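(* Let $k$ be a positive integer. Then $S^+(4)\cap A^+(4)=\{0\}$ in $S_{k+1/2}(\Gamma_0(4))$.
   Context: $S_{k+1/2}(\Gamma_0(4))$ is the space of holomorphic cusp forms $f$ on the upper half plane with $f(\alpha z)=j(\alpha,z)^{2k+1}f(z)$ for $\alpha=\begin{pmatrix}a&b\\c&d\end{pmatrix}\in\Gamma_0(4)$, where $j(\alpha,z)=\varepsilon_d^{-1}\left(\frac cd\right)(cz+d)^{1/2}$, $\varepsilon_d=1$ or $i$ as $d\equiv1$ or $3\pmod4$, square roots have argument in $(-\pi/2,\pi/2]$, $\left(\frac cd\right)$ is Shimura's quadratic symbol. $\widetilde W_4$ is the involution $\widetilde W_4(f)(z)=\left(\frac2{2k+1}\right)(-2iz)^{-k-1/2}f(-1/4z)$ on $S_{k+1/2}(\Gamma_0(4))$, and $U_4(\sum a_nq^n)=\sum a_{4n}q^n$. $S^+(4)$ is Kohnen's plus space: the forms $\sum a_nq^n\in S_{k+1/2}(\Gamma_0(4))$ with $a_n=0$ unless $(-1)^kn\equiv0,1\pmod4$; equivalently (Kohnen) the $2$-eigenspace of $\widetilde Q'_2=2^{1-k}\widetilde W_4U_4$. $A^+(4)=\widetilde W_4S^+(4)$. *)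

theory Defs
  imports "HOL-Analysis.Analysis" "HOL-Number_Theory.Number_Theory"
begin

abbreviation upper_half_plane :: "complex set" ("\<H>")
  where "\<H> \<equiv> {z. Im z > 0}"

text \<open>
  Shimura's quadratic symbol \<open>(c/d)\<close>, for odd \<open>d\<close> of either sign: the Jacobi symbol of \<open>c\<close>
  modulo \<open>\<bar>d\<bar>\<close>, with an extra sign when \<open>c\<close> and \<open>d\<close> are both negative.
  In particular \<open>(0/1) = (0/-1) = 1\<close>, as the product is then empty.
\<close>

definition shimura_symbol :: "int \<Rightarrow> int \<Rightarrow> int" where
  "shimura_symbol c d =
     (if c < 0 \<and> d < 0 then -1 else 1) *
     (\<Prod>p\<in>#prime_factorization (nat \<bar>d\<bar>). Legendre c (int p))"

definition theta_eps :: "int \<Rightarrow> complex" where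
  "theta_eps d = (if d mod 4 = 1 then 1 else \<i>)"

text \<open>
  The factor \<open>j(\<alpha>, z)\<close>, which depends only on the lower row \<open>(c, d)\<close> of \<open>\<alpha>\<close>. The values of
  \<^const>\<open>csqrt\<close> have argument in \<open>(-\<pi>/2, \<pi>/2]\<close>; throughout, \<open>w\<close> to the power \<open>m/2\<close>
  means \<open>csqrt w\<close> to the power \<open>m\<close>.
\<close>

definition theta_j :: "int \<Rightarrow> int \<Rightarrow> complex \<Rightarrow> complex" where
  "theta_j c d z =
     inverse (theta_eps d) * of_int (shimura_symbol c d) * csqrt (of_int c * z + of_int d)"

definition moebius :: "int \<Rightarrow> int \<Rightarrow> int \<Rightarrow> int \<Rightarrow> complex \<Rightarrow> complex" where
  "moebius a b c d z = (of_int a * z + of_int b) / (of_int c * z + of_int d)"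

text \<open>
  Vanishing at all cusps. Every cusp is the image of \<open>\<infinity>\<close> under some matrix in \<open>SL\<^sub>2(\<int>)\<close>, so we ask
  that each transform of \<open>f\<close> by such a matrix has a Fourier expansion with positive exponents
  only. The choice of the branch of \<open>(cz + d)\<^sup>1\<^sup>/\<^sup>2\<close> does not matter here. At an irregular cusp of
  width \<open>w\<close> the exponents of the expansion are \<open>(n + r)/w\<close> with \<open>4r\<close> an integer; they are of the
  form \<open>m/h\<close> for \<open>h = 4w\<close>, so that integers \<open>n\<close> suffice below.
\<close>

definition vanishes_at_cusps :: "nat \<Rightarrow> (complex \<Rightarrow> complex) \<Rightarrow> bool" where
  "vanishes_at_cusps k f \<longleftrightarrow>
     (\<forall>a b c d :: int. a * d - b * c = 1 \<longrightarrow>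
       (\<exists>(h::nat) (u :: nat \<Rightarrow> complex). h > 0 \<and> u 0 = 0 \<and>
         (\<forall>z\<in>\<H>. (\<lambda>n. u n * exp (2 * of_real pi * \<i> * of_nat n * z / of_nat h)) sums
           (f (moebius a b c d z) / csqrt (of_int c * z + of_int d) ^ (2 * k + 1)))))"

text \<open>
  The space \<open>S\<^bsub>k+1/2\<^esub>(\<Gamma>\<^sub>0(4))\<close>. Functions on the upper half plane are represented by functions on
  \<open>\<complex>\<close> that are \<open>0\<close> elsewhere, so that equality of forms is equality of functions.
\<close>

definition cusp_forms :: "nat \<Rightarrow> (complex \<Rightarrow> complex) set" where
  "cusp_forms k = {f.
     (\<forall>z. z \<notin> \<H> \<longrightarrow> f z = 0) \<and>
     f holomorphic_on \<H> \<and>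
     (\<forall>a b c d :: int. a * d - b * c = 1 \<longrightarrow> 4 dvd c \<longrightarrow>
        (\<forall>z\<in>\<H>. f (moebius a b c d z) = theta_j c d z ^ (2 * k + 1) * f z)) \<and>
     vanishes_at_cusps k f}"

definition W4 :: "nat \<Rightarrow> (complex \<Rightarrow> complex) \<Rightarrow> complex \<Rightarrow> complex" where
  "W4 k f z =
     (if z \<in> \<H>
      then of_int (shimura_symbol 2 (2 * int k + 1)) *
           inverse (csqrt (- 2 * \<i> * z) ^ (2 * k + 1)) * f (- 1 / (4 * z))
      else 0)"

definition plus_space :: "nat \<Rightarrow> (complex \<Rightarrow> complex) set" where
  "plus_space k = {f \<in> cusp_forms k.
     \<exists>a :: nat \<Rightarrow> complex.
       (\<forall>z\<in>\<H>. (\<lambda>n. a n * exp (2 * of_real pi * \<i> * z) ^ n) sums f z) \<and>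
       (\<forall>n. ((-1) ^ k * int n) mod 4 \<notin> {0, 1} \<longrightarrow> a n = 0)}"

definition A_plus_space :: "nat \<Rightarrow> (complex \<Rightarrow> complex) set" where
  "A_plus_space k = W4 k ` plus_space k"

end

theory Submission
  imports Defs "HOL-Probability.Probability" "HOL-Complex_Analysis.Complex_Analysis" "HOL-Real_Asymp.Real_Asymp"
begin

text \<open>
  On a plus form \<open>f\<close> the operators \<open>U4\<close> and \<open>W4\<close> agree up to a nonzero scalar: this follows from the
  transformation behaviour under the matrices with lower row \<open>(4, 1)\<close> and \<open>(-4, 1)\<close>. Hence \<open>U4\<close>
  exchanges a form in the intersection with its \<open>W4\<close>-preimage up to scalars, and it suffices to show
  that a plus form \<open>f = \<Sum> a n * q ^ n\<close> with \<open>a (4 * n) = l * a n\<close> vanishes. Applying the inversion twice gives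
  \<open>l\<^sup>2 = 4 ^ k\<close>, so \<open>a 0 = 0\<close>. The functions \<open>f (z/2)\<close>, \<open>f ((z+1)/2)\<close> and \<open>f (z/8) / l - f (z/2)\<close> are
  permuted by the full modular group up to automorphy factors, which bounds
  \<open>(Im z) powr (k/2 + 1/4) * norm (f z)\<close>.

  For \<open>k = 1\<close> the plus condition gives \<open>a 0 = a 1 = a 2 = 0\<close>, and then comparing the maximum at
  heights \<open>y\<close> and \<open>y/2\<close> shows that this bound can be improved by a factor less than 1, so \<open>f = 0\<close>.

  For \<open>k \<ge> 2\<close> let \<open>t\<close> be the least index with \<open>a t \<noteq> 0\<close>. Theta has no zeros, so \<open>f z / theta (t * z)\<close> is
  holomorphic, of weight \<open>k\<close> with a quadratic character. Its Hecke transforms are the coefficients of a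
  symmetric two-variable kernel, whose diagonal yields a Shimura lift \<open>F\<close> of weight \<open>2 * k\<close> with
  leading coefficient \<open>a t\<close> and \<open>F (z/2) + F ((z+1)/2) = 2 * l * F z\<close>. If \<open>F\<close> is nonzero, then
  \<open>(Im z) ^ k * norm (F z)\<close> attains its maximum at some \<open>z0\<close>. As \<open>norm l = 2 ^ k\<close>, it also attains it at
  all \<open>(z0 + b) / 2 ^ n\<close>; but some of these points are equivalent to points arbitrarily high up,
  where the function tends to 0.
\<close>

section \<open>Fourier coefficients and Poisson summation\<close>

text \<open>The multiplier of theta is not computed from Gauss sums: a nonzero form with Shimura's
  factor already forces theta to have it, because the quotient of the actual and the expected factor
  has an odd power and its fourth power equal to 1. In the same way the character of
  \<open>f z / theta (t * z)\<close> is seen to be periodic and multiplicative from the behaviour of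
  that function, without reciprocity.

  The kernel originates in the coefficients \<open>a (t * n\<^sup>2)\<close>. With \<open>qc\<close>
  the coefficients of the quotient by theta, such a coefficient is the sum over \<open>m\<close> of
  \<open>qc (t * (n\<^sup>2 - m\<^sup>2))\<close>, and factoring the difference of squares makes it
  a sum of entries \<open>qc (t * i * j)\<close> with \<open>i + j = 2 * n\<close>, in an array
  symmetric in \<open>i\<close> and \<open>j\<close>.

  Taking \<open>t\<close> least makes \<open>f\<close> vanish at every cusp at least as fast as
  theta at \<open>t * z\<close>, so that \<open>qc\<close> grows polynomially.

  The available growth bound for the lift gives decay at the cusps only when \<open>3/2 - k\<close>
  is negative. This is why \<open>k = 1\<close> needs its own argument, in which a zero of order 3
  just outweighs the factor \<open>2 powr (3/4)\<close>.\<close>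

lemma fourier_coeffs_polynomial_mult:
  fixes p :: "complex \<Rightarrow> real" and h :: "real \<Rightarrow> complex"
  assumes "real_polynomial_function p" "continuous_on {0..1} h"
    and "\<And>m::int. integral {0..1} (\<lambda>x. h x * cis (2 * pi * m * x)) = 0"
  shows "integral {0..1} (\<lambda>x. p (cis (2 * pi * x)) * h x * cis (2 * pi * of_int m * x)) = 0"
  using assms
proof (induction p arbitrary: h m rule: real_polynomial_function.induct)
  case (linear f h m)
  define A where "A = (f 1 - \<i> * f \<i>) / 2"
  define B where "B = (f 1 + \<i> * f \<i>) / 2"
  \<comment> \<open>On the circle a real linear form is a combination of \<open>cis t\<close> and
    \<open>cis (-t)\<close>, so multiplying by it only shifts the frequency by one in either
    direction.\<close>
  have lin: "complex_of_real (f (cis t)) = A * cis t + B * cis (-t)" for t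
  proof -
    have "cis t = cos t *\<^sub>R 1 + sin t *\<^sub>R \<i>" by (simp add: complex_eq_iff)
    then have "f (cis t) = cos t * f 1 + sin t * f \<i>"
      using linear_add[OF bounded_linear.linear[OF linear(1)]]
        linear_scale[OF bounded_linear.linear[OF linear(1)]] by simp
    then show ?thesis
      by (simp add: A_def B_def complex_eq_iff field_simps)
  qed
  have "(\<lambda>x. f (cis (2 * pi * x)) * h x * cis (2 * pi * of_int m * x)) =
     (\<lambda>x. A * (h x * cis (2 * pi * of_int (m+1) * x)) + B * (h x * cis (2 * pi * of_int (m-1) * x)))"
    unfolding lin by (auto simp: fun_eq_iff algebra_simps cis_mult)
  moreover have "(\<lambda>x. h x * cis (2 * pi * of_int k * x)) integrable_on {0..1}" for k
    by (intro integrable_continuous_interval continuous_intros linear)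
  then have "(\<lambda>x. c * (h x * cis (2 * pi * of_int k * x))) integrable_on {0..1}" for k and c :: complex
    by (rule integrable_on_mult_right)
  ultimately show ?case
    using linear(3)[of "m+1"] linear(3)[of "m-1"] 
    by (simp add: Henstock_Kurzweil_Integration.integral_add del: of_int_add of_int_diff)
next
  case (const c h m)
  then show ?case by (simp add: mult.assoc)
next
  case (add f g h m)
  have "(\<lambda>x. q (cis (2 * pi * x)) * h x * cis (2 * pi * of_int m * x)) integrable_on {0..1}"
    if "real_polynomial_function q" for q
    by (intro integrable_continuous_interval continuous_intros add
        continuous_on_compose2[OF continuous_on_polymonial_function[of q]])
      (use that in \<open>auto simp: real_polynomial_function_eq\<close>)
  with add show ?case
    by (simp add: algebra_simps Henstock_Kurzweil_Integration.integral_add)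
next
  case (mult f g h m)
  have "continuous_on {0..1} (\<lambda>x. complex_of_real (g (cis (2 * pi * x))) * h x)"
    by (intro continuous_intros mult 
        continuous_on_compose2[OF continuous_on_polymonial_function[of g]])
      (use mult in \<open>auto simp: real_polynomial_function_eq\<close>)
  from mult.IH(1)[OF this] mult.IH(2)[OF mult.prems] show ?case
    by (simp add: mult_ac)
qed

text \<open>Weierstrass approximation on the circle: \<open>q * D\<close> has integral 0 for every
  polynomial \<open>q\<close>, so the integral of \<open>D ^ 2\<close> equals that of
  \<open>(D - q) * D\<close>, which can be made arbitrarily small.\<close>

lemma fourier_coeffs_zero_imp_zero:
  fixes D :: "real \<Rightarrow> real"
  assumes cont: "continuous_on {0..1} D" and per: "D 0 = D 1"
    and coeff: "\<And>m::int. integral {0..1} (\<lambda>x. D x * cis (2 * pi * m * x)) = 0"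
    and x: "x \<in> {0..1}"
  shows "D x = 0"
proof -
  let ?p = "\<lambda>x. cis (2 * pi * x)"
  define g where "g u = D (Arg2pi u / (2 * pi))" for u
  have gD: "g (?p x) = D x" if "x \<in> {0..1}" for x
  proof (cases "x = 1")
    case True
    then show ?thesis using per by (simp add: g_def Arg2pi_of_real[of 1, simplified])
  next
    case False
    then have "Arg2pi (?p x) = 2 * pi * x"
      using that by (intro Arg2pi_unique[of 1]) (auto simp: cis_conv_exp)
    then show ?thesis by (simp add: g_def)
  qed
  have img: "?p ` {0..1} = sphere 0 1"
  proof
    show "sphere 0 1 \<subseteq> ?p ` {0..1}"
    proof
      fix u :: complex assume "u \<in> sphere 0 1"
      then have "u = ?p (Arg2pi u / (2 * pi))"
        using Arg2pi_eq[of u] by (simp add: cis_conv_exp)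
      moreover have "Arg2pi u / (2 * pi) \<in> {0..1}"
        using Arg2pi_ge_0[of u] Arg2pi_lt_2pi[of u] by (auto simp: field_simps)
      ultimately show "u \<in> ?p ` {0..1}" by blast
    qed
  qed auto
  have contp: "continuous_on {0..1} ?p" by (intro continuous_intros)
  \<comment> \<open>By compactness the wrapping of the interval onto the circle is a quotient map.
    This gives continuity of \<open>g\<close> without treating the jump of
    \<open>Arg2pi\<close>.\<close>
  have gcont: "continuous_on (sphere 0 1) g"
    unfolding continuous_on_open_gen[of g "sphere 0 1" UNIV, simplified]
  proof (intro allI impI)
    fix U :: "real set" assume U: "open U"
    have "openin (top_of_set {0..1}) ({0..1} \<inter> ?p -` (sphere 0 1 \<inter> g -` U))"
    proof -
      have "{0..1} \<inter> ?p -` (sphere 0 1 \<inter> g -` U) = {0..1} \<inter> D -` U"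
        using gD img by auto
      moreover have "openin (top_of_set {0..1}) ({0..1} \<inter> D -` U)"
        using cont U by (simp add: continuous_on_open_gen[of D "{0..1}" UNIV])
      ultimately show ?thesis by simp
    qed
    then show "openin (top_of_set (sphere 0 1)) (sphere 0 1 \<inter> g -` U)"
      using Abstract_Topology_2.continuous_imp_quotient_map[OF contp img, of "sphere 0 1 \<inter> g -` U"] by auto
  qed
  have "integral {0..1} (\<lambda>x. D x ^ 2) \<le> 0 + e" if "e > 0" for e
  proof -
    obtain B where B: "\<And>x. x \<in> {0..1} \<Longrightarrow> \<bar>D x\<bar> \<le> B" "B > 0"
    proof -
      have "bounded (D ` {0..1})" using cont by (intro compact_imp_bounded compact_continuous_image) auto
      then obtain b where "b > 0" "\<forall>y\<in>D ` {0..1}. norm y \<le> b" unfolding bounded_pos by auto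
      then show ?thesis using that[of b] by simp
    qed
    obtain q where q: "real_polynomial_function q" "\<And>u. u \<in> sphere 0 1 \<Longrightarrow> \<bar>g u - q u\<bar> < e / B"
      using Stone_Weierstrass_real_polynomial_function[OF compact_sphere gcont, of "e / B"] \<open>e > 0\<close> B(2)
      by (metis divide_pos_pos)
    have qc: "continuous_on {0..1} (\<lambda>x. q (?p x))"
      by (intro continuous_intros continuous_on_compose2[OF continuous_on_polymonial_function[of q]])
        (use q in \<open>auto simp: real_polynomial_function_eq\<close>)
    have i1: "(\<lambda>x. D x * D x) integrable_on {0..1}" "(\<lambda>x. q (?p x) * D x) integrable_on {0..1}"
      by (intro integrable_continuous_interval continuous_intros cont qc)+
    have "integral {0..1} (\<lambda>x. complex_of_real (q (?p x)) * complex_of_real (D x) * cis (2 * pi * of_int 0 * x)) = 0"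
      by (rule fourier_coeffs_polynomial_mult[OF q(1)]) (auto intro!: continuous_intros cont coeff)
    then have "integral {0..1} (\<lambda>x. complex_of_real (q (?p x) * D x)) = 0"
      by simp
    then have z: "integral {0..1} (\<lambda>x. q (?p x) * D x) = 0"
      using integral_unique[OF has_integral_of_real[OF integrable_integral[OF i1(2)], where 'b=complex]]
      by simp
    have "integral {0..1} (\<lambda>x. D x ^ 2) = integral {0..1} (\<lambda>x. (D x - q (?p x)) * D x)"
      using z i1 by (simp add: left_diff_distrib Henstock_Kurzweil_Integration.integral_diff power2_eq_square)
    also have "\<dots> \<le> integral {0..1} (\<lambda>x::real. e)"
    proof (rule integral_le)
      show "(\<lambda>x. (D x - q (?p x)) * D x) integrable_on {0..1}"
        using i1 by (simp add: left_diff_distrib integrable_diff)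
      fix x :: real assume x: "x \<in> {0..1}"
      have "\<bar>(D x - q (?p x)) * D x\<bar> \<le> e / B * B"
        unfolding abs_mult using q(2)[of "?p x"] gD[OF x] B x by (intro mult_mono) auto
      then show "(D x - q (?p x)) * D x \<le> e" using B by auto
    qed auto
    finally show ?thesis by simp
  qed
  then have le: "integral {0..1} (\<lambda>x. D x ^ 2) \<le> 0" by (rule field_le_epsilon)
  have c2: "continuous_on {0..1} (\<lambda>x. D x ^ 2)"
    by (intro continuous_intros cont)
  have "integral {0..1} (\<lambda>x. D x ^ 2) \<ge> 0"
    by (rule Henstock_Kurzweil_Integration.integral_nonneg[OF integrable_continuous_interval[OF c2]]) simp
  with le have "integral {0..1} (\<lambda>x. D x ^ 2) = 0" by (rule antisym)
  then have "D x ^ 2 = 0"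
    using integral_eq_0_iff[OF c2] x by simp
  then show ?thesis by simp
qed

text \<open>This is the characteristic function of the standard normal distribution, rescaled by
  \<open>c = sqrt (2 * pi * s)\<close>.\<close>

lemma gaussian_fourier_transform:
  fixes s m :: real
  assumes s: "s > 0"
  shows "has_bochner_integral lborel (\<lambda>u. of_real (exp (- pi * s * u\<^sup>2)) * cis (2 * pi * m * u))
           (complex_of_real (exp (- pi * m\<^sup>2 / s) / sqrt s))"
proof -
  define c where "c = sqrt (2 * pi * s)"
  have c: "c > 0" "c\<^sup>2 = 2 * pi * s" using s by (auto simp: c_def)
  define t where "t = 2 * pi * m / c"
  have d: "std_normal_density (0 + c * u) = exp (- pi * s * u\<^sup>2) / sqrt (2 * pi)" for u
    using c(2) by (simp add: std_normal_density_def power_mult_distrib)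
  have ft: "(LINT x|lborel. std_normal_density x *\<^sub>R iexp (t * x)) = exp (- t\<^sup>2 / 2)"
    using fun_cong[OF char_std_normal_distribution, of t]
    unfolding char_def by (subst (asm) integral_density) auto
  have "integrable lborel (\<lambda>x. std_normal_density x *\<^sub>R iexp (t * x))"
    by (rule Bochner_Integration.integrable_bound[OF integrable_std_normal_moment_abs[of 0]]) auto
  with ft have "has_bochner_integral lborel (\<lambda>x. std_normal_density x *\<^sub>R iexp (t * x)) (exp (- t\<^sup>2 / 2))"
    by (simp add: has_bochner_integral_iff)
  then have "has_bochner_integral lborel (\<lambda>u. std_normal_density (0 + c * u) *\<^sub>R iexp (t * (0 + c * u)))
       (complex_of_real (exp (- t\<^sup>2 / 2)) /\<^sub>R \<bar>c\<bar>)"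
    by (subst (asm) lborel_has_bochner_integral_real_affine_iff[of c _ _ 0]) (use c in auto)
  then have "has_bochner_integral lborel (\<lambda>u. sqrt (2 * pi) *\<^sub>R (std_normal_density (0 + c * u) *\<^sub>R iexp (t * (0 + c * u))))
       (sqrt (2 * pi) *\<^sub>R (complex_of_real (exp (- t\<^sup>2 / 2)) /\<^sub>R \<bar>c\<bar>))"
    by (intro has_bochner_integral_scaleR_right)
  moreover have "sqrt (2 * pi) *\<^sub>R (std_normal_density (0 + c * u) *\<^sub>R iexp (t * (0 + c * u)))
      = of_real (exp (- pi * s * u\<^sup>2)) * cis (2 * pi * m * u)" for u
    unfolding d using c by (simp add: t_def cis_conv_exp scaleR_conv_of_real field_simps)
  moreover have "t\<^sup>2 / 2 = pi * m\<^sup>2 / s"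
    using s c unfolding t_def power_divide c(2) by (simp add: field_simps power2_eq_square)
  moreover have "sqrt (2 * pi) / c = 1 / sqrt s"
    using s by (simp add: c_def real_sqrt_mult)
  ultimately show ?thesis using c
    by (simp add: scaleR_conv_of_real field_simps flip: of_real_mult of_real_divide)
qed

lemma integral_cis_period:
  "integral {0..1} (\<lambda>x. cis (2 * pi * of_int j * x)) = (if j = 0 then 1 else 0)"
proof (cases "j = 0")
  case False
  have "((\<lambda>x. cis (2 * pi * of_int j * x)) has_integral 
      (cis (2 * pi * of_int j * 1) / (2 * pi * \<i> * j) - cis (2 * pi * of_int j * 0) / (2 * pi * \<i> * j))) {0..1}"
  proof (intro fundamental_theorem_of_calculus)
    fix x :: real
    have "((\<lambda>z. exp (\<i> * (2 * pi * j * z)) / (2 * pi * \<i> * j)) has_field_derivative 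
        exp (\<i> * (2 * pi * j * of_real x))) (at (of_real x))"
      using False by (auto intro!: derivative_eq_intros)
    from has_vector_derivative_real_field[OF this]
    show "((\<lambda>x. cis (2 * pi * of_int j * x) / (2 * pi * \<i> * j)) has_vector_derivative
        cis (2 * pi * of_int j * x)) (at x within {0..1})"
      by (simp add: cis_conv_exp)
  qed auto
  moreover have "cis (2 * pi * of_int j * 1) = 1"
    using cis_multiple_2pi[of "of_int j"] by simp
  ultimately show ?thesis using False by (simp add: integral_unique)
qed simp

lemma gaussian_truncated_integral:
  fixes s m :: real
  assumes s: "s > 0"
  defines "H \<equiv> \<lambda>u. complex_of_real (exp (- pi * s * u\<^sup>2)) * cis (2 * pi * m * u)"
  shows "(\<lambda>N. integral {- real N..real N} H) \<longlonglongrightarrow> of_real (exp (- pi * m\<^sup>2 / s) / sqrt s)"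
proof -
  have hb: "has_bochner_integral lborel H (of_real (exp (- pi * m\<^sup>2 / s) / sqrt s))"
    unfolding H_def by (rule gaussian_fourier_transform[OF s])
  have meas: "H \<in> borel_measurable lborel"
    using hb by (rule has_bochner_integral_iff[THEN iffD1, THEN conjunct1, THEN borel_measurable_integrable])
  have "(\<lambda>N. LINT u|lborel. indicator {- real N..real N} u *\<^sub>R H u) \<longlonglongrightarrow> (LINT u|lborel. H u)"
  proof (rule integral_dominated_convergence[where w = "\<lambda>u. norm (H u)"])
    show "integrable lborel (\<lambda>u. norm (H u))"
      using hb by (simp add: has_bochner_integral_iff)
    show "AE u in lborel. (\<lambda>N. indicator {- real N..real N} u *\<^sub>R H u) \<longlonglongrightarrow> H u"
    proof (intro always_eventually allI)
      fix u :: real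
      have "eventually (\<lambda>N. indicator {- real N..real N} u *\<^sub>R H u = H u) sequentially"
        using eventually_ge_at_top[of "nat \<lceil>\<bar>u\<bar>\<rceil>"]
        by eventually_elim (auto simp: indicator_def)
      then show "(\<lambda>N. indicator {- real N..real N} u *\<^sub>R H u) \<longlonglongrightarrow> H u"
        by (rule tendsto_eventually)
    qed
  qed (use meas in \<open>auto simp: indicator_def\<close>)
  moreover have "(LINT u|lborel. indicator {- real N..real N} u *\<^sub>R H u) = integral {- real N..real N} H" for N
  proof -
    have "set_integrable lborel {- real N..real N} H"
      unfolding set_integrable_def using hb by (intro integrable_mult_indicator) (auto simp: has_bochner_integral_iff)
    from set_borel_integral_eq_integral(2)[OF this] show ?thesis
      by (simp add: set_lebesgue_integral_def)
  qed
  ultimately show ?thesis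
    using hb by (simp add: has_bochner_integral_iff)
qed

text \<open>The \<open>n\<close>-th summand covers the unit intervals that start at \<open>n\<close>
  and at \<open>- n - 1\<close>.\<close>

lemma sum_shifted_integrals:
  fixes H :: "real \<Rightarrow> complex"
  assumes H: "continuous_on UNIV H"
  shows "(\<Sum>n<N. integral {0..1} (\<lambda>x. H (x + real n) + H (x - 1 - real n))) = integral {- real N..real N} H"
proof (induction N)
  case (Suc N)
  have i: "H integrable_on {a..b}" for a b
    by (intro integrable_continuous_interval continuous_on_subset[OF H]) auto
  have c: "(\<lambda>x. H (x + c)) integrable_on {0..1}" for c
    by (intro integrable_continuous_interval continuous_on_compose2[OF H] continuous_intros) auto
  have sh: "integral {0..1} (\<lambda>x. H (x + c)) = integral {c..1+c} H" for c
    using integral_shift_real_ivl[of c c "1+c" H] by simp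
  have e1: "integral {0..1} (\<lambda>x. H (x + real N) + H (x - 1 - real N)) = 
     integral {real N..1 + real N} H + integral {-1-real N..-real N} H"
    using sh[of "real N"] sh[of "-1-real N"] c[of "real N"] c[of "-1-real N"]
    by (simp add: Henstock_Kurzweil_Integration.integral_add algebra_simps)
  have e2: "integral {- real N..real N} H + integral {real N..1+real N} H = integral {- real N..1+real N} H"
    by (rule Henstock_Kurzweil_Integration.integral_combine) (auto intro: i)
  have e3: "integral {-1 - real N..-real N} H + integral {-real N..1+real N} H = integral {-1 - real N..1+real N} H"
    by (rule Henstock_Kurzweil_Integration.integral_combine) (auto intro: i)
  have "integral {- real N..real N} H + (integral {real N..1 + real N} H + integral {-1-real N..-real N} H) =
     integral {-1-real N..1+real N} H"
    unfolding add.assoc[symmetric] e2 using e3 by (simp only: add.commute)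
  moreover have "- real (Suc N) = -1 - real N" "real (Suc N) = 1 + real N" by auto
  ultimately show ?case
    unfolding sum.lessThan_Suc Suc.IH e1 by simp
qed simp

lemma integral_uniform_limit_mult:
  fixes f :: "nat \<Rightarrow> real \<Rightarrow> real" and q :: "real \<Rightarrow> complex"
  assumes u: "uniform_limit {0..1} f g sequentially" and c: "\<And>n. continuous_on {0..1} (f n)"
    and q: "continuous_on {0..1} q"
  shows "(\<lambda>n. integral {0..1} (\<lambda>x. f n x * q x)) \<longlonglongrightarrow> integral {0..1} (\<lambda>x. g x * q x)"
proof -
  have g: "continuous_on {0..1} g"
    by (rule uniform_limit_theorem[OF _ u]) (use c in auto)
  have bd: "bounded (p ` {0..1})" if "continuous_on {0..1} p" for p :: "real \<Rightarrow> complex"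
    using that by (intro compact_imp_bounded compact_continuous_image) auto
  have "uniform_limit {0..1} (\<lambda>n x. complex_of_real (f n x)) (\<lambda>x. complex_of_real (g x)) sequentially"
    by (intro bounded_linear_uniform_limit_intros u)
  then have "uniform_limit {0..1} (\<lambda>n x. f n x * q x) (\<lambda>x. g x * q x) sequentially"
    by (intro uniform_lim_mult uniform_limit_const bd continuous_intros g q)
  moreover have "continuous_on {0..1} (\<lambda>x. f n x * q x)" for n
    by (intro continuous_intros c q)
  ultimately obtain I J where IJ: "\<And>n. ((\<lambda>x. f n x * q x) has_integral I n) {0..1}"
    "((\<lambda>x. g x * q x) has_integral J) {0..1}" "I \<longlonglongrightarrow> J"
    by (rule uniform_limit_integral[OF _ _ sequentially_bot]) (rule that)
  have "(\<lambda>n. integral {0..1} (\<lambda>x. f n x * q x)) = I"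
    using integral_unique[OF IJ(1)] by (rule ext)
  with IJ show ?thesis by (simp add: integral_unique)
qed

lemma gaussian_exp_bound:
  assumes "c > 0" shows "exp (- c * (real n)\<^sup>2) \<le> exp (- c) ^ n"
proof -
  have "real n \<le> (real n)\<^sup>2" by (cases n) (auto simp: power2_eq_square field_simps)
  then have "c * real n \<le> c * (real n)\<^sup>2" using assms by (intro mult_left_mono) auto
  then show ?thesis by (simp add: exp_of_nat_mult[symmetric] mult.commute)
qed

lemma summable_gaussian: "c > 0 \<Longrightarrow> summable (\<lambda>n. exp (- c * (real n)\<^sup>2))"
  by (rule summable_comparison_test'[OF summable_geometric[of "exp (-c)"], of 0])
    (use gaussian_exp_bound in auto)

text \<open>\<open>g\<close> is the Gaussian summed over all integer shifts and
  \<open>d / sqrt s\<close> is its Fourier series, with opposite frequencies combined. Both are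
  continuous with equal Fourier coefficients, hence equal; the claim is their equality at 0.\<close>

lemma poisson_gaussian:
  assumes s: "s > 0"
  shows "1 + 2 * (\<Sum>n. exp (- pi * s * (real (Suc n))\<^sup>2)) =
     (1 + 2 * (\<Sum>n. exp (- pi / s * (real (Suc n))\<^sup>2))) / sqrt s"
proof -
  define h where "h u = exp (- pi * s * u\<^sup>2)" for u :: real
  \<comment> \<open>The shifts by \<open>n\<close> and by \<open>- 1 - n\<close> are paired because
    on the unit interval both arguments then have absolute value at least \<open>n\<close>, which
    gives a uniform geometric majorant.\<close>
  define gn where "gn N x = (\<Sum>n<N. h (x + real n) + h (x - 1 - real n))" for N x
  define g where "g x = (\<Sum>n. h (x + real n) + h (x - 1 - real n))" for x
  define e where "e n = exp (- pi / s * (real n)\<^sup>2)" for n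
  define dn where "dn N x = (\<Sum>n<N. (if n = 0 then 1 else 2 * e n) * cos (2 * pi * real n * x))" for N x
  define d where "d x = (\<Sum>n. (if n = 0 then 1 else 2 * e n) * cos (2 * pi * real n * x))" for x
  have hb: "h u \<le> exp (- (pi * s)) ^ n" if "\<bar>u\<bar> \<ge> real n" for u n
  proof -
    have "(real n)\<^sup>2 \<le> \<bar>u\<bar>\<^sup>2" using that by (intro power_mono) auto
    then have "pi * s * (real n)\<^sup>2 \<le> pi * s * u\<^sup>2" using s by (intro mult_left_mono) auto
    then have "h u \<le> exp (- (pi * s) * (real n)\<^sup>2)" by (simp add: h_def)
    also have "\<dots> \<le> exp (- (pi * s)) ^ n" using s by (intro gaussian_exp_bound) auto
    finally show ?thesis .
  qed
  have ugn: "uniform_limit {0..1} gn g sequentially"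
    unfolding gn_def[abs_def] g_def[abs_def]
  proof (rule Weierstrass_m_test)
    fix n :: nat and x :: real assume x: "x \<in> {0..1}"
    have "h (x + real n) \<le> exp (- (pi * s)) ^ n" "h (x - 1 - real n) \<le> exp (- (pi * s)) ^ n"
      using x by (auto intro!: hb)
    moreover have "h u \<ge> 0" for u by (simp add: h_def)
    ultimately show "norm (h (x + real n) + h (x - 1 - real n)) \<le> 2 * exp (- (pi * s)) ^ n"
      by (simp add: abs_of_nonneg add_nonneg_nonneg)
  next
    show "summable (\<lambda>n. 2 * exp (- (pi * s)) ^ n)"
      using s by (intro summable_mult summable_geometric) auto
  qed
  have eb: "e n \<le> exp (- (pi / s)) ^ n" "e n > 0" for n
    using gaussian_exp_bound[of "pi / s" n] s by (auto simp: e_def)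
  have udn: "uniform_limit {0..1} dn d sequentially"
    unfolding dn_def[abs_def] d_def[abs_def]
  proof (rule Weierstrass_m_test)
    fix n :: nat and x :: real
    have "norm ((if n = 0 then 1 else 2 * e n) * cos (2 * pi * real n * x)) \<le> \<bar>if n = 0 then 1 else 2 * e n\<bar> * 1"
      unfolding real_norm_def abs_mult by (intro mult_left_mono) auto
    also have "\<dots> \<le> 2 * exp (- (pi / s)) ^ n" using eb[of n] by auto
    finally show "norm ((if n = 0 then 1 else 2 * e n) * cos (2 * pi * real n * x)) \<le> 2 * exp (- (pi / s)) ^ n" .
  next
    show "summable (\<lambda>n. 2 * exp (- (pi / s)) ^ n)"
      using s by (intro summable_mult summable_geometric) auto
  qed
  have cg: "continuous_on {0..1} (gn N)" and cd: "continuous_on {0..1} (dn N)" for N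
    unfolding gn_def[abs_def] dn_def[abs_def] h_def by (intro continuous_intros)+
  have cgl: "continuous_on {0..1} g" and cdl: "continuous_on {0..1} d"
    by (rule uniform_limit_theorem[OF _ ugn] uniform_limit_theorem[OF _ udn]; use cg cd in auto)+
  define D where "D x = g x - d x / sqrt s" for x
  have "D 0 = 0"
  proof (rule fourier_coeffs_zero_imp_zero[of D])
    show "continuous_on {0..1} D" unfolding D_def by (intro continuous_intros cgl cdl) (use s in auto)
    have "h (1 + real n) + h (1 - 1 - real n) = h (0 + real n) + h (0 - 1 - real n)" for n
      by (simp add: h_def power2_eq_square algebra_simps)
    then have "g 0 = g 1" by (simp add: g_def del: add_0)
    moreover have "cos (2 * pi * real n) = 1" for n
      using cos_int_2pin[of "int n"] by (simp add: mult_ac)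
    then have "d 0 = d 1" by (simp add: d_def)
    ultimately show "D 0 = D 1" by (simp add: D_def)
    fix m :: int
    let ?q = "\<lambda>x. cis (2 * pi * m * x)"
    have cq: "continuous_on {0..1} ?q" by (intro continuous_intros)
    have "(\<lambda>N. integral {0..1} (\<lambda>x. gn N x * ?q x)) \<longlonglongrightarrow> of_real (exp (- pi * (real_of_int m)\<^sup>2 / s) / sqrt s)"
    proof -
      define H where "H = (\<lambda>u. complex_of_real (exp (- pi * s * u\<^sup>2)) * cis (2 * pi * m * u))"
      have per: "cis (2 * pi * m * (x + real n)) = ?q x" "cis (2 * pi * m * (x - 1 - real n)) = ?q x" for x n
      proof -
        have "cis (2 * pi * m * (x + of_int j)) = ?q x" for j :: int
          using cis_multiple_2pi[of "of_int (m * j)"] by (simp add: ring_distribs cis_mult[symmetric] mult_ac)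
        from this[of "int n"] this[of "- 1 - int n"]
        show "cis (2 * pi * m * (x + real n)) = ?q x" "cis (2 * pi * m * (x - 1 - real n)) = ?q x" by (auto simp: algebra_simps)
      qed
      have "integral {0..1} (\<lambda>x. gn N x * ?q x) = integral {- real N..real N} H" for N
      proof -
        have "(\<lambda>x. gn N x * ?q x) = (\<lambda>x. \<Sum>n<N. H (x + real n) + H (x - 1 - real n))"
          unfolding gn_def H_def per h_def by (simp add: sum_distrib_right ring_distribs)
        moreover have cH: "continuous_on UNIV H" unfolding H_def by (intro continuous_intros)
        have "integral {0..1} (\<lambda>x. \<Sum>n<N. H (x + real n) + H (x - 1 - real n)) = 
           (\<Sum>n<N. integral {0..1} (\<lambda>x. H (x + real n) + H (x - 1 - real n)))"
          by (intro integral_sum integrable_continuous_interval continuous_intros continuous_on_compose2[OF cH]) auto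
        ultimately show ?thesis using sum_shifted_integrals[OF cH] by simp
      qed
      then show ?thesis using gaussian_truncated_integral[OF s, of m] unfolding H_def by simp
    qed
    with integral_uniform_limit_mult[OF ugn cg cq] 
    have ig: "integral {0..1} (\<lambda>x. g x * ?q x) = of_real (exp (- pi * (real_of_int m)\<^sup>2 / s) / sqrt s)"
      by (rule LIMSEQ_unique)
    have "(\<lambda>N. integral {0..1} (\<lambda>x. dn N x * ?q x)) \<longlonglongrightarrow> of_real (exp (- pi * (real_of_int m)\<^sup>2 / s))"
    proof (rule tendsto_eventually, use eventually_gt_at_top[of "nat \<bar>m\<bar>"] in eventually_elim)
      fix N assume N: "nat \<bar>m\<bar> < N"
      have t: "integral {0..1} (\<lambda>x. complex_of_real ((if n = 0 then 1 else 2 * e n) * cos (2 * pi * real n * x)) * ?q x)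
         = (if n = nat \<bar>m\<bar> then of_real (e n) else 0)" for n
      proof -
        have eq: "complex_of_real ((if n = 0 then 1 else 2 * e n) * cos (2 * pi * real n * x)) * ?q x =
           (if n = 0 then 1/2 else of_real (e n)) * cis (2 * pi * of_int (m + int n) * x) + 
           (if n = 0 then 1/2 else of_real (e n)) * cis (2 * pi * of_int (m - int n) * x)" for x
          by (auto simp: complex_eq_iff ring_distribs cos_add sin_add cos_diff sin_diff)
        have "(\<lambda>x. c * cis (2 * pi * of_int j * x)) integrable_on {0..1}" for c :: complex and j :: int
          by (intro integrable_continuous_interval continuous_intros)
        then show ?thesis
          unfolding eq by (subst Henstock_Kurzweil_Integration.integral_add)
            (auto simp: integral_cis_period e_def simp del: of_int_add of_int_diff)
      qed
      have "integral {0..1} (\<lambda>x. dn N x * ?q x) = (\<Sum>n<N. if n = nat \<bar>m\<bar> then complex_of_real (e n) else 0)"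
        unfolding dn_def of_real_sum sum_distrib_right t[symmetric]
        by (intro integral_sum integrable_continuous_interval continuous_intros) auto
      also have "\<dots> = of_real (exp (- pi * (real_of_int m)\<^sup>2 / s))"
        using N by (simp add: sum.delta e_def)
      finally show "integral {0..1} (\<lambda>x. dn N x * ?q x) = of_real (exp (- pi * (real_of_int m)\<^sup>2 / s))" .
    qed
    with integral_uniform_limit_mult[OF udn cd cq] 
    have id: "integral {0..1} (\<lambda>x. d x * ?q x) = of_real (exp (- pi * (real_of_int m)\<^sup>2 / s))"
      by (rule LIMSEQ_unique)
    have "(\<lambda>x. of_real (g x) * ?q x) integrable_on {0..1}" "(\<lambda>x. (of_real (d x) * ?q x) * (1 / sqrt s)) integrable_on {0..1}"
      by (intro integrable_continuous_interval continuous_intros cgl cdl)+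
    then show "integral {0..1} (\<lambda>x. D x * ?q x) = 0"
      using ig id unfolding D_def 
      by (simp add: left_diff_distrib Henstock_Kurzweil_Integration.integral_diff)
  qed auto
  have sm: "summable (\<lambda>n. exp (- c * (real n)\<^sup>2))" "summable (\<lambda>n. exp (- c * (real (Suc n))\<^sup>2))" if "c > 0" for c
    using summable_gaussian[OF that] summable_ignore_initial_segment[OF summable_gaussian[OF that], of 1] by auto
  have "g 0 = (\<Sum>n. exp (- (pi * s) * (real n)\<^sup>2) + exp (- (pi * s) * (real (Suc n))\<^sup>2))"
    unfolding g_def h_def by (simp add: power2_eq_square algebra_simps)
  also have "\<dots> = (\<Sum>n. exp (- (pi * s) * (real n)\<^sup>2)) + (\<Sum>n. exp (- (pi * s) * (real (Suc n))\<^sup>2))"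
    using s by (intro suminf_add[symmetric] sm) auto
  also have "(\<Sum>n. exp (- (pi * s) * (real n)\<^sup>2)) = 1 + (\<Sum>n. exp (- (pi * s) * (real (Suc n))\<^sup>2))"
    using s by (subst suminf_split_head[OF sm(1)]) auto
  finally have g0: "g 0 = 1 + 2 * (\<Sum>n. exp (- pi * s * (real (Suc n))\<^sup>2))" by simp
  have "norm (if n = 0 then 1 else 2 * e n) \<le> 2 * exp (- (pi / s)) ^ n" for n
    using eb[of n] by auto
  then have "summable (\<lambda>n. if n = 0 then 1 else 2 * e n)"
    by (rule summable_comparison_test'[rotated]) (use s in \<open>auto intro!: summable_mult summable_geometric\<close>)
  from suminf_split_head[OF this] have "d 0 = 1 + (\<Sum>n. 2 * e (Suc n))"
    unfolding d_def by simp
  also have "\<dots> = 1 + 2 * (\<Sum>n. e (Suc n))"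
    using sm(2)[of "pi / s"] s by (subst suminf_mult) (auto simp: e_def)
  finally have "d 0 = 1 + 2 * (\<Sum>n. exp (- pi / s * (real (Suc n))\<^sup>2))"
    by (simp add: e_def)
  with g0 \<open>D 0 = 0\<close> show ?thesis by (simp add: D_def)
qed

section \<open>Power series in the nome\<close>

definition qexp :: "complex \<Rightarrow> complex" where "qexp z = exp (2 * of_real pi * \<i> * z)"

text \<open>Convergence on the open unit disc is what a \<open>q\<close>-expansion valid on the
  whole upper half plane amounts to.\<close>

definition unit_series :: "(nat \<Rightarrow> complex) \<Rightarrow> bool" where
  "unit_series a \<longleftrightarrow> (\<forall>x. norm x < 1 \<longrightarrow> summable (\<lambda>n. a n * x ^ n))"

definition pseries :: "(nat \<Rightarrow> complex) \<Rightarrow> complex \<Rightarrow> complex" where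
  "pseries a x = (\<Sum>n. a n * x ^ n)"

definition qseries :: "(nat \<Rightarrow> complex) \<Rightarrow> complex \<Rightarrow> complex" where
  "qseries a z = pseries a (qexp z)"

lemma norm_qexp: "norm (qexp z) = exp (- 2 * pi * Im z)"
  by (simp add: qexp_def)

lemma norm_qexp_less_1_iff: "norm (qexp z) < 1 \<longleftrightarrow> Im z > 0"
  unfolding norm_qexp by (auto simp: zero_less_mult_iff)

lemma qexp_nonzero [simp]: "qexp z \<noteq> 0" by (simp add: qexp_def)

lemma qexp_add: "qexp (z + w) = qexp z * qexp w"
  by (simp add: qexp_def ring_distribs exp_add)

lemma qexp_of_nat_mult: "qexp (of_nat n * z) = qexp z ^ n"
  unfolding qexp_def exp_of_nat_mult[symmetric] by (simp add: mult_ac)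

lemma qexp_of_int [simp]: "qexp (of_int n) = 1"
  unfolding qexp_def by (subst exp_eq_1) (auto simp: intro!: exI[of _ n])

lemma qexp_of_nat [simp]: "qexp (of_nat n) = 1"
  using qexp_of_int[of "int n"] by simp

lemma qexp_1 [simp]: "qexp 1 = 1" and qexp_0 [simp]: "qexp 0 = 1"
  using qexp_of_int[of 1] qexp_of_int[of 0] by simp_all

lemma qexp_half [simp]: "qexp (1/2) = -1"
  by (simp add: qexp_def exp_Euler)

lemma qexp_holomorphic [holomorphic_intros]:
  "f holomorphic_on S \<Longrightarrow> (\<lambda>z. qexp (f z)) holomorphic_on S"
  unfolding qexp_def by (intro holomorphic_intros)

lemma qexp_surj:
  assumes "x \<noteq> 0" obtains z where "qexp z = x"
proof
  show "qexp (Ln x / (2 * of_real pi * \<i>)) = x"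
    using assms by (simp add: qexp_def)
qed

lemma unit_series_abs_summable:
  assumes "unit_series a" "norm x < 1"
  shows "summable (\<lambda>n. norm (a n * x ^ n))"
proof -
  obtain r where r: "norm x < r" "r < 1" using assms(2) dense by blast
  then have "r > 0" using norm_ge_zero[of x] by linarith
  then have "summable (\<lambda>n. a n * of_real r ^ n)"
    using assms(1) r by (auto simp: unit_series_def)
  then show ?thesis
    by (rule powser_insidea) (use r \<open>r > 0\<close> in auto)
qed

lemma pseries_sums: "unit_series a \<Longrightarrow> norm x < 1 \<Longrightarrow> (\<lambda>n. a n * x ^ n) sums pseries a x"
  unfolding pseries_def unit_series_def by (simp add: summable_sums)

lemma qseries_sums: "unit_series a \<Longrightarrow> Im z > 0 \<Longrightarrow> (\<lambda>n. a n * qexp z ^ n) sums qseries a z"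
  unfolding qseries_def by (rule pseries_sums) (auto simp: norm_qexp_less_1_iff)

lemma pseries_holomorphic: "unit_series a \<Longrightarrow> pseries a holomorphic_on ball 0 1"
  by (rule power_series_holomorphic[of _ _ a]) (use pseries_sums in auto)

lemma qseries_holomorphic: "unit_series a \<Longrightarrow> qseries a holomorphic_on \<H>"
  unfolding qseries_def
  by (rule holomorphic_on_compose_gen[OF _ pseries_holomorphic, unfolded o_def])
    (auto intro!: holomorphic_intros simp: norm_qexp_less_1_iff)

lemma qseries_add_1 [simp]: "qseries a (z + 1) = qseries a z" "qseries a (1 + z) = qseries a z"
  by (simp_all add: qseries_def qexp_add)

lemma qseries_add_of_int [simp]: "qseries a (z + of_int n) = qseries a z"
  by (simp add: qseries_def qexp_add)

lemma open_upper_half_plane: "open \<H>"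
  by (simp add: open_halfspace_Im_gt)

lemma convex_upper_half_plane: "convex \<H>"
  by (simp add: convex_halfspace_Im_gt)

lemma unit_series_0: "unit_series (\<lambda>_. 0)" by (simp add: unit_series_def)

lemma unit_seriesI_of_upper_half_plane:
  assumes "\<And>z. Im z > 0 \<Longrightarrow> summable (\<lambda>n. a n * qexp z ^ n)"
  shows "unit_series a"
  unfolding unit_series_def
proof (intro allI impI)
  fix x :: complex assume x: "norm x < 1"
  show "summable (\<lambda>n. a n * x ^ n)"
  proof (cases "x = 0")
    case False
    then obtain z where "qexp z = x" by (rule qexp_surj)
    then show ?thesis using assms[of z] x norm_qexp_less_1_iff[of z] by auto
  qed (auto intro: summable_finite[of "{0}"])
qed

lemma unit_series_of_holomorphic:
  assumes "f holomorphic_on ball 0 1"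
  obtains a where "unit_series a" "\<And>x. norm x < 1 \<Longrightarrow> pseries a x = f x"
proof -
  define a where "a n = (deriv ^^ n) f 0 / fact n" for n
  have "(\<lambda>n. a n * x ^ n) sums f x" if "norm x < 1" for x
    using holomorphic_power_series[OF assms, of x] that by (simp add: a_def)
  then have "unit_series a" "\<And>x. norm x < 1 \<Longrightarrow> pseries a x = f x"
    by (auto simp: unit_series_def pseries_def sums_iff)
  then show ?thesis using that by blast
qed

text \<open>The hypothesis leaves out 0 because \<open>qexp\<close> never takes that value; the
  point is recovered by continuity.\<close>

lemma pseries_unique:
  assumes a: "unit_series a" and b: "unit_series b"
    and eq: "\<And>x. norm x < 1 \<Longrightarrow> x \<noteq> 0 \<Longrightarrow> pseries a x = pseries b x"
  shows "a = b"
proof -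
  define c where "c n = a n - b n" for n
  have c: "unit_series c"
    using a b by (auto simp: unit_series_def left_diff_distrib c_def intro: summable_diff)
  have zero: "pseries c x = 0" if "norm x < 1" "x \<noteq> 0" for x
    using sums_diff[OF pseries_sums[OF a that(1)] pseries_sums[OF b that(1)]] eq[OF that]
    by (simp add: c_def pseries_def sums_iff algebra_simps)
  have "isCont (pseries c) 0"
    using holomorphic_on_imp_continuous_on[OF pseries_holomorphic[OF c]]
    by (rule continuous_on_interior) auto
  then have "pseries c \<midarrow>0\<rightarrow> pseries c 0" by (simp add: isCont_def)
  moreover have "pseries c \<midarrow>0\<rightarrow> 0"
    by (rule tendsto_eventually) (use zero in \<open>auto simp: eventually_at intro!: exI[of _ 1]\<close>)
  ultimately have "pseries c 0 = 0" by (rule tendsto_unique[OF at_neq_bot])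
  have "c n = 0" for n
  proof (cases "n = 0")
    case True
    then show ?thesis using \<open>pseries c 0 = 0\<close> by (simp add: pseries_def)
  next
    case False
    show ?thesis
    proof (rule ccontr)
      assume "c n \<noteq> 0"
      have "\<exists>s>0. \<forall>z\<in>cball 0 s - {0}. pseries c z \<noteq> 0"
        by (rule powser_0_nonzero[of 1 0 c "pseries c" n])
          (use \<open>c n \<noteq> 0\<close> False \<open>pseries c 0 = 0\<close> pseries_sums[OF c] in auto)
      then obtain s where s: "s > 0" "\<And>z. z \<in> cball 0 s - {0} \<Longrightarrow> pseries c z \<noteq> 0" by blast
      have "pseries c (of_real (min s (1/2))) = 0"
        using s by (intro zero) auto
      then show False using s(2)[of "of_real (min s (1/2))"] s(1) by auto
    qed
  qed
  then show ?thesis by (auto simp: c_def)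
qed

lemma qseries_unique:
  assumes "unit_series a" "unit_series b" "\<And>z. Im z > 0 \<Longrightarrow> qseries a z = qseries b z"
  shows "a = b"
proof (rule pseries_unique[OF assms(1,2)])
  fix x :: complex assume x: "norm x < 1" "x \<noteq> 0"
  obtain z where "qexp z = x" using x(2) by (rule qexp_surj)
  then show "pseries a x = pseries b x"
    using assms(3)[of z] x norm_qexp_less_1_iff[of z] by (auto simp: qseries_def)
qed

lemma pseries_coeff_bound:
  assumes a: "unit_series a" and r: "0 < r" "r < 1"
    and B: "\<And>x. norm x = r \<Longrightarrow> norm (pseries a x) \<le> B"
  shows "norm (a n) \<le> B / r ^ n"
proof -
  obtain r' where r': "r < r'" "r' < 1" using r dense by blast
  have hol: "pseries a holomorphic_on ball 0 r'"
    using pseries_holomorphic[OF a] r' by (rule_tac holomorphic_on_subset) auto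
  have ho: "pseries a holomorphic_on ball 0 1" by (rule pseries_holomorphic[OF a])
  have "unit_series (\<lambda>n. (deriv ^^ n) (pseries a) 0 / fact n)"
    unfolding unit_series_def using holomorphic_power_series[OF ho] by (auto simp: sums_iff)
  then have "a = (\<lambda>n. (deriv ^^ n) (pseries a) 0 / fact n)"
    by (rule pseries_unique[OF a])
      (use holomorphic_power_series[OF ho] in \<open>auto simp: pseries_def sums_iff\<close>)
  then have "norm (a n) = norm ((deriv ^^ n) (pseries a) 0) / fact n"
    by (metis norm_divide norm_fact)
  also have "norm ((deriv ^^ n) (pseries a) 0) \<le> fact n * B / r ^ n"
  proof (rule Cauchy_inequality)
    show "pseries a holomorphic_on ball 0 r" using hol r' by (rule_tac holomorphic_on_subset) auto
    show "continuous_on (cball 0 r) (pseries a)"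
      using holomorphic_on_imp_continuous_on[OF hol] r' by (rule_tac continuous_on_subset) auto
  qed (use r B in auto)
  finally show ?thesis by (simp add: divide_right_mono)
qed

section \<open>The theta series and its inversion formula\<close>

definition theta_coeff :: "nat \<Rightarrow> complex" where
  "theta_coeff n = (if n = 0 then 1 else if \<exists>m. n = m\<^sup>2 then 2 else 0)"

lemma summable_power_squares:
  fixes x :: complex
  assumes "norm x < 1" shows "summable (\<lambda>m. x ^ (Suc m)\<^sup>2)"
proof (rule summable_comparison_test'[of "\<lambda>m. norm x ^ m" 0])
  show "norm (x ^ (Suc m)\<^sup>2) \<le> norm x ^ m" for m
    unfolding norm_power by (rule power_decreasing) (use assms in \<open>auto simp: power2_eq_square\<close>)
qed (use assms in \<open>auto simp: summable_geometric\<close>)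

lemma theta_coeff_sums:
  assumes "norm x < 1"
  shows "(\<lambda>n. theta_coeff n * x ^ n) sums (1 + 2 * (\<Sum>m. x ^ (Suc m)\<^sup>2))"
proof -
  have "(\<lambda>m. 2 * x ^ (Suc m)\<^sup>2) sums (2 * (\<Sum>m. x ^ (Suc m)\<^sup>2))"
    by (intro sums_mult summable_sums summable_power_squares assms)
  then have "(\<lambda>m. theta_coeff ((Suc m)\<^sup>2) * x ^ (Suc m)\<^sup>2) sums (2 * (\<Sum>m. x ^ (Suc m)\<^sup>2))"
    by (rule sums_cong[THEN iffD1, rotated]) (auto simp: theta_coeff_def)
  then have "(\<lambda>m. theta_coeff (m\<^sup>2) * x ^ m\<^sup>2) sums (2 * (\<Sum>m. x ^ (Suc m)\<^sup>2) + theta_coeff (0\<^sup>2) * x ^ 0\<^sup>2)"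
    by (subst (asm) sums_Suc_iff) auto
  then have "(\<lambda>m. theta_coeff (m\<^sup>2) * x ^ m\<^sup>2) sums (1 + 2 * (\<Sum>m. x ^ (Suc m)\<^sup>2))"
    by (simp add: theta_coeff_def add.commute)
  then show ?thesis
    by (subst (asm) sums_mono_reindex[of "\<lambda>m. m\<^sup>2" "\<lambda>n. theta_coeff n * x ^ n"])
      (auto simp: theta_coeff_def strict_mono_def power_strict_mono)
qed

lemma unit_series_theta: "unit_series theta_coeff"
  unfolding unit_series_def using theta_coeff_sums by (auto simp: sums_iff)

text \<open>On the imaginary axis this is Poisson summation with \<open>s = 2 / y\<close>; both
  sides are holomorphic, so it extends to the half plane. The factor is
  \<open>csqrt (- 2 * \<i> * t) / 2\<close>.\<close>

lemma theta_inversion: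
  assumes "Im t > 0"
  shows "qseries theta_coeff (-1/t) = (1 - \<i>) / 2 * csqrt t * qseries theta_coeff (t/4)"
proof -
  let ?S = "(\<lambda>y. \<i> * complex_of_real y) ` {0<..}"
  have real: "qseries theta_coeff (-1/t) - (1 - \<i>) / 2 * csqrt t * qseries theta_coeff (t/4) = 0"
    if t: "t = \<i> * of_real y" and y: "y > 0" for t y
  proof -
    have e: "qseries theta_coeff (\<i> * of_real u) = of_real (1 + 2 * (\<Sum>n. exp (- pi * (2 * u) * (real (Suc n))\<^sup>2)))" if "u > 0" for u
    proof -
      have q: "qexp (\<i> * of_real u) = of_real (exp (-2 * pi * u))"
        by (simp add: qexp_def flip: exp_of_real) (simp add: algebra_simps flip: exp_of_real)
      have "norm (qexp (\<i> * of_real u)) < 1" using that by (simp add: norm_qexp_less_1_iff)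
      note th = theta_coeff_sums[OF this]
      have pw: "qexp (\<i> * of_real u) ^ (Suc n)\<^sup>2 = of_real (exp (- pi * (2 * u) * (real (Suc n))\<^sup>2))" for n
      proof -
        have "exp (- 2 * pi * u) ^ (Suc n)\<^sup>2 = exp (- pi * (2 * u) * (real (Suc n))\<^sup>2)"
          by (subst exp_of_nat_mult[symmetric]) (simp add: mult_ac del: of_nat_Suc)
        then show ?thesis unfolding q of_real_power[symmetric] by simp
      qed
      have "summable (\<lambda>n. exp (- (pi * (2 * u)) * (real (Suc n))\<^sup>2))"
        using summable_ignore_initial_segment[OF summable_gaussian[of "pi * (2 * u)"], of 1] that by simp
      then have "(\<Sum>n. complex_of_real (exp (- pi * (2 * u) * (real (Suc n))\<^sup>2))) = of_real (\<Sum>n. exp (- pi * (2 * u) * (real (Suc n))\<^sup>2))"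
        by (intro suminf_of_real[symmetric]) simp
      with th show ?thesis
        unfolding pw by (simp add: qseries_def pseries_def sums_iff)
    qed
    define A where "A = 1 + 2 * (\<Sum>n. exp (- pi * (2 * (1/y)) * (real (Suc n))\<^sup>2))"
    define B where "B = 1 + 2 * (\<Sum>n. exp (- pi * (2 * (y/4)) * (real (Suc n))\<^sup>2))"
    have t1: "-1/t = \<i> * of_real (1/y)" and t2: "t / 4 = \<i> * of_real (y/4)" using t y by (simp_all add: field_simps)
    have "csqrt t = of_real (sqrt (y / 2)) * (1 + \<i>)"
      by (rule csqrt_unique) (use t y in \<open>auto simp: power2_eq_square field_simps complex_eq_iff\<close>)
    moreover have "A = sqrt (y / 2) * B"
      using poisson_gaussian[of "2 / y"] y by (simp add: A_def B_def real_sqrt_divide field_simps)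
    moreover have "qseries theta_coeff (-1/t) = of_real A" "qseries theta_coeff (t/4) = of_real B"
      unfolding t1 t2 using e[of "1/y"] e[of "y/4"] y by (simp_all only: A_def B_def) simp_all
    ultimately show ?thesis
      by (simp add: complex_eq_iff)
  qed
  have hol: "(\<lambda>t. qseries theta_coeff (-1/t) - (1 - \<i>) / 2 * csqrt t * qseries theta_coeff (t/4)) holomorphic_on \<H>"
  proof (intro holomorphic_intros)
    show "(\<lambda>t. qseries theta_coeff (-1/t)) holomorphic_on \<H>"
      by (rule holomorphic_on_compose_gen[OF _ qseries_holomorphic[OF unit_series_theta], unfolded o_def])
        (auto intro!: holomorphic_intros divide_pos_pos add_nonneg_pos simp: Im_divide)
    show "(\<lambda>t. qseries theta_coeff (t/4)) holomorphic_on \<H>"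
      by (rule holomorphic_on_compose_gen[OF _ qseries_holomorphic[OF unit_series_theta], unfolded o_def])
        (auto intro!: holomorphic_intros)
  qed (auto simp: complex_nonpos_Reals_iff)
  have "qseries theta_coeff (-1/t) - (1 - \<i>) / 2 * csqrt t * qseries theta_coeff (t/4) = 0"
  proof (rule analytic_continuation[OF hol open_upper_half_plane convex_connected[OF convex_upper_half_plane], of ?S "\<i>"])
    show "\<i> islimpt ?S"
    proof (rule islimptI)
      fix T :: "complex set" assume T: "\<i> \<in> T" "open T"
      then obtain e where e: "e > 0" "ball \<i> e \<subseteq> T" using open_contains_ball by blast
      have "\<i> * of_real (1 + e / 2) \<in> ball \<i> e"
        using e by (simp add: dist_norm algebra_simps norm_mult)
      moreover have "\<i> * of_real (1 + e / 2) \<noteq> \<i>" using e by (simp add: algebra_simps)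
      moreover have "\<i> * of_real (1 + e / 2) \<in> ?S" using e by (intro imageI) auto
      ultimately show "\<exists>y\<in>?S. y \<in> T \<and> y \<noteq> \<i>" using e(2) by blast
    qed
  qed (use real assms in auto)
  then show ?thesis by simp
qed

section \<open>Moebius transformations\<close>

lemma moebius_denom_nonzero:
  assumes "Im z > 0" "c \<noteq> 0 \<or> d \<noteq> 0"
  shows "of_int c * z + of_int d \<noteq> (0::complex)"
proof
  assume *: "of_int c * z + of_int d = 0"
  then have "Im (of_int c * z + of_int d) = 0" by (metis zero_complex.sel(2))
  then have "c = 0" using assms(1) by simp
  with * assms show False by simp
qed

lemma det_imp_row_nonzero:
  fixes a b c d :: int
  assumes "a * d - b * c \<noteq> 0" shows "c \<noteq> 0 \<or> d \<noteq> 0"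
  using assms by auto

lemma Im_moebius:
  assumes "Im z > 0" "a * d - b * c \<noteq> 0"
  shows "Im (moebius a b c d z) = of_int (a * d - b * c) * Im z / (norm (of_int c * z + of_int d))\<^sup>2"
proof -
  have "Im ((of_int a * z + of_int b) * cnj (of_int c * z + of_int d)) = of_int (a * d - b * c) * Im z"
    by (simp add: algebra_simps)
  then show ?thesis
    unfolding moebius_def by (subst complex_div_cnj) (simp add: Im_divide_of_real flip: of_real_power)
qed

lemma Im_moebius_pos:
  assumes "Im z > 0" "a * d - b * c > 0" shows "Im (moebius a b c d z) > 0"
proof -
  have "of_int (a * d - b * c) > (0::real)" using assms(2) by (simp only: of_int_0_less_iff)
  then show ?thesis
    using assms moebius_denom_nonzero[OF assms(1) det_imp_row_nonzero[of a d b c]]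
    by (subst Im_moebius) (auto intro!: divide_pos_pos mult_pos_pos)
qed

text \<open>The outer matrix is arbitrary: where its denominator vanishes, both sides are 0 by
  division by zero.\<close>

lemma moebius_compose:
  assumes "Im z > 0" "a' * d' - b' * c' > 0"
  shows "moebius a b c d (moebius a' b' c' d' z) =
     moebius (a * a' + b * c') (a * b' + b * d') (c * a' + d * c') (c * b' + d * d') z"
proof -
  have nz: "of_int c' * z + of_int d' \<noteq> (0::complex)"
    by (rule moebius_denom_nonzero[OF assms(1) det_imp_row_nonzero[of a' d' b']]) (use assms in auto)
  show ?thesis
  proof (cases "of_int c * moebius a' b' c' d' z + of_int d = 0")
    case True
    then have "(of_int c * (of_int a' * z + of_int b') + of_int d * (of_int c' * z + of_int d')) = (0::complex)"
      using nz by (simp add: moebius_def field_simps)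
    with True show ?thesis by (simp add: moebius_def[of a] moebius_def[of "a * a' + b * c'"] algebra_simps)
  next
    case False
    then have "(of_int c * (of_int a' * z + of_int b') + of_int d * (of_int c' * z + of_int d')) \<noteq> (0::complex)"
      using nz by (simp add: moebius_def field_simps)
    with False nz show ?thesis
      by (simp add: moebius_def divide_simps) (simp add: algebra_simps)?
  qed
qed

lemma Im_neg_inverse_pos: "Im z > 0 \<Longrightarrow> Im (-1/z) > 0"
  by (auto simp: Im_divide intro!: divide_pos_pos add_nonneg_pos)

lemma moebius_id [simp]: "moebius 1 0 0 1 z = z"
  by (simp add: moebius_def)

lemma moebius_translate: "moebius a (b + n * a) c (d + n * c) z = moebius a b c d (z + of_int n)"
  by (simp add: moebius_def algebra_simps)

lemma moebius_invert:
  assumes "z \<noteq> 0" shows "moebius b (-a) d (-c) z = moebius a b c d (-1/z)"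
proof -
  have "moebius a b c d (-1/z) = (z * (of_int a * (-1/z) + of_int b)) / (z * (of_int c * (-1/z) + of_int d))"
    using assms by (simp add: moebius_def)
  also have "\<dots> = moebius b (-a) d (-c) z" using assms by (simp add: moebius_def algebra_simps)
  finally show ?thesis by simp
qed

text \<open>Euclid's algorithm on the lower row. The steps are right multiplications by the
  translation, its inverse and the inversion, so that a property of \<open>moebius a b c d z\<close>
  is propagated by changing the argument \<open>z\<close>.\<close>

lemma SL2_induct [consumes 1, case_names id T T_inv S]:
  assumes "a * d - b * c = (1::int)"
    and id: "P 1 0 0 1"
    and T: "\<And>a b c d. P a b c d \<Longrightarrow> P a (b + a) c (d + c)"
    and T_inv: "\<And>a b c d. P a b c d \<Longrightarrow> P a (b - a) c (d - c)"
    and S: "\<And>a b c d. P a b c d \<Longrightarrow> P b (-a) d (-c)"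
  shows "P a b c d"
  using assms(1)
proof (induction "nat \<bar>c\<bar>" arbitrary: a b c d rule: less_induct)
  case less
  have Tn: "P a (b + n * a) c (d + n * c)" if "P a b c d" for a b c d n
  proof (induction n rule: int_induct[of _ 0])
    case (step1 i)
    then show ?case using T[OF step1(2)] by (simp add: algebra_simps)
  next
    case (step2 i)
    then show ?case using T_inv[OF step2(2)] by (simp add: algebra_simps)
  qed (use that in simp)
  show ?case
  proof (cases "c = 0")
    case True
    then have "a = 1 \<and> d = 1 \<or> a = -1 \<and> d = -1"
      using less.prems by (auto simp: zmult_eq_1_iff)
    moreover have "P (-1) 0 0 (-1)" using S[OF S[OF id]] by simp
    ultimately show ?thesis using True Tn[OF id, of b] Tn[of "-1" 0 0 "-1" "-b"] by auto
  next
    case False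
    define q where "q = d div c"
    define r where "r = d mod c"
    have d: "d = q * c + r" by (simp add: q_def r_def)
    have "\<bar>r\<bar> < \<bar>c\<bar>" using False abs_mod_less[of c d] by (simp add: r_def)
    moreover have "- (b - q * a) * c - a * (-r) = 1" using less.prems d by (simp add: algebra_simps)
    ultimately have "P (- (b - q * a)) a (- r) c"
      by (intro less.hyps) auto
    from Tn[OF S[OF this], of q] show ?thesis using d by (simp add: add.commute)
  qed
qed

text \<open>Below height 1/2, once the real part is centred, the squared norm is at most 1/2, so the
  inversion at least doubles the imaginary part. The number of doublings still needed bounds the
  recursion.\<close>

lemma reduce_to_Im_ge_half:
  assumes "Im z > 0"
  obtains a b c d w where "a * d - b * c = (1::int)" "Im w \<ge> 1 / 2" "z = moebius a b c d w"
proof -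
  have "\<exists>a b c d w. a * d - b * c = (1::int) \<and> Im w \<ge> 1 / 2 \<and> z = moebius a b c d w"
    if "Im z > 0" "Im z * 2 ^ n \<ge> 1 / 2" for n z
    using that
  proof (induction n arbitrary: z)
    case 0
    then show ?case
      by (intro exI[of _ 1] exI[of _ 0] exI[of _ 0] exI[of _ 1] exI[of _ z]) simp
  next
    case (Suc n)
    show ?case
    proof (cases "Im z \<ge> 1 / 2")
      case True
      then show ?thesis
        by (intro exI[of _ 1] exI[of _ 0] exI[of _ 0] exI[of _ 1] exI[of _ z]) simp
    next
      case False
      define m where "m = \<lfloor>Re z + 1 / 2\<rfloor>"
      define z1 where "z1 = z - of_int m"
      have "\<bar>Re z1\<bar> \<le> 1 / 2" unfolding z1_def m_def by (simp add: abs_if) linarith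
      then have "(Re z1)\<^sup>2 \<le> (1 / 2)\<^sup>2" by (simp add: abs_le_square_iff[symmetric])
      moreover have "(Im z1)\<^sup>2 \<le> (1 / 2)\<^sup>2"
        using False Suc.prems(1) by (intro power_mono) (auto simp: z1_def)
      ultimately have nz: "(norm z1)\<^sup>2 \<le> 1 / 2"
        by (simp add: cmod_power2 power_divide)
      have im1: "Im z1 = Im z" by (simp add: z1_def)
      with Suc.prems have "z1 \<noteq> 0" by auto
      define w1 where "w1 = -1 / z1"
      have "Im w1 = Im z / (norm z1)\<^sup>2"
        using im1 by (simp add: w1_def Im_divide cmod_power2)
      moreover have "Im z / (norm z1)\<^sup>2 \<ge> Im z / (1 / 2)"
        using nz \<open>z1 \<noteq> 0\<close> Suc.prems by (intro divide_left_mono) auto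
      ultimately have w1: "Im w1 \<ge> 2 * Im z" by simp
      then have "Im w1 * 2 ^ n \<ge> 2 * Im z * 2 ^ n" by (intro mult_right_mono) auto
      moreover have "2 * Im z * 2 ^ n = Im z * 2 ^ Suc n" by simp
      ultimately have "Im w1 > 0" "Im w1 * 2 ^ n \<ge> 1 / 2" using Suc.prems w1 by linarith+
      from Suc.IH[OF this] obtain a b c d w where
        *: "a * d - b * c = (1::int)" "Im w \<ge> 1 / 2" "w1 = moebius a b c d w" by blast
      have "z = of_int m - 1 / w1" using \<open>z1 \<noteq> 0\<close> by (simp add: w1_def z1_def)
      also have "\<dots> = moebius m (-1) 1 0 w1"
        using \<open>z1 \<noteq> 0\<close> by (simp add: moebius_def w1_def field_simps)
      also have "\<dots> = moebius (m * a - c) (m * b - d) a b w"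
        using * by (simp add: moebius_compose)
      finally show ?thesis using *
        by (intro exI[of _ "m * a - c"] exI[of _ "m * b - d"] exI[of _ a] exI[of _ b] exI[of _ w])
          (auto simp: algebra_simps)
    qed
  qed
  moreover obtain n :: nat where "1 / 2 / Im z < 2 ^ n"
    using real_arch_pow[of 2] by auto
  ultimately show ?thesis using that assms
    by (metis (no_types, lifting) less_eq_real_def mult.commute pos_divide_less_eq)
qed

lemma csqrt_mult_of_real:
  assumes "r \<ge> 0" shows "csqrt (of_real r * z) = of_real (sqrt r) * csqrt z"
proof (cases "r = 0 \<or> z = 0")
  case False
  show ?thesis
  proof (rule csqrt_unique)
    show "(of_real (sqrt r) * csqrt z)\<^sup>2 = of_real r * z"
      using assms by (simp add: power_mult_distrib flip: of_real_power)
    show "0 < Re (of_real (sqrt r) * csqrt z) \<or> Re (of_real (sqrt r) * csqrt z) = 0 \<and> 0 \<le> Im (of_real (sqrt r) * csqrt z)"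
      using csqrt_principal[of z] assms False by auto
  qed
qed auto

lemma norm_csqrt_power:
  assumes "z \<noteq> 0" shows "norm (csqrt z ^ (2 * k + 1)) = norm z powr (real k + 1 / 2)"
proof -
  have "norm (csqrt z ^ (2 * k + 1)) = (norm z powr (1 / 2)) powr real (2 * k + 1)"
    using assms powr_realpow[of "norm z powr (1 / 2)" "2 * k + 1"]
    by (simp only: norm_power norm_csqrt powr_half_sqrt norm_ge_zero) simp
  then show ?thesis by (simp add: powr_powr field_simps)
qed

section \<open>Eigenforms under inversion\<close>

text \<open>\<open>(a + c, b + d)\<close> is the row vector \<open>(1, 1)\<close> times the matrix,
  and an invertible matrix keeps it nonzero modulo 2.\<close>

lemma det_1_imp_odd:
  fixes a b c d :: int
  assumes "a * d - b * c = 1" shows "odd (a + c) \<or> odd (b + d)"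
proof (rule ccontr)
  assume "\<not> ?thesis"
  then have "even (a + c)" "even (b + d)" by auto
  moreover have "a * d - b * c = a * (b + d) - b * (a + c)" by (simp add: algebra_simps)
  ultimately show False using assms by (metis dvd_diff dvd_mult odd_one)
qed

text \<open>The locale covers plus eigenforms and, with \<open>k = 0\<close> and
  \<open>l = 1\<close>, theta itself. The values of \<open>norm C\<close> and
  \<open>l\<^sup>2\<close> are those for which the inversion permutes the branches without changing
  invariant sizes.\<close>

locale weil_series =
  fixes k :: nat and a :: "nat \<Rightarrow> complex" and l C :: complex
  assumes unit: "unit_series a"
    and coeff_mult_4: "\<And>n. a (4 * n) = l * a n"
    and coeff_2_mod_4: "\<And>n. n mod 4 = 2 \<Longrightarrow> a n = 0"
    and inversion: "\<And>t. Im t > 0 \<Longrightarrow>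
      qseries a (-1/t) = C * csqrt t ^ (2 * k + 1) * qseries a (t/4)"
    and norm_C: "norm C = 2 powr - (real k + 1/2)"
    and l_squared: "l\<^sup>2 = 4 ^ k"
begin

lemma l_nonzero: "l \<noteq> 0" and norm_l: "norm l = 2 ^ k"
proof -
  show "l \<noteq> 0" using l_squared by auto
  have "norm (l\<^sup>2) = (2 ^ k)\<^sup>2" unfolding l_squared
    using power_mult[of "2::real" 2 k] power_even_eq[of "2::real" k] by (simp add: norm_power)
  then show "norm l = 2 ^ k" by (simp add: norm_power power2_eq_iff_nonneg)
qed

text \<open>
  The index \<open>(u, v)\<close> of a branch matters only modulo 2. Up to factors of absolute value 1, the
  inversion and the translation permute the functions \<open>pet u v\<close> as they permute the nonzero vectors
  modulo 2.
\<close>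

definition branch :: "int \<Rightarrow> int \<Rightarrow> complex \<Rightarrow> complex" where
  "branch u v z = (if even u then qseries a (z/8) / l - qseries a (z/2)
     else if even v then qseries a ((z + 1)/2) else qseries a (z/2))"

definition pet :: "int \<Rightarrow> int \<Rightarrow> complex \<Rightarrow> real" where
  "pet u v z = norm (branch u v z) * Im z powr (real k / 2 + 1/4)"

text \<open>The support consists of multiples of 4 and odd numbers. The first part is
  \<open>l\<close> times the series at \<open>4 * z\<close>; adding 1/2 to \<open>z\<close> flips
  the sign of the second.\<close>

lemma qseries_sections:
  assumes "Im z > 0" 
  shows "(\<lambda>n. a n * (if 4 dvd n then qexp z ^ n else 0)) sums (l * qseries a (4 * z))"
    and "(\<lambda>n. a n * (if odd n then qexp z ^ n else 0)) sums (qseries a z - l * qseries a (4 * z))"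
    and "qseries a (z + 1/2) = 2 * l * qseries a (4 * z) - qseries a z"
proof -
  have "(\<lambda>m. l * (a m * qexp (4 * z) ^ m)) sums (l * qseries a (4 * z))"
    using assms by (intro sums_mult qseries_sums unit) auto
  moreover have "l * (a m * qexp (4 * z) ^ m) = a (4 * m) * (if 4 dvd 4 * m then qexp z ^ (4 * m) else 0)" for m
    using qexp_of_nat_mult[of 4 z] by (simp add: coeff_mult_4 power_mult)
  ultimately have "(\<lambda>m. a (4 * m) * (if 4 dvd 4 * m then qexp z ^ (4 * m) else 0)) sums (l * qseries a (4 * z))"
    by simp
  then show 1: "(\<lambda>n. a n * (if 4 dvd n then qexp z ^ n else 0)) sums (l * qseries a (4 * z))"
    by (subst (asm) sums_mono_reindex[of "\<lambda>m. 4 * m" "\<lambda>n. a n * (if 4 dvd n then qexp z ^ n else 0)"])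
      (auto simp: strict_mono_def elim!: dvdE)
  have q: "(\<lambda>n. a n * qexp z ^ n) sums qseries a z"
    using assms by (intro qseries_sums unit)
  have cases: "n mod 4 = 2 \<or> (4 dvd n \<and> even n) \<or> odd n \<and> \<not> 4 dvd n" for n :: nat by presburger
  have "a n * qexp z ^ n - a n * (if 4 dvd n then qexp z ^ n else 0) = a n * (if odd n then qexp z ^ n else 0)" for n
    using cases[of n] coeff_2_mod_4[of n] by auto
  with sums_diff[OF q 1] show "(\<lambda>n. a n * (if odd n then qexp z ^ n else 0)) sums (qseries a z - l * qseries a (4 * z))"
    by simp
  have "(\<lambda>n. a n * qexp (z + 1/2) ^ n) sums qseries a (z + 1/2)"
    using assms by (intro qseries_sums unit) auto
  moreover have "2 * (a n * (if 4 dvd n then qexp z ^ n else 0)) - a n * qexp z ^ n = a n * qexp (z + 1/2) ^ n" for n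
    using cases[of n] coeff_2_mod_4[of n] by (auto simp: qexp_add power_minus')
  then have "(\<lambda>n. a n * qexp (z + 1/2) ^ n) sums (2 * (l * qseries a (4 * z)) - qseries a z)"
    using sums_diff[OF sums_mult[OF 1, of 2] q] by simp
  ultimately show "qseries a (z + 1/2) = 2 * l * qseries a (4 * z) - qseries a z"
    by (simp add: sums_iff)
qed

lemma branch_parity: "even u = even u' \<Longrightarrow> even v = even v' \<Longrightarrow> branch u v = branch u' v'"
  by (simp add: branch_def fun_eq_iff)

lemma pet_parity: "even u = even u' \<Longrightarrow> even v = even v' \<Longrightarrow> pet u v = pet u' v'"
  using branch_parity[of u u' v v'] by (simp add: pet_def fun_eq_iff)

text \<open>\<open>norm C\<close> cancels the 2 inside \<open>csqrt (2 * z)\<close>, and the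
  remaining power of \<open>norm z\<close> is absorbed by the imaginary part because the exponent in
  \<open>pet\<close> is half the weight \<open>k + 1/2\<close>.\<close>

lemma inversion_norm:
  assumes z: "Im z > 0" and eq: "branch u v (-1/z) = C * csqrt (2 * z) ^ (2 * k + 1) * branch u' v' z"
  shows "pet u v (-1/z) = pet u' v' z"
proof -
  have "z \<noteq> 0" using z by auto
  let ?s = "real k + 1 / 2"
  have "norm (branch u v (-1/z)) = norm z powr ?s * norm (branch u' v' z)"
    unfolding eq norm_mult norm_C norm_csqrt_power[of "2 * z", OF _] using \<open>z \<noteq> 0\<close>
    by (subst norm_csqrt_power) (auto simp: norm_mult powr_mult powr_minus field_simps)
  moreover have "Im (-1/z) = Im z / (norm z)\<^sup>2" by (simp add: Im_divide cmod_power2)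
  moreover have "(Im z / (norm z)\<^sup>2) powr (?s / 2) = Im z powr (?s / 2) / norm z powr ?s"
  proof -
    have "(norm z)\<^sup>2 = norm z powr 2" using \<open>z \<noteq> 0\<close> by simp
    then have "((norm z)\<^sup>2) powr (?s / 2) = norm z powr ?s" by (simp only: powr_powr) (simp add: add_divide_distrib)
    then show ?thesis using z by (simp add: powr_divide)
  qed
  ultimately show ?thesis
    using \<open>z \<noteq> 0\<close> by (simp add: pet_def add_divide_distrib)
qed

lemma pet_S:
  assumes z: "Im z > 0" and odd: "odd u \<or> odd v"
  shows "pet u v (-1/z) = pet v (-u) z"
proof -
  have 11: "pet 1 1 (-1/z) = pet 1 1 z" if "Im z > 0" for z
    using inversion[of "2 * z"] that by (intro inversion_norm) (auto simp: branch_def mult.commute[of z 2])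
  have 10: "pet 1 0 (-1/z) = pet 0 1 z" if "Im z > 0" for z
  proof (rule inversion_norm[OF that])
    have "z \<noteq> 0" using that by auto
    have "(-1/z + 1)/2 = -1/(2 * z) + 1/2" using \<open>z \<noteq> 0\<close> by (simp add: field_simps)
    then have "branch 1 0 (-1/z) = qseries a (-1/(2 * z) + 1/2)"
      unfolding branch_def by (simp only: odd_one if_False dvd_0_right if_True)
    also have "\<dots> = 2 * l * qseries a (4 * (-1/(2 * z))) - qseries a (-1/(2 * z))"
      using that Im_neg_inverse_pos[of "2 * z"] by (intro qseries_sections(3)) simp
    also have "4 * (-1/(2 * z)) = -1/(z/2)" by simp
    also have "qseries a (-1/(z/2)) = C * csqrt (z/2) ^ (2 * k + 1) * qseries a (z/8)"
      using inversion[of "z/2"] that by simp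
    also have "csqrt (z/2) = csqrt (2 * z) / 2"
      using csqrt_mult_of_real[of "1/4" "2 * z"] by (simp add: real_sqrt_divide)
    also have "qseries a (-1/(2 * z)) = C * csqrt (2 * z) ^ (2 * k + 1) * qseries a (z/2)"
      using inversion[of "2 * z"] that by simp
    \<comment> \<open>Here \<open>l\<^sup>2 = 4 ^ k\<close> turns
      \<open>2 * l / 2 ^ (2 * k + 1)\<close> into \<open>1 / l\<close>, the origin of the division
      by \<open>l\<close> in \<open>branch\<close>.\<close>
    also have "2 * l * (C * (csqrt (2 * z) / 2) ^ (2 * k + 1) * qseries a (z/8)) =
       C * csqrt (2 * z) ^ (2 * k + 1) * (qseries a (z/8) / l)"
    proof -
      define m where "m = 2 * k + 1"
      have "(4::complex) ^ k = 2 ^ k * 2 ^ k" by (simp flip: power_mult_distrib)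
      then have "2 * l / 2 ^ m = 1 / l"
        using l_squared l_nonzero by (simp add: m_def power_mult field_simps power2_eq_square)
      then have "(2 * l / 2 ^ m) * (C * csqrt (2 * z) ^ m * qseries a (z/8)) =
         C * csqrt (2 * z) ^ m * (qseries a (z/8) / l)" by simp
      then show ?thesis unfolding m_def[symmetric] by (simp add: power_divide)
    qed
    finally show "branch 1 0 (-1/z) = C * csqrt (2 * z) ^ (2 * k + 1) * branch 0 1 z"
      by (simp add: branch_def algebra_simps)
  qed
  have "Im (-1/z) > 0" by (rule Im_neg_inverse_pos[OF z])
  from 10[OF this] have 01: "pet 0 1 (-1/z) = pet 1 0 z" by simp
  show ?thesis
    using odd 11[OF z] 10[OF z] 01 pet_parity[of u 1 v 1] pet_parity[of u 1 v 0] pet_parity[of u 0 v 1]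
      pet_parity[of v 1 "-u" 1] pet_parity[of v 1 "-u" 0] pet_parity[of v 0 "-u" 1]
    by (cases "even u"; cases "even v") simp_all
qed

lemma pet_T:
  assumes z: "Im z > 0" and odd: "odd u \<or> odd v"
  shows "pet u v (z + 1) = pet u (u + v) z"
proof -
  have 11: "pet 1 1 (z + 1) = pet 1 0 z" for z
    by (simp add: pet_def branch_def)
  have 10: "pet 1 0 (z + 1) = pet 1 1 z" for z
    using qseries_add_1(1)[of a "z/2"] by (simp add: pet_def branch_def add_divide_distrib)
  \<comment> \<open>A direct computation at \<open>(z + 1) / 8\<close> would need the odd part of
    the support to lie in one class modulo 8, which is not among the hypotheses. Instead the
    translation is written through inversions and the two translations already treated.\<close>
  have 01: "pet 0 1 (z + 1) = pet 0 1 z"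
  proof -
    define u where "u = -1 - 1 / z"
    have "Im (z + 1) > 0" using z by simp
    then have nz: "z \<noteq> 0" "z + 1 \<noteq> 0" using z by force+
    have im: "Im (-1/z) > 0" "Im (-1/(z+1)) > 0"
      using z Im_neg_inverse_pos[of z] Im_neg_inverse_pos[of "z + 1"] by simp_all
    have u: "Im u > 0" using im by (simp add: u_def)
    have "pet 0 1 (z + 1) = pet 1 0 (-1/(z + 1))"
      using pet_S[of "z + 1" 1 0] z pet_parity[of 0 0 "-1" 1] by simp
    also have "\<dots> = pet 1 1 (-1/(z + 1) + 1)" by (rule 11[symmetric])
    also have "-1/(z + 1) + 1 = -1/u" 
    proof -
      have "u = - ((z + 1) / z)" using nz by (simp add: u_def field_simps)
      then have "-1/u = z / (z + 1)" using nz by (simp del: minus_add_distrib)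
      then show ?thesis using nz by (simp add: field_simps)
    qed
    also have "pet 1 1 (-1/u) = pet 1 1 u"
      using pet_S[OF u, of 1 1] pet_parity[of 1 1 1 "-1"] by simp
    also have "\<dots> = pet 1 0 (u + 1)" by (rule 10[symmetric])
    also have "u + 1 = -1/z" by (simp add: u_def)
    also have "pet 1 0 (-1/z) = pet 0 1 z"
      using pet_S[OF z, of 1 0] pet_parity[of 0 0 "-1" 1] by simp
    finally show ?thesis .
  qed
  show ?thesis
    using odd 11 10 01 pet_parity[of u 1 v 1] pet_parity[of u 1 v 0] pet_parity[of u 0 v 1]
      pet_parity[of u 1 "u + v" 1] pet_parity[of u 1 "u + v" 0] pet_parity[of u 0 "u + v" 1]
    by (cases "even u"; cases "even v") simp_all
qed

text \<open>The index is the row vector \<open>(1, 1)\<close> times the matrix: on the right, the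
  translation sends \<open>(u, v)\<close> to \<open>(u, u + v)\<close> and the inversion sends it to
  \<open>(v, - u)\<close>, as in \<open>pet_T\<close> and \<open>pet_S\<close>.\<close>

lemma pet_moebius:
  assumes "p * s - q * r = 1" "Im z > 0"
  shows "pet 1 1 (moebius p q r s z) = pet (p + r) (q + s) z"
proof -
  have "p * s - q * r = 1 \<and> (\<forall>z. Im z > 0 \<longrightarrow> pet 1 1 (moebius p q r s z) = pet (p + r) (q + s) z)"
    using assms(1)
  proof (induction p q r s rule: SL2_induct)
    case id
    show ?case by simp
  next
    case (T p q r s)
    have "pet 1 1 (moebius p (q + p) r (s + r) z) = pet (p + r) (q + p + (s + r)) z" if "Im z > 0" for z
      using moebius_translate[of p q 1 r s z] T pet_T[OF that det_1_imp_odd[of p s q r]] that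
      by (simp add: algebra_simps)
    with T show ?case by (auto simp: algebra_simps)
  next
    case (T_inv p q r s)
    have "pet 1 1 (moebius p (q - p) r (s - r) z) = pet (p + r) (q - p + (s - r)) z" if "Im z > 0" for z
    proof -
      have "pet 1 1 (moebius p (q - p) r (s - r) z) = pet (p + r) (q + s) (z - 1)"
        using moebius_translate[of p q "-1" r s z] T_inv that by simp
      also have "\<dots> = pet (p + r) ((p + r) + ((q + s) - (p + r))) (z - 1)" by simp
      also have "\<dots> = pet (p + r) ((q + s) - (p + r)) (z - 1 + 1)"
        using T_inv that det_1_imp_odd[of p s q r] by (intro pet_T[symmetric]) auto
      finally show ?thesis by (simp add: algebra_simps)
    qed
    with T_inv show ?case by (auto simp: algebra_simps)
  next
    case (S p q r s)
    have "pet 1 1 (moebius q (-p) s (-r) z) = pet (q + s) (- p - r) z" if "Im z > 0" for z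
    proof -
      have "z \<noteq> 0" using that by auto
      moreover have "Im (-1/z) > 0" by (rule Im_neg_inverse_pos[OF that])
      ultimately show ?thesis
        using S pet_S[OF that det_1_imp_odd[of p s q r]] by (simp add: moebius_invert algebra_simps)
    qed
    with S show ?case by (auto simp: algebra_simps)
  qed
  with assms show ?thesis by blast
qed

end

lemma pseries_bounded:
  assumes "unit_series a" "r < 1"
  obtains B where "B > 0" "\<And>x. norm x \<le> r \<Longrightarrow> norm (pseries a x) \<le> B"
proof -
  have "continuous_on (cball 0 r) (pseries a)"
    using holomorphic_on_imp_continuous_on[OF pseries_holomorphic[OF assms(1)]]
    by (rule continuous_on_subset) (use assms(2) in auto)
  then have "bounded (pseries a ` cball 0 r)"
    by (intro compact_imp_bounded compact_continuous_image) auto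
  then obtain B where "B > 0" "\<forall>y\<in>pseries a ` cball 0 r. norm y \<le> B"
    by (auto simp: bounded_pos)
  then show ?thesis using that[of B] by simp
qed

lemma pseries_bounded_below:
  assumes "unit_series a" "r < 1" "r \<ge> 0" "\<And>x. norm x < 1 \<Longrightarrow> pseries a x \<noteq> 0"
  obtains c where "c > 0" "\<And>x. norm x \<le> r \<Longrightarrow> norm (pseries a x) \<ge> c"
proof -
  have "continuous_on (cball 0 r) (pseries a)"
    using holomorphic_on_imp_continuous_on[OF pseries_holomorphic[OF assms(1)]]
    by (rule continuous_on_subset) (use assms(2) in auto)
  then have "continuous_on (cball 0 r) (\<lambda>x. norm (pseries a x))"
    by (rule continuous_on_norm)
  moreover have "cball (0::complex) r \<noteq> {}" using assms(3) by simp
  ultimately obtain x0 where x0: "x0 \<in> cball 0 r" "\<And>x. x \<in> cball 0 r \<Longrightarrow> norm (pseries a x0) \<le> norm (pseries a x)"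
    using continuous_attains_inf[OF compact_cball] by blast
  then show ?thesis using that[of "norm (pseries a x0)"] assms(2,4) by force
qed

lemma unit_series_shift:
  assumes "unit_series a"
  shows "unit_series (\<lambda>n. a (n + t))"
  unfolding unit_series_def
proof (intro allI impI)
  fix x :: complex assume x: "norm x < 1"
  show "summable (\<lambda>n. a (n + t) * x ^ n)"
  proof (cases "x = 0")
    case False
    have "summable (\<lambda>n. a (n + t) * x ^ (n + t) * inverse (x ^ t))"
      using assms x by (intro summable_mult2 summable_ignore_initial_segment) (auto simp: unit_series_def)
    moreover have "a (n + t) * x ^ (n + t) * inverse (x ^ t) = a (n + t) * x ^ n" for n
      using False by (simp add: power_add field_simps)
    ultimately show ?thesis by simp
  qed (auto intro: summable_finite[of "{0}"])
qed

lemma pseries_shift: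
  assumes "unit_series a" "\<And>n. n < t \<Longrightarrow> a n = 0" "norm x < 1"
  shows "pseries a x = x ^ t * pseries (\<lambda>n. a (n + t)) x"
proof -
  have "(\<lambda>n. x ^ t * (a (n + t) * x ^ n)) sums (x ^ t * pseries (\<lambda>n. a (n + t)) x)"
    by (intro sums_mult pseries_sums unit_series_shift assms)
  then have "(\<lambda>n. a (n + t) * x ^ (n + t)) sums (x ^ t * pseries (\<lambda>n. a (n + t)) x)"
    by (simp add: power_add mult_ac)
  then have "(\<lambda>n. a n * x ^ n) sums (x ^ t * pseries (\<lambda>n. a (n + t)) x)"
    by (subst (asm) sums_zero_iff_shift) (use assms(2) in auto)
  then show ?thesis by (simp add: pseries_def sums_iff)
qed

lemma unit_series_subset:
  assumes "unit_series a" shows "unit_series (\<lambda>n. if P n then a n else 0)"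
  unfolding unit_series_def
proof (intro allI impI)
  fix x :: complex assume x: "norm x < 1"
  show "summable (\<lambda>n. (if P n then a n else 0) * x ^ n)"
    by (rule summable_comparison_test'[OF unit_series_abs_summable[OF assms x], of 0]) auto
qed

context weil_series
begin

definition odd_coeff :: "nat \<Rightarrow> complex" where
  "odd_coeff n = (if odd n then a n else 0)"

lemma unit_series_odd_coeff: "unit_series odd_coeff"
  unfolding odd_coeff_def using unit by (rule unit_series_subset)

text \<open>The local parameter in which the branch is a power series; it has period 8 for even
  \<open>u\<close> and period 2 for odd \<open>u\<close>.\<close>

definition nome :: "int \<Rightarrow> int \<Rightarrow> complex \<Rightarrow> complex" where
  "nome u v z = (if even u then qexp (z/8) else if even v then qexp ((z + 1)/2) else qexp (z/2))"

definition branch_coeff :: "int \<Rightarrow> nat \<Rightarrow> complex" where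
  "branch_coeff u n = (if even u then odd_coeff n / l else a n)"

lemma unit_series_branch_coeff: "unit_series (branch_coeff u)"
proof (cases "even u")
  case True
  then show ?thesis
    using unit_series_odd_coeff summable_divide[of "\<lambda>n. odd_coeff n * x ^ n" l for x]
    by (simp add: unit_series_def branch_coeff_def)
qed (use unit in \<open>simp add: branch_coeff_def[abs_def]\<close>)

text \<open>For even \<open>u\<close> the difference in \<open>branch\<close> is the odd part of the
  series at \<open>z / 8\<close>, divided by \<open>l\<close>.\<close>

lemma branch_conv_pseries:
  assumes "Im z > 0"
  shows "branch u v z = pseries (branch_coeff u) (nome u v z)"
proof (cases "even u")
  case True
  have "a n * (if odd n then x else 0) = odd_coeff n * x" for n x by (simp add: odd_coeff_def)
  then have "(\<lambda>n. odd_coeff n * qexp (z/8) ^ n / l) sums ((qseries a (z/8) - l * qseries a (4 * (z/8))) / l)"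
    using qseries_sections(2)[of "z/8"] assms by (intro sums_divide) simp
  then show ?thesis
    using True l_nonzero by (simp add: branch_def pseries_def nome_def branch_coeff_def sums_iff diff_divide_distrib)
next
  case False
  then have "branch_coeff u = a" by (simp add: branch_coeff_def fun_eq_iff)
  with False show ?thesis by (simp add: branch_def nome_def qseries_def)
qed

lemma norm_nome: "norm (nome u v z) = exp (- (if even u then pi / 4 else pi) * Im z)"
  by (simp add: nome_def norm_qexp)

lemma norm_nome_le: "Im z \<ge> 0 \<Longrightarrow> norm (nome u v z) \<le> exp (- pi * Im z / 4)"
  by (simp add: norm_nome field_simps)

lemma norm_nome_less_1: "Im z > 0 \<Longrightarrow> norm (nome u v z) < 1"
  by (simp add: norm_nome)

lemma nome_surj:
  assumes "x \<noteq> 0" obtains z where "nome u v z = x"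
proof -
  obtain z where z: "qexp z = x" using assms by (rule qexp_surj)
  have "nome u v (if even u then 8 * z else if even v then 2 * z - 1 else 2 * z) = x"
    using z by (simp add: nome_def)
  then show ?thesis by (rule that)
qed

text \<open>Each branch is built from coefficients of \<open>a\<close> at unchanged indices, so a
  zero of order \<open>t\<close> persists in every nome; the slowest nome has size
  \<open>exp (- pi * Im w / 4)\<close>.\<close>

lemma branch_bound:
  assumes van: "\<And>n. n < t \<Longrightarrow> a n = 0"
  obtains B where "B > 0" "\<And>u v w. Im w \<ge> 1/2 \<Longrightarrow> norm (branch u v w) \<le> B * exp (- pi * real t * Im w / 4)"
proof -
  have "\<exists>B>0. \<forall>x. norm x \<le> exp (- pi / 8) \<longrightarrow> norm (pseries (\<lambda>n. branch_coeff u (n + t)) x) \<le> B" for u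
  proof -
    have "exp (- pi / 8) < 1" by simp
    from pseries_bounded[OF unit_series_shift[OF unit_series_branch_coeff, of u t] this] show ?thesis by blast
  qed
  then obtain B where B: "\<And>u. B u > 0" "\<And>u x. norm x \<le> exp (- pi / 8) \<Longrightarrow> norm (pseries (\<lambda>n. branch_coeff u (n + t)) x) \<le> B u"
    by (metis (full_types))
  have par: "branch u v = branch (u mod 2) v" for u v by (rule branch_parity) auto
  have "norm (branch u v w) \<le> (B 0 + B 1) * exp (- pi * real t * Im w / 4)" if w: "Im w \<ge> 1/2" for u v w
  proof -
    define u' where "u' = u mod 2"
    have u': "u' = 0 \<or> u' = 1" by (auto simp: u'_def)
    let ?x = "nome u' v w"
    have x1: "norm ?x \<le> exp (- pi * Im w / 4)" "norm ?x < 1"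
      using w norm_nome_le[of w u' v] norm_nome_less_1[of w u' v] by auto
    have "exp (- pi * Im w / 4) \<le> exp (- pi / 8)"
      using mult_left_mono[OF w, of pi] by (simp add: field_simps)
    with x1 have x2: "norm ?x \<le> exp (- pi / 8)" by linarith
    have "branch u v w = pseries (branch_coeff u') ?x"
      using branch_conv_pseries[of w u' v] w par[of u v] by (simp add: u'_def)
    also have "\<dots> = ?x ^ t * pseries (\<lambda>n. branch_coeff u' (n + t)) ?x"
      by (intro pseries_shift unit_series_branch_coeff x1) (simp add: branch_coeff_def odd_coeff_def van)
    also have "norm \<dots> \<le> exp (- pi * Im w / 4) ^ t * (B 0 + B 1)"
      unfolding norm_mult norm_power
      using B(2)[OF x2, of u'] B(1)[of 0] B(1)[of 1] u' x1 by (intro mult_mono power_mono) auto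
    also have "exp (- pi * Im w / 4) ^ t = exp (- pi * real t * Im w / 4)"
      by (subst exp_of_nat_mult[symmetric]) (simp add: field_simps)
    finally show ?thesis by (simp add: mult.commute)
  qed
  moreover have "B 0 + B 1 > 0" using B(1)[of 0] B(1)[of 1] by linarith
  ultimately show ?thesis by (intro that[of "B 0 + B 1"])
qed

lemma pet_eq_pet_11:
  assumes "odd u \<or> odd v" "Im z > 0"
  obtains z' where "Im z' > 0" "pet u v z = pet 1 1 z'"
proof -
  note obt = that
  have *: thesis if pm: "p * s - q * r = 1" "even (p + r) = even u" "even (q + s) = even v" for p q r s :: int
  proof (rule obt)
    show "Im (moebius p q r s z) > 0" using pm(1) assms(2) by (intro Im_moebius_pos) auto
    show "pet u v z = pet 1 1 (moebius p q r s z)"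
      using pet_moebius[OF pm(1) assms(2)] pet_parity[OF pm(2,3)] by simp
  qed
  show thesis
    using assms(1) *[of 1 1 0 0] *[of 1 1 0 1] *[of 1 1 1 0] by (cases "even u"; cases "even v") auto
qed

text \<open>Above height 1/2 exponential decay outweighs the power of the imaginary part, and every
  value of \<open>pet\<close> is also a value taken there.\<close>

lemma pet_bounded:
  assumes "a 0 = 0"
  obtains M where "M > 0" "\<And>u v z. Im z > 0 \<Longrightarrow> odd u \<or> odd v \<Longrightarrow> pet u v z \<le> M"
proof -
  obtain B where B: "B > 0" "\<And>u v w. Im w \<ge> 1/2 \<Longrightarrow> norm (branch u v w) \<le> B * exp (- pi * real 1 * Im w / 4)"
    by (rule branch_bound[of 1]) (use assms in auto)
  define s where "s = real k / 2 + 1 / 4"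
  have s: "s > 0" by (simp add: s_def)
  have "eventually (\<lambda>y::real. exp (- pi * real 1 * y / 4) * y powr s \<le> 1) at_top"
  proof -
    have "((\<lambda>y::real. exp (- pi * real 1 * y / 4) * y powr s) \<longlongrightarrow> 0) at_top"
      using s by real_asymp
    then have "eventually (\<lambda>y::real. exp (- pi * real 1 * y / 4) * y powr s < 1) at_top"
      by (rule order_tendstoD) simp
    then show ?thesis by eventually_elim simp
  qed
  then obtain Y where Y: "\<And>y. y \<ge> Y \<Longrightarrow> exp (- pi * real 1 * y / 4) * y powr s \<le> 1"
    by (auto simp: eventually_at_top_linorder)
  define Y' where "Y' = max Y 1"
  have bd: "exp (- pi * real 1 * y / 4) * y powr s \<le> Y' powr s" if "y > 0" for y
  proof (cases "y \<ge> Y")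
    case True
    then show ?thesis using Y[OF True] ge_one_powr_ge_zero[of Y' s] s by (simp add: Y'_def)
  next
    case False
    have "exp (- pi * real 1 * y / 4) * y powr s \<le> 1 * Y' powr s"
      using that False s by (intro mult_mono powr_mono2) (auto simp: Y'_def)
    then show ?thesis by simp
  qed
  have M: "pet u v w \<le> B * Y' powr s" if w: "Im w \<ge> 1/2" for u v w
  proof -
    have "pet u v w \<le> (B * exp (- pi * real 1 * Im w / 4)) * Im w powr s"
      unfolding pet_def s_def using B(2)[OF w] by (intro mult_right_mono) auto
    also have "\<dots> \<le> B * Y' powr s" using bd[of "Im w"] B(1) w by (simp add: mult.assoc)
    finally show ?thesis .
  qed
  have M11: "pet 1 1 z \<le> B * Y' powr s" if z: "Im z > 0" for z
  proof -
    obtain p q r s' w where *: "p * s' - q * r = 1" "Im w \<ge> 1 / 2" "z = moebius p q r s' w"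
      by (rule reduce_to_Im_ge_half[OF z])
    then show ?thesis using M[OF *(2)] pet_moebius[OF *(1), of w] by simp
  qed
  have "pet u v z \<le> B * Y' powr s" if "Im z > 0" "odd u \<or> odd v" for u v z
    by (rule pet_eq_pet_11[OF that(2,1)]) (use M11 in simp)
  moreover have "B * Y' powr s > 0" using B(1) by (simp add: Y'_def)
  ultimately show ?thesis using that by blast
qed

end

section \<open>Weight 3/2 and the theta function\<close>

context weil_series
begin

lemma pet_nonneg: "pet u v z \<ge> 0"
  by (simp add: pet_def)

lemma qseries_eq_0_iff_pet: "Im z > 0 \<Longrightarrow> qseries a z = 0 \<longleftrightarrow> pet 1 1 (2 * z) = 0"
  by (simp add: pet_def branch_def)

text \<open>A Schwarz lemma. After division by the third power of the nome, the maximum principle on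
  the circle of radius \<open>r\<close>, that is at height \<open>y / 2\<close>, bounds the value
  where the nome has size \<open>r * r\<close>, at height \<open>y\<close>. The gain is
  \<open>r ^ 3\<close>, the loss \<open>2 powr (3/4)\<close> comes from the change of
  height.\<close>

lemma pet_contraction:
  assumes k: "k = 1" and van: "\<forall>n<3. a n = 0"
    and M: "\<forall>u v z. Im z > 0 \<longrightarrow> odd u \<or> odd v \<longrightarrow> pet u v z \<le> M"
    and w: "Im w \<ge> 1/2" and uv: "odd u \<or> odd v"
  shows "pet u v w \<le> exp (- 3 * pi / 16) * 2 powr (3/4) * M"
proof -
  define c where "c = (if even u then pi / 4 else pi)"
  have c: "c \<ge> pi / 4" "c > 0" by (auto simp: c_def)
  define y where "y = Im w"
  have y: "y \<ge> 1/2" using w by (simp add: y_def)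
  define r where "r = exp (- c * (y / 2))"
  define G where "G = pseries (\<lambda>n. branch_coeff u (n + 3))"
  let ?x = "nome u v w"
  have s: "real k / 2 + 1 / 4 = 3 / 4" using k by simp
  have M0: "M \<ge> 0" using M[rule_format, of w u v] pet_nonneg[of u v w] uv w by auto
  have r: "0 < r" "r < 1" using c y by (auto simp: r_def)
  have sh: "pseries (branch_coeff u) x = x ^ 3 * G x" if "norm x < 1" for x
    unfolding G_def using that van
    by (intro pseries_shift unit_series_branch_coeff) (simp_all add: branch_coeff_def odd_coeff_def)
  have Gh: "G holomorphic_on ball 0 1"
    unfolding G_def by (intro pseries_holomorphic unit_series_shift unit_series_branch_coeff)
  have nx: "norm ?x = r * r"
    by (simp add: norm_nome r_def c_def y_def flip: exp_add)
  have "norm (G ?x) \<le> M * (y / 2) powr - (3/4) / r ^ 3"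
  proof (rule maximum_modulus_frontier[of G "cball 0 r"])
    show "G holomorphic_on interior (cball 0 r)"
      by (rule holomorphic_on_subset[OF Gh]) (use r in auto)
    show "continuous_on (closure (cball 0 r)) G"
      by (rule continuous_on_subset[OF holomorphic_on_imp_continuous_on[OF Gh]]) (use r in auto)
    show "?x \<in> cball 0 r" using nx r by (simp add: mult_left_le)
    fix x :: complex assume "x \<in> frontier (cball 0 r)"
    then have x: "norm x = r" using r by simp
    then have "x \<noteq> 0" using r by auto
    then obtain z where z: "nome u v z = x" by (rule nome_surj)
    have "norm (nome u v z) = r" using x z by simp
    then have "exp (- c * Im z) = r" unfolding norm_nome c_def[symmetric] .
    then have imz: "Im z = y / 2" using c by (simp add: r_def)
    then have "Im z > 0" using y by simp
    then have "norm (branch u v z) * (y / 2) powr (3/4) \<le> M"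
      using M[rule_format, of z u v] uv unfolding pet_def s imz by simp
    then have "norm (branch u v z) \<le> M * (y / 2) powr - (3/4)"
      unfolding powr_minus using y by (simp add: field_simps)
    moreover have "branch u v z = x ^ 3 * G x"
      using branch_conv_pseries[OF \<open>Im z > 0\<close>] sh[of x] x r z by simp
    ultimately show "norm (G x) \<le> M * (y / 2) powr - (3/4) / r ^ 3"
      using x r by (simp add: norm_mult norm_power field_simps)
  qed auto
  then have "norm ?x ^ 3 * norm (G ?x) \<le> norm ?x ^ 3 * (M * (y / 2) powr - (3/4) / r ^ 3)"
    by (rule mult_left_mono) simp
  then have "norm (branch u v w) \<le> norm ?x ^ 3 * (M * (y / 2) powr - (3/4) / r ^ 3)"
    using branch_conv_pseries[of w u v] sh[of ?x] norm_nome_less_1[of w u v] w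
    by (simp add: norm_mult norm_power)
  also have "\<dots> = r ^ 3 * (M * (y / 2) powr - (3/4))"
  proof -
    define R where "R = r ^ 3"
    have "R > 0" using r by (simp add: R_def)
    then show ?thesis unfolding nx power_mult_distrib R_def[symmetric] by simp
  qed
  \<comment> \<open>The worst case is the slow nome, \<open>c = pi / 4\<close>, at the least height
    \<open>y = 1/2\<close>.\<close>
  also have "r ^ 3 \<le> exp (- 3 * pi / 16)"
  proof -
    have "pi / 4 * (1/2) \<le> c * y" using c y by (intro mult_mono) auto
    moreover have "r ^ 3 = exp (- 3 * (c * y) / 2)"
      unfolding r_def by (subst exp_of_nat_mult[symmetric]) simp
    ultimately show ?thesis by simp
  qed
  finally have "norm (branch u v w) \<le> exp (- 3 * pi / 16) * (M * (y / 2) powr - (3/4))"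
    using M0 by (simp add: mult_right_mono)
  then have "pet u v w \<le> exp (- 3 * pi / 16) * (M * (y / 2) powr - (3/4)) * y powr (3/4)"
    unfolding pet_def s by (intro mult_mono) (use M0 in \<open>auto simp: y_def\<close>)
  also have "(y / 2) powr - (3/4) = 2 powr (3/4) / y powr (3/4)"
    unfolding powr_minus using y by (subst powr_divide) auto
  finally show ?thesis using y by (simp add: mult_ac)
qed

lemma weight_3_half_vanishes:
  assumes k: "k = 1" and van: "\<And>n. n < 3 \<Longrightarrow> a n = 0"
  shows "a = (\<lambda>_. 0)"
proof -
  define \<rho> where "\<rho> = exp (- 3 * pi / 16) * 2 powr (3/4 :: real)"
  have "\<rho> = exp (- 3 * pi / 16 + 3/4 * ln 2)"
    unfolding \<rho>_def exp_add by (simp add: powr_def)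
  \<comment> \<open>The order of vanishing counts here: with 2 in place of 3 the exponent would be
    positive.\<close>
  moreover have "- 3 * pi / 16 + 3/4 * ln 2 < 0"
    using ln2_le_25_over_36 pi_gt3 by linarith
  ultimately have \<rho>: "0 < \<rho>" "\<rho> < 1" by simp_all
  have "a 0 = 0" using van by simp
  then obtain M where M: "M > 0" "\<And>u v z. Im z > 0 \<Longrightarrow> odd u \<or> odd v \<Longrightarrow> pet u v z \<le> M"
    by (rule pet_bounded) blast
  have bd: "\<forall>u v z. Im z > 0 \<longrightarrow> odd u \<or> odd v \<longrightarrow> pet u v z \<le> \<rho> ^ n * M" for n
  proof (induction n)
    case 0
    show ?case using M by simp
  next
    case (Suc n)
    have c: "pet u v w \<le> \<rho> * (\<rho> ^ n * M)" if "Im w \<ge> 1/2" "odd u \<or> odd v" for u v w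
      using pet_contraction[OF k _ Suc that] van by (simp add: \<rho>_def)
    have c11: "pet 1 1 z \<le> \<rho> * (\<rho> ^ n * M)" if z: "Im z > 0" for z
    proof -
      obtain p q r s w where *: "p * s - q * r = 1" "Im w \<ge> 1 / 2" "z = moebius p q r s w"
        by (rule reduce_to_Im_ge_half[OF z])
      then show ?thesis
        using c[OF *(2) det_1_imp_odd[OF *(1)]] pet_moebius[OF *(1), of w] by simp
    qed
    show ?case
    proof (intro allI impI)
      fix u v :: int and z :: complex assume *: "Im z > 0" "odd u \<or> odd v"
      obtain z' where "Im z' > 0" "pet u v z = pet 1 1 z'"
        by (rule pet_eq_pet_11[OF *(2,1)])
      then show "pet u v z \<le> \<rho> ^ Suc n * M" using c11[of z'] by (simp add: mult_ac)
    qed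
  qed
  have "(\<lambda>n. \<rho> ^ n * M) \<longlonglongrightarrow> 0 * M"
    using \<rho> by (intro tendsto_mult tendsto_const LIMSEQ_realpow_zero) auto
  then have "pet 1 1 z \<le> 0" if "Im z > 0" for z
    using bd that by (intro LIMSEQ_le_const[of "\<lambda>n. \<rho> ^ n * M"]) auto
  then have "qseries a z = qseries (\<lambda>_. 0) z" if "Im z > 0" for z
  proof -
    have "pet 1 1 (2 * z) = 0" using \<open>\<And>z. Im z > 0 \<Longrightarrow> pet 1 1 z \<le> 0\<close>[of "2 * z"] that pet_nonneg[of 1 1 "2 * z"] by simp
    then have "qseries a z = 0" using qseries_eq_0_iff_pet[OF that] by simp
    then show ?thesis by (simp add: qseries_def[of "\<lambda>_. 0"] pseries_def)
  qed
  then show ?thesis by (intro qseries_unique unit unit_series_0)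
qed

end

section \<open>Theta as an instance, and the absence of zeros\<close>

interpretation theta: weil_series 0 theta_coeff 1 "(1 - \<i>) / 2"
proof
  show "theta_coeff (4 * n) = 1 * theta_coeff n" for n
  proof -
    have "(\<exists>m. 4 * n = m\<^sup>2) \<longleftrightarrow> (\<exists>m. n = m\<^sup>2)"
    proof
      assume "\<exists>m. 4 * n = m\<^sup>2"
      then obtain m where m: "4 * n = m\<^sup>2" by blast
      then have "even (m\<^sup>2)" by (metis even_mult_iff even_numeral)
      then obtain j where "m = 2 * j" by (auto elim: evenE)
      with m show "\<exists>m. n = m\<^sup>2" by (auto simp: power2_eq_square)
    next
      assume "\<exists>m. n = m\<^sup>2"
      then obtain m where "n = m\<^sup>2" by blast
      then show "\<exists>m. 4 * n = m\<^sup>2" by (intro exI[of _ "2 * m"]) (simp add: power_mult_distrib)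
    qed
    then show ?thesis by (simp add: theta_coeff_def)
  qed
  show "theta_coeff n = 0" if "n mod 4 = 2" for n
  proof -
    have "m\<^sup>2 mod 4 \<noteq> 2" for m :: nat
    proof (cases "even m")
      case True
      then obtain j where "m = 2 * j" by (rule evenE)
      then have "m\<^sup>2 = 4 * j\<^sup>2" by (simp add: power_mult_distrib)
      then show ?thesis by simp
    next
      case False
      then have "odd (m\<^sup>2)" by simp
      then show ?thesis by presburger
    qed
    with that show ?thesis by (auto simp: theta_coeff_def)
  qed
  show "norm ((1 - \<i>) / 2) = 2 powr - (real 0 + 1/2)"
    by (simp add: cmod_def powr_minus powr_half_sqrt real_sqrt_divide norm_divide field_simps)
  show "unit_series theta_coeff" by (rule unit_series_theta)
  show "qseries theta_coeff (-1/t) = (1 - \<i>) / 2 * csqrt t ^ (2 * 0 + 1) * qseries theta_coeff (t/4)"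
    if "Im t > 0" for t
    using theta_inversion[OF that] by (simp only: mult_0_right add_0 power_one_right)
qed simp

lemma norm_suminf_le_geometric:
  fixes f :: "nat \<Rightarrow> complex"
  assumes "\<And>m. norm (f m) \<le> c ^ Suc m" "0 \<le> c" "c < 1"
  shows "norm (\<Sum>m. f m) \<le> c / (1 - c)"
proof -
  have "(\<lambda>m. c * c ^ m) sums (c * (1 / (1 - c)))"
    using assms by (intro sums_mult geometric_sums) auto
  then have sg: "(\<lambda>m. c ^ Suc m) sums (c / (1 - c))" by simp
  then have "norm (\<Sum>m. f m) \<le> (\<Sum>m. c ^ Suc m)"
    by (intro norm_suminf_le assms) (simp add: sums_iff)
  then show ?thesis using sg by (simp add: sums_iff)
qed

lemma odd_square_mod_8: "odd m \<Longrightarrow> m\<^sup>2 mod 8 = (1::nat)"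
proof -
  assume "odd m"
  then obtain j where j: "m = 2 * j + 1" by (rule oddE)
  have "even (j * (j + 1))" by simp
  then obtain i where "j * (j + 1) = 2 * i" by (rule evenE)
  then have "m\<^sup>2 = 8 * i + 1" by (simp add: j power2_eq_square algebra_simps)
  then show ?thesis by simp
qed

text \<open>The leading term dominates. For odd \<open>u\<close> the nome is below 2/7, so the tail
  is at most 2/5, less than 1/2. For even \<open>u\<close>, after removal of one factor of the nome,
  the series runs in its eighth power, as odd squares are 1 modulo 8, and that power is at most
  1/3.\<close>

lemma theta_branch_nonzero:
  assumes w: "Im w \<ge> 1/2"
  shows "theta.branch u v w \<noteq> 0"
proof -
  let ?x = "theta.nome u v w"
  have e3: "exp (pi / 2) > 7/2"
  proof -
    have "(7/2::real) < 1 + 3/2 + (3/2)\<^sup>2 / 2" by (simp add: power2_eq_square)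
    also have "\<dots> \<le> exp (3/2 :: real)"
      by (rule exp_lower_Taylor_quadratic) simp
    also have "\<dots> \<le> exp (pi / 2)" using pi_gt3 by simp
    finally show ?thesis .
  qed
  have x1: "norm ?x < 1" using w by (intro theta.norm_nome_less_1) auto
  have br: "theta.branch u v w = pseries (theta.branch_coeff u) ?x"
    using w by (intro theta.branch_conv_pseries) auto
  show ?thesis
  proof (cases "even u")
    case False
    have "norm ?x \<le> exp (- (pi / 2))"
      using w False mult_left_mono[OF w, of pi] by (simp add: theta.norm_nome)
    also have "exp (- (pi / 2)) < 2/7" using e3 by (simp add: exp_minus field_simps)
    finally have x3: "norm ?x < 2/7" .
    have "theta.branch_coeff u = theta_coeff"
      using False by (simp add: theta.branch_coeff_def fun_eq_iff)
    then have b: "theta.branch u v w = 1 + 2 * (\<Sum>m. ?x ^ (Suc m)\<^sup>2)"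
      using br theta_coeff_sums[OF x1] by (simp add: pseries_def sums_iff)
    have "norm (\<Sum>m. ?x ^ (Suc m)\<^sup>2) \<le> (2/7) / (1 - 2/7)"
    proof (rule norm_suminf_le_geometric)
      show "norm (?x ^ (Suc m)\<^sup>2) \<le> (2/7) ^ Suc m" for m
      proof -
        have "norm (?x ^ (Suc m)\<^sup>2) \<le> norm ?x ^ Suc m"
          unfolding norm_power by (rule power_decreasing) (use x1 in \<open>auto simp: power2_eq_square\<close>)
        also have "\<dots> \<le> (2/7) ^ Suc m" using x3 by (intro power_mono) auto
        finally show ?thesis .
      qed
    qed auto
    then have "norm (2 * (\<Sum>m. ?x ^ (Suc m)\<^sup>2)) < 1" by (simp only: norm_mult) simp
    then have "2 * (\<Sum>m. ?x ^ (Suc m)\<^sup>2) \<noteq> -1" by force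
    then show ?thesis
      unfolding b by (simp add: add_eq_0_iff)
  next
    case True
    have "norm ?x \<le> exp (- (pi / 8))"
      using w True mult_left_mono[OF w, of pi] by (simp add: theta.norm_nome)
    then have "norm ?x ^ 8 \<le> exp (- (pi / 8)) ^ 8" by (intro power_mono) auto
    also have "\<dots> = exp (- (pi / 2)) * exp (- (pi / 2))"
      by (subst exp_of_nat_mult[symmetric]) (simp flip: exp_add)
    also have "exp (- (pi / 2)) * exp (- (pi / 2)) < 1/3 * 1"
      using e3 by (intro mult_strict_mono) (auto simp: exp_minus field_simps)
    finally have x8: "norm (?x ^ 8) \<le> 1/3" by (simp add: norm_power)
    define g where "g n = theta.odd_coeff (n + 1)" for n
    have g: "unit_series g"
      unfolding g_def by (intro unit_series_shift theta.unit_series_odd_coeff)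
    have "theta.branch_coeff u = theta.odd_coeff"
      using True by (simp add: theta.branch_coeff_def fun_eq_iff)
    then have b: "theta.branch u v w = ?x * pseries g ?x"
      using br pseries_shift[OF theta.unit_series_odd_coeff, of 1 ?x] x1
      by (simp add: g_def[abs_def] theta.odd_coeff_def)
    have g8: "g n = 0" if "\<not> 8 dvd n" for n
    proof (rule ccontr)
      assume "g n \<noteq> 0"
      then have "odd (n + 1)" "\<exists>m. n + 1 = m\<^sup>2"
        by (auto simp: g_def theta.odd_coeff_def theta_coeff_def split: if_splits)
      then obtain m where m: "n + 1 = m\<^sup>2" "odd (n + 1)" by blast
      then have "odd m" by simp
      then have "(n + 1) mod 8 = 1" using odd_square_mod_8 m by simp
      then show False using that by presburger
    qed
    have "(\<lambda>n. g n * ?x ^ n) sums pseries g ?x" by (intro pseries_sums g x1)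
    then have "(\<lambda>j. g (8 * j) * ?x ^ (8 * j)) sums pseries g ?x"
      by (subst sums_mono_reindex[of "\<lambda>j. 8 * j" "\<lambda>n. g n * ?x ^ n"])
        (use g8 in \<open>auto simp: strict_mono_def elim!: dvdE\<close>)
    then have "pseries g ?x = g 0 + (\<Sum>j. g (8 * Suc j) * ?x ^ (8 * Suc j))"
      using suminf_split_head[of "\<lambda>j. g (8 * j) * ?x ^ (8 * j)"] by (simp add: sums_iff)
    moreover have "g 0 = 2"
      by (auto simp: g_def theta.odd_coeff_def theta_coeff_def intro: exI[of _ 1])
    moreover have "norm (\<Sum>j. g (8 * Suc j) / 2 * ?x ^ (8 * Suc j)) \<le> (1/3) / (1 - 1/3)"
    proof (rule norm_suminf_le_geometric)
      fix j
      have "norm (g (8 * Suc j) / 2) \<le> 1"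
        by (simp add: g_def theta.odd_coeff_def theta_coeff_def)
      moreover have "norm (?x ^ (8 * Suc j)) \<le> (1/3) ^ Suc j"
        unfolding power_mult norm_power[of _ "Suc j"] using x8 by (intro power_mono) auto
      ultimately have "norm (g (8 * Suc j) / 2) * norm (?x ^ (8 * Suc j)) \<le> 1 * (1/3) ^ Suc j"
        by (intro mult_mono) auto
      then show "norm (g (8 * Suc j) / 2 * ?x ^ (8 * Suc j)) \<le> (1/3) ^ Suc j"
        by (simp only: norm_mult mult_1)
    qed auto
    moreover have "(\<Sum>j. g (8 * Suc j) * ?x ^ (8 * Suc j)) = 2 * (\<Sum>j. g (8 * Suc j) / 2 * ?x ^ (8 * Suc j))"
    proof -
      have "summable (\<lambda>j. g (8 * j) * ?x ^ (8 * j))"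
        using \<open>(\<lambda>j. g (8 * j) * ?x ^ (8 * j)) sums pseries g ?x\<close> by (simp add: sums_iff)
      then have "summable (\<lambda>j. g (8 * Suc j) * ?x ^ (8 * Suc j))"
        by (subst summable_Suc_iff)
      then have "summable (\<lambda>j. g (8 * Suc j) * ?x ^ (8 * Suc j) / 2)" by (rule summable_divide)
      from suminf_mult[OF this, of 2] show ?thesis by simp
    qed
    ultimately have "pseries g ?x = 2 * (1 + (\<Sum>j. g (8 * Suc j) / 2 * ?x ^ (8 * Suc j)))"
      and n: "norm (\<Sum>j. g (8 * Suc j) / 2 * ?x ^ (8 * Suc j)) < 1" by simp_all
    moreover have "(\<Sum>j. g (8 * Suc j) / 2 * ?x ^ (8 * Suc j)) \<noteq> - 1" using n by force
    ultimately have "pseries g ?x \<noteq> 0" by (simp add: add_eq_0_iff)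
    moreover have "?x \<noteq> 0" by (simp add: theta.nome_def)
    ultimately show ?thesis unfolding b by simp
  qed
qed

lemma theta_pet_pos:
  assumes "Im z > 0" "odd u \<or> odd v"
  shows "theta.pet u v z > 0"
proof -
  have 11: "theta.pet 1 1 z > 0" if z: "Im z > 0" for z
  proof -
    obtain p q r s w where *: "p * s - q * r = 1" "Im w \<ge> 1 / 2" "z = moebius p q r s w"
      by (rule reduce_to_Im_ge_half[OF z])
    then have "theta.pet 1 1 z = theta.pet (p + r) (q + s) w"
      using theta.pet_moebius[OF *(1), of w] by simp
    also have "\<dots> > 0"
      using theta_branch_nonzero[OF *(2)] *(2) by (simp add: theta.pet_def)
    finally show ?thesis .
  qed
  obtain z' where "Im z' > 0" "theta.pet u v z = theta.pet 1 1 z'"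
    by (rule theta.pet_eq_pet_11[OF assms(2,1)])
  with 11 show ?thesis by simp
qed

lemma theta_nonzero: "Im z > 0 \<Longrightarrow> qseries theta_coeff z \<noteq> 0"
  using theta.qseries_eq_0_iff_pet[of z] theta_pet_pos[of "2 * z" 1 1] by simp

lemma pseries_theta_nonzero:
  assumes "norm x < 1" shows "pseries theta_coeff x \<noteq> 0"
proof (cases "x = 0")
  case True
  then show ?thesis by (simp add: pseries_def theta_coeff_def)
next
  case False
  then obtain z where z: "qexp z = x" by (rule qexp_surj)
  with assms have "Im z > 0" by (auto simp flip: norm_qexp_less_1_iff)
  from theta_nonzero[OF this] z show ?thesis by (simp add: qseries_def)
qed

text \<open>This is the nonvanishing of the branch with even \<open>u\<close>, extended to its cusp
  once the simple zero there is divided out.\<close>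

lemma pseries_theta_odd_nonzero:
  assumes "norm x < 1" shows "pseries (\<lambda>n. theta.odd_coeff (n + 1)) x \<noteq> 0"
proof (cases "x = 0")
  case True
  have "\<exists>m. Suc 0 = m\<^sup>2" by (rule exI[of _ 1]) simp
  then show ?thesis using True by (simp add: pseries_def theta.odd_coeff_def theta_coeff_def)
next
  case False
  then obtain z where z: "theta.nome 0 1 z = x" by (rule theta.nome_surj)
  have "exp (- (pi / 4) * Im z) < 1"
    using assms theta.norm_nome[of 0 1 z] z by simp
  then have "Im z > 0" by (simp add: zero_less_mult_iff)
  then have "theta.branch 0 1 z \<noteq> 0"
    using theta_pet_pos[of z 0 1] by (auto simp: theta.pet_def)
  moreover have "theta.branch_coeff 0 = theta.odd_coeff"
    by (simp add: theta.branch_coeff_def fun_eq_iff)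
  ultimately show ?thesis
    using theta.branch_conv_pseries[OF \<open>Im z > 0\<close>, of 0 1] z assms
      pseries_shift[OF theta.unit_series_odd_coeff, of 1 x]
    by (auto simp: theta.odd_coeff_def)
qed

section \<open>The theta multiplier\<close>

lemma nearest_multiple:
  fixes c m :: int
  assumes "m > 0" obtains n where "2 * \<bar>c - n * m\<bar> \<le> m"
proof
  let ?n = "(2 * c + m) div (2 * m)"
  have "2 * c + m = ?n * (2 * m) + (2 * c + m) mod (2 * m)" by (simp add: div_mult_mod_eq)
  moreover have "0 \<le> (2 * c + m) mod (2 * m)" "(2 * c + m) mod (2 * m) < 2 * m" using assms by auto
  ultimately show "2 * \<bar>c - ?n * m\<bar> \<le> m" by (simp add: algebra_simps abs_if)
qed

text \<open>Euclid's algorithm with nearest multiples: \<open>d\<close> is reduced modulo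
  \<open>c\<close>, or \<open>c\<close> modulo \<open>4 * d\<close>. One of the two always makes
  strict progress, since \<open>d\<close> is odd and \<open>4 dvd c\<close> excludes
  \<open>\<bar>c\<bar> = 2 * \<bar>d\<bar>\<close>.\<close>

lemma Gamma0_4_induct [consumes 2, case_names id minus_id T T_inv U U_inv]:
  assumes "a * d - b * c = (1::int)" "4 dvd c"
    and id: "P 1 0 0 1" and minus_id: "P (-1) 0 0 (-1)"
    and T: "\<And>a b c d. P a b c d \<Longrightarrow> P a (b + a) c (d + c)"
    and T_inv: "\<And>a b c d. P a b c d \<Longrightarrow> P a (b - a) c (d - c)"
    and U: "\<And>a b c d. P a b c d \<Longrightarrow> P (a + 4 * b) b (c + 4 * d) d"
    and U_inv: "\<And>a b c d. P a b c d \<Longrightarrow> P (a - 4 * b) b (c - 4 * d) d"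
  shows "P a b c d"
  using assms(1,2)
proof (induction "nat (\<bar>c\<bar> + \<bar>d\<bar>)" arbitrary: a b c d rule: less_induct)
  case less
  have Tn: "P a (b + n * a) c (d + n * c)" if "P a b c d" for a b c d n
  proof (induction n rule: int_induct[of _ 0])
    case (step1 i)
    then show ?case using T[OF step1(2)] by (simp add: algebra_simps)
  next
    case (step2 i)
    then show ?case using T_inv[OF step2(2)] by (simp add: algebra_simps)
  qed (use that in simp)
  have Un: "P (a + n * (4 * b)) b (c + n * (4 * d)) d" if "P a b c d" for a b c d n
  proof (induction n rule: int_induct[of _ 0])
    case (step1 i)
    then show ?case using U[OF step1(2)] by (simp add: algebra_simps)
  next
    case (step2 i)
    then show ?case using U_inv[OF step2(2)] by (simp add: algebra_simps)
  qed (use that in simp)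
  have odd: "odd d"
  proof
    assume "even d"
    then have "even (a * d - b * c)" using less.prems(2) by (auto elim!: dvdE)
    with less.prems(1) show False by simp
  qed
  show ?case
  proof (cases "c = 0")
    case True
    then have "a = 1 \<and> d = 1 \<or> a = -1 \<and> d = -1"
      using less.prems by (auto simp: zmult_eq_1_iff)
    then show ?thesis using True Tn[OF id, of b] Tn[OF minus_id, of "-b"] by auto
  next
    case False
    show ?thesis
    proof (cases "\<bar>c\<bar> < 2 * \<bar>d\<bar>")
      case True
      obtain n where n: "2 * \<bar>d - n * \<bar>c\<bar>\<bar> \<le> \<bar>c\<bar>" using nearest_multiple[of "\<bar>c\<bar>" d] False by auto
      define m where "m = n * sgn c"
      have "n * \<bar>c\<bar> = m * c" by (simp add: m_def abs_sgn mult_ac)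
      then have "\<bar>d - m * c\<bar> < \<bar>d\<bar>" using n True by simp
      then have "P a (b - m * a) c (d - m * c)"
        using less.prems by (intro less.hyps) (auto simp: algebra_simps)
      from Tn[OF this, of m] show ?thesis by simp
    next
      case False
      have "\<bar>c\<bar> \<noteq> 2 * \<bar>d\<bar>"
      proof
        assume "\<bar>c\<bar> = 2 * \<bar>d\<bar>"
        moreover have "4 dvd \<bar>c\<bar>" using less.prems(2) by simp
        ultimately show False using odd by presburger
      qed
      with False have lt: "2 * \<bar>d\<bar> < \<bar>c\<bar>" by simp
      have "d \<noteq> 0" using odd by auto
      then obtain n where n: "2 * \<bar>c - n * (4 * \<bar>d\<bar>)\<bar> \<le> 4 * \<bar>d\<bar>" using nearest_multiple[of "4 * \<bar>d\<bar>" c] by auto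
      define m where "m = n * sgn d"
      have "n * (4 * \<bar>d\<bar>) = m * (4 * d)" by (simp add: m_def abs_sgn mult_ac)
      then have "\<bar>c - m * (4 * d)\<bar> < \<bar>c\<bar>" using n lt by simp
      moreover have "4 dvd c - m * (4 * d)" using less.prems(2) by (intro dvd_diff) auto
      ultimately have "P (a - m * (4 * b)) b (c - m * (4 * d)) d"
        using less.prems(1) by (intro less.hyps) (auto simp: algebra_simps)
      from Un[OF this, of m] show ?thesis by simp
    qed
  qed
qed

section \<open>Shimura's symbol and the automorphy factor\<close>

lemma Legendre_mult:
  assumes "prime p" "odd p"
  shows "Legendre (a * b) (int p) = Legendre a (int p) * Legendre b (int p)"
proof -
  have p: "2 < p" using assms prime_ge_2_nat[of p] by (cases "p = 2") auto
  have "[Legendre (a * b) p = (a * b) ^ ((p - 1) div 2)] (mod int p)"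
    by (rule euler_criterion[OF assms(1) p])
  also have "(a * b) ^ ((p - 1) div 2) = a ^ ((p - 1) div 2) * b ^ ((p - 1) div 2)"
    by (rule power_mult_distrib)
  also have "[\<dots> = Legendre a p * Legendre b p] (mod int p)"
    by (intro cong_mult cong_sym[OF euler_criterion] assms p)
  finally have "int p dvd Legendre (a * b) p - Legendre a p * Legendre b p"
    by (simp add: cong_iff_dvd_diff)
  moreover have "\<bar>Legendre (a * b) p - Legendre a p * Legendre b p\<bar> < int p"
    using p by (auto simp: Legendre_def)
  ultimately show ?thesis
    using zdvd_imp_le[of "int p" "\<bar>Legendre (a * b) p - Legendre a p * Legendre b p\<bar>"] by force
qed

lemma shimura_symbol_cases:
  assumes "coprime c d" shows "shimura_symbol c d = 1 \<or> shimura_symbol c d = -1"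
proof -
  have "\<bar>\<Prod>p\<in>#prime_factorization (nat \<bar>d\<bar>). Legendre c (int p)\<bar> = 1"
  proof -
    have L: "\<bar>Legendre c (int p)\<bar> = 1" if "p \<in># prime_factorization (nat \<bar>d\<bar>)" for p
    proof -
      have "p dvd nat \<bar>d\<bar>" "prime p" using that by (auto simp: in_prime_factors_iff)
      then have "int p dvd d" "\<not> is_unit (int p)" by (auto simp: nat_dvd_iff prime_nat_iff)
      then have "\<not> int p dvd c" using assms by (auto simp: coprime_def)
      then show ?thesis by (auto simp: Legendre_def cong_0_iff)
    qed
    have "\<bar>\<Prod>p\<in>#A. Legendre c (int p)\<bar> = 1" if "\<forall>p\<in>#A. \<bar>Legendre c (int p)\<bar> = 1" for A :: "nat multiset"
      using that by (induction A) (auto simp: abs_mult)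
    with L show ?thesis by blast
  qed
  then show ?thesis by (auto simp: shimura_symbol_def abs_if split: if_splits)
qed

lemma shimura_symbol_mult_pos:
  assumes "odd d" "t > 0"
  shows "shimura_symbol (t * c) d = (\<Prod>p\<in>#prime_factorization (nat \<bar>d\<bar>). Legendre t (int p)) * shimura_symbol c d"
proof -
  have odd: "odd p" if "p \<in># prime_factorization (nat \<bar>d\<bar>)" for p
  proof
    assume "even p"
    moreover have "p dvd nat \<bar>d\<bar>" using that by (auto simp: in_prime_factors_iff)
    ultimately have "even (nat \<bar>d\<bar>)" by (rule dvd_trans)
    then show False using assms by (simp add: even_nat_iff)
  qed
  have "(\<Prod>p\<in>#prime_factorization (nat \<bar>d\<bar>). Legendre (t * c) (int p)) = 
     (\<Prod>p\<in>#prime_factorization (nat \<bar>d\<bar>). Legendre t (int p) * Legendre c (int p))"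
    using odd by (intro arg_cong[of _ _ prod_mset] image_mset_cong Legendre_mult) (auto simp: in_prime_factors_iff)
  then show ?thesis using assms
    by (simp add: shimura_symbol_def prod_mset.distrib mult_less_0_iff)
qed

lemma theta_eps_pow4: "theta_eps d ^ 4 = 1"
  by (simp add: theta_eps_def)

lemma theta_j_pow4:
  assumes "coprime c d" shows "theta_j c d z ^ 4 = (of_int c * z + of_int d) ^ 2"
proof -
  have s: "(of_int (shimura_symbol c d) :: complex) ^ 4 = 1"
    using shimura_symbol_cases[OF assms] by auto
  have "csqrt w ^ 4 = w\<^sup>2" for w
    using power_mult[of "csqrt w" 2 2] by simp
  then show ?thesis
    using s by (simp add: theta_j_def power_mult_distrib power_inverse theta_eps_pow4)
qed

text \<open>Both roots lie in the open first quadrant, so their product has positive imaginary part,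
  and \<open>- \<i>\<close> times it is a principal root.\<close>

lemma csqrt_mult_inverse_half_plane:
  assumes "Im t > 0" "Im u > 0"
  shows "csqrt t * csqrt u = \<i> * csqrt (- (t * u))"
proof -
  have pos: "Re (csqrt w) > 0 \<and> Im (csqrt w) > 0" if "Im w > 0" for w
  proof -
    have "Im ((csqrt w)\<^sup>2) > 0" using that by simp
    then have "Re (csqrt w) * Im (csqrt w) > 0" by (simp only: Im_power2)
    then show ?thesis using csqrt_principal[of w] by (auto simp: zero_less_mult_iff)
  qed
  have "csqrt (- (t * u)) = - \<i> * (csqrt t * csqrt u)"
  proof (rule csqrt_unique)
    show "(- \<i> * (csqrt t * csqrt u))\<^sup>2 = - (t * u)" by (simp add: power_mult_distrib)
    have "Im (csqrt t * csqrt u) > 0"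
      using pos[OF assms(1)] pos[OF assms(2)] by (simp add: add_pos_pos)
    then show "0 < Re (- \<i> * (csqrt t * csqrt u)) \<or>
       Re (- \<i> * (csqrt t * csqrt u)) = 0 \<and> 0 \<le> Im (- \<i> * (csqrt t * csqrt u))" by simp
  qed
  then show ?thesis by simp
qed

text \<open>The matrix is an inversion, a translation by -4 and an inversion; at
  \<open>t / 4\<close> the translation becomes one by -1, under which theta is periodic.\<close>

lemma theta_U:
  assumes z: "Im z > 0"
  shows "qseries theta_coeff (moebius 1 0 4 1 z) = csqrt (4 * z + 1) * qseries theta_coeff z"
proof -
  define t where "t = -4 - 1/z"
  have nz: "z \<noteq> 0" using z by auto
  have nz4: "4 * z + 1 \<noteq> 0" using moebius_denom_nonzero[OF z, of 4 1] by simp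
  have t: "Im t > 0" using Im_neg_inverse_pos[OF z] by (simp add: t_def)
  have "t = - ((4 * z + 1) / z)" using nz by (simp add: t_def field_simps)
  then have "moebius 1 0 4 1 z = -1/t" using nz nz4 by (simp add: moebius_def del: minus_add_distrib)
  then have "qseries theta_coeff (moebius 1 0 4 1 z) = (1 - \<i>) / 2 * csqrt t * qseries theta_coeff (t/4)"
    using theta_inversion[OF t] by simp
  also have "t / 4 = -1/(4*z) + of_int (-1)" using nz by (simp add: t_def field_simps)
  also have "qseries theta_coeff (-1/(4*z) + of_int (-1)) = qseries theta_coeff (-1/(4*z))"
    by (rule qseries_add_of_int)
  also have "qseries theta_coeff (-1/(4*z)) = (1 - \<i>) / 2 * csqrt (4*z) * qseries theta_coeff z"
    using theta_inversion[of "4 * z"] z by simp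
  also have "(1 - \<i>) / 2 * csqrt t * ((1 - \<i>) / 2 * csqrt (4*z) * qseries theta_coeff z) =
     ((1 - \<i>) / 2)\<^sup>2 * (csqrt t * csqrt (4*z)) * qseries theta_coeff z"
    by (simp add: power2_eq_square)
  also have "csqrt t * csqrt (4*z) = \<i> * csqrt (- (t * (4 * z)))"
    using t z by (intro csqrt_mult_inverse_half_plane) auto
  also have "- (t * (4 * z)) = of_real 4 * (4 * z + 1)" using nz by (simp add: t_def field_simps)
  also have "csqrt (of_real 4 * (4 * z + 1)) = 2 * csqrt (4 * z + 1)"
    by (subst csqrt_mult_of_real) auto
  also have "((1 - \<i>) / 2)\<^sup>2 = - \<i> / 2" by (simp add: power2_eq_square field_simps)
  finally show ?thesis by simp
qed

lemma moebius_U_inverse: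
  assumes "Im z > 0"
  shows "moebius 1 0 4 1 (moebius 1 0 (-4) 1 z) = z" "Im (moebius 1 0 (-4) 1 z) > 0"
  using assms by (simp_all add: moebius_compose Im_moebius_pos)

text \<open>The fourth power has trivial multiplier, so this much follows from the generators
  without tracking symbols or branches of square roots.\<close>

lemma theta_pow4_law:
  assumes "p * s - q * r = 1" "4 dvd r" "Im z > 0"
  shows "qseries theta_coeff (moebius p q r s z) ^ 4 = (of_int r * z + of_int s)\<^sup>2 * qseries theta_coeff z ^ 4"
proof -
  let ?t = "qseries theta_coeff"
  have U4: "?t (moebius 1 0 4 1 z) ^ 4 = (4 * z + 1)\<^sup>2 * ?t z ^ 4" if "Im z > 0" for z
    unfolding theta_U[OF that] power_mult_distrib
    using power_mult[of "csqrt (4 * z + 1)" 2 2] by simp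
  have "p * s - q * r = 1 \<and> (\<forall>z. Im z > 0 \<longrightarrow> ?t (moebius p q r s z) ^ 4 = (of_int r * z + of_int s)\<^sup>2 * ?t z ^ 4)"
    using assms(1,2)
  proof (induction p q r s rule: Gamma0_4_induct)
    case (T p q r s)
    then show ?case using moebius_translate[of p q 1 r s] by (auto simp: algebra_simps)
  next
    case (T_inv p q r s)
    have "?t (z - 1) = ?t z" for z using qseries_add_of_int[of theta_coeff z "-1"] by simp
    with T_inv show ?case using moebius_translate[of p q "-1" r s] by (auto simp: algebra_simps)
  next
    case (U p q r s)
    have "?t (moebius (p + 4 * q) q (r + 4 * s) s z) ^ 4 = (of_int (r + 4 * s) * z + of_int s)\<^sup>2 * ?t z ^ 4"
      if z: "Im z > 0" for z
    proof -
      define w where "w = moebius 1 0 4 1 z"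
      have w: "Im w > 0" unfolding w_def using z by (intro Im_moebius_pos) auto
      have nz4: "4 * z + 1 \<noteq> 0" using moebius_denom_nonzero[OF z, of 4 1] by simp
      have "moebius (p + 4 * q) q (r + 4 * s) s z = moebius p q r s w"
        using z by (simp add: w_def moebius_compose mult.commute)
      then have "?t (moebius (p + 4 * q) q (r + 4 * s) s z) ^ 4 = ((of_int r * w + of_int s) * (4 * z + 1))\<^sup>2 * ?t z ^ 4"
        using U w U4[OF z] by (simp add: w_def power_mult_distrib)
      also have "(of_int r * w + of_int s) * (4 * z + 1) = of_int (r + 4 * s) * z + of_int s"
        using nz4 by (simp add: w_def moebius_def field_simps)
      finally show ?thesis .
    qed
    with U show ?case by (auto simp: algebra_simps)
  next
    case (U_inv p q r s)
    have "?t (moebius (p - 4 * q) q (r - 4 * s) s z) ^ 4 = (of_int (r - 4 * s) * z + of_int s)\<^sup>2 * ?t z ^ 4"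
      if z: "Im z > 0" for z
    proof -
      define w where "w = moebius 1 0 (-4) 1 z"
      have w: "Im w > 0" "moebius 1 0 4 1 w = z" unfolding w_def using moebius_U_inverse[OF z] by auto
      have nz4: "-4 * z + 1 \<noteq> 0" using moebius_denom_nonzero[OF z, of "-4" 1] by simp
      have "4 * w + 1 = 1 / (-4 * z + 1)" using nz4 by (simp add: w_def moebius_def field_simps)
      then have tz: "?t w ^ 4 = (-4 * z + 1)\<^sup>2 * ?t z ^ 4"
        using U4[OF w(1)] w(2) nz4 by (simp add: field_simps)
      have "moebius (p - 4 * q) q (r - 4 * s) s z = moebius p q r s w"
        using z by (simp add: w_def moebius_compose mult.commute)
      then have "?t (moebius (p - 4 * q) q (r - 4 * s) s z) ^ 4 = ((of_int r * w + of_int s) * (-4 * z + 1))\<^sup>2 * ?t z ^ 4"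
        using U_inv w tz by (simp add: power_mult_distrib)
      also have "(of_int r * w + of_int s) * (-4 * z + 1) = of_int (r - 4 * s) * z + of_int s"
        using nz4 by (simp add: w_def moebius_def field_simps)
      finally show ?thesis .
    qed
    with U_inv show ?case by (auto simp: algebra_simps)
  qed (simp_all add: moebius_def)
  with assms(3) show ?thesis by blast
qed

lemma Gamma0_4_invariant:
  fixes \<Phi> :: "complex \<Rightarrow> complex"
  assumes T: "\<And>z. Im z > 0 \<Longrightarrow> \<Phi> (z + 1) = \<Phi> z"
    and U: "\<And>z. Im z > 0 \<Longrightarrow> \<Phi> (moebius 1 0 4 1 z) = \<Phi> z"
    and g: "p * s - q * r = 1" "4 dvd r" and z: "Im z > 0"
  shows "\<Phi> (moebius p q r s z) = \<Phi> z"
proof -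
  have "\<forall>z. Im z > 0 \<longrightarrow> \<Phi> (moebius p q r s z) = \<Phi> z"
    using g
  proof (induction p q r s rule: Gamma0_4_induct)
    case (T p q r s)
    then show ?case using moebius_translate[of p q 1 r s] assms(1) by (auto simp: algebra_simps)
  next
    case (T_inv p q r s)
    have "\<Phi> (z - 1) = \<Phi> z" if "Im z > 0" for z using assms(1)[of "z - 1"] that by simp
    with T_inv show ?case using moebius_translate[of p q "-1" r s] by (auto simp: algebra_simps)
  next
    case (U p q r s)
    have "\<Phi> (moebius (p + 4 * q) q (r + 4 * s) s z) = \<Phi> z" if z: "Im z > 0" for z
    proof -
      have "moebius (p + 4 * q) q (r + 4 * s) s z = moebius p q r s (moebius 1 0 4 1 z)"
        using z by (simp add: moebius_compose mult.commute)
      moreover have "Im (moebius 1 0 4 1 z) > 0" using z by (intro Im_moebius_pos) auto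
      ultimately show ?thesis using U assms(2)[OF z] by simp
    qed
    then show ?case by simp
  next
    case (U_inv p q r s)
    have "\<Phi> (moebius (p - 4 * q) q (r - 4 * s) s z) = \<Phi> z" if z: "Im z > 0" for z
    proof -
      have "moebius (p - 4 * q) q (r - 4 * s) s z = moebius p q r s (moebius 1 0 (-4) 1 z)"
        using z by (simp add: moebius_compose mult.commute)
      then show ?thesis using U_inv assms(2)[OF moebius_U_inverse(2)[OF z]] moebius_U_inverse[OF z] by simp
    qed
    then show ?case by simp
  qed (simp_all add: moebius_def)
  with z show ?thesis by blast
qed

lemma theta_j_holomorphic: "r \<noteq> 0 \<or> s = 1 \<or> s = -1 \<Longrightarrow> theta_j r s holomorphic_on \<H>"
proof (cases "r = 0")
  case False
  then show ?thesis unfolding theta_j_def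
    by (intro holomorphic_intros) (auto simp: complex_nonpos_Reals_iff)
qed (auto simp: theta_j_def[abs_def])

lemma det_imp_coprime:
  fixes p q r s :: int
  assumes "p * s - q * r = 1" shows "coprime r s"
proof (rule coprimeI)
  fix c assume "c dvd r" "c dvd s"
  then have "c dvd p * s - q * r" by simp
  with assms show "is_unit c" by simp
qed

text \<open>The quotient of \<open>f\<close> by \<open>theta ^ (2 * k + 1)\<close> is invariant
  under the generators, hence under the group. So where \<open>f\<close> is nonzero, the theta
  quotient \<open>J\<close> and \<open>theta_j r s z\<close> have equal powers of exponent
  \<open>2 * k + 1\<close>; their fourth powers agree as well, and the two exponents are
  coprime.\<close>

lemma theta_law:
  fixes f :: "complex \<Rightarrow> complex"
  assumes hol: "f holomorphic_on \<H>" and per: "\<And>z. Im z > 0 \<Longrightarrow> f (z + 1) = f z"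
    and law: "\<And>p q r s z. p * s - q * r = 1 \<Longrightarrow> 4 dvd r \<Longrightarrow> Im z > 0 \<Longrightarrow>
        f (moebius p q r s z) = theta_j r s z ^ (2 * k + 1) * f z"
    and nz: "Im z0 > 0" "f z0 \<noteq> 0"
    and g: "p * s - q * r = 1" "4 dvd r" and z: "Im z > 0"
  shows "qseries theta_coeff (moebius p q r s z) = theta_j r s z * qseries theta_coeff z"
proof -
  let ?t = "qseries theta_coeff"
  have cop: "coprime r s"
    by (rule det_imp_coprime[OF g(1)])
  have th: "?t holomorphic_on \<H>" by (intro qseries_holomorphic unit_series_theta)
  define D where "D z = ?t (moebius p q r s z) - theta_j r s z * ?t z" for z
  have det: "p * s - q * r > 0" using g by simp
  have im: "Im (moebius p q r s z) > 0" if "Im z > 0" for z by (rule Im_moebius_pos[OF that det])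
  have nzd: "of_int r * z + of_int s \<noteq> (0::complex)" if "Im z > 0" for z
    by (rule moebius_denom_nonzero[OF that]) (use g in auto)
  have zero: "f z * D z = 0" if "Im z > 0" for z
  proof (cases "f z = 0")
    case False
    have "f (moebius p q r s z) / ?t (moebius p q r s z) ^ (2 * k + 1) = f z / ?t z ^ (2 * k + 1)"
    proof (rule Gamma0_4_invariant[OF _ _ g that])
      fix z assume z: "Im z > 0"
      show "f (z + 1) / ?t (z + 1) ^ (2 * k + 1) = f z / ?t z ^ (2 * k + 1)"
        using per[OF z] by simp
      have "theta_j 4 1 z = csqrt (4 * z + 1)" by (simp add: theta_j_def theta_eps_def shimura_symbol_def)
      moreover have "4 * z + 1 \<noteq> 0" using moebius_denom_nonzero[OF z, of 4 1] by simp
      ultimately show "f (moebius 1 0 4 1 z) / ?t (moebius 1 0 4 1 z) ^ (2 * k + 1) = f z / ?t z ^ (2 * k + 1)"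
        using law[of 1 1 0 4 z] theta_U[OF z] z by (simp add: power_mult_distrib)
    qed
    define J where "J = ?t (moebius p q r s z) / ?t z"
    have tz: "?t z \<noteq> 0" "?t (moebius p q r s z) \<noteq> 0" using that im[OF that] theta_nonzero by auto
    have e1: "theta_j r s z ^ (2 * k + 1) = J ^ (2 * k + 1)"
      using \<open>f (moebius p q r s z) / ?t (moebius p q r s z) ^ (2 * k + 1) = f z / ?t z ^ (2 * k + 1)\<close>
        law[OF g that] False tz unfolding J_def power_divide by (simp add: field_simps)
    have e2: "theta_j r s z ^ 4 = J ^ 4"
      using theta_j_pow4[OF cop, of z] theta_pow4_law[OF g that] tz by (simp add: J_def power_divide field_simps)
    have "theta_j r s z \<noteq> 0"
    proof
      assume "theta_j r s z = 0"
      then show False using theta_j_pow4[OF cop, of z] nzd[OF that] by simp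
    qed
    then have J0: "J \<noteq> 0" using e2 by auto
    define x where "x = theta_j r s z / J"
    have x4: "x ^ 4 = 1" and xk: "x ^ (2 * k + 1) = 1"
      using e1 e2 J0 by (simp_all add: x_def power_divide)
    have "x = 1"
    proof (cases "even k")
      case True
      then obtain j where "k = 2 * j" by (rule evenE)
      then have "2 * k + 1 = 4 * j + 1" by simp
      then have "x ^ (2 * k + 1) = (x ^ 4) ^ j * x" by (simp only: power_add power_mult power_one_right)
      then have "x ^ (2 * k + 1) = x" by (simp only: x4 power_one mult_1_left)
      then show ?thesis using xk by (rule subst)
    next
      case False
      then obtain j where "k = 2 * j + 1" by (rule oddE)
      then have "2 * k + 1 = 4 * j + 3" by simp
      then have "x ^ (2 * k + 1) = (x ^ 4) ^ j * x ^ 3" by (simp only: power_add power_mult)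
      then have "x ^ (2 * k + 1) = x ^ 3" by (simp only: x4 power_one mult_1_left)
      then have "x ^ 3 = 1" using xk by (rule subst)
      moreover have "x ^ 4 = x * x ^ 3" by (simp add: numeral_eq_Suc)
      ultimately show ?thesis using x4 by simp
    qed
    then have "theta_j r s z = J" using J0 by (simp add: x_def)
    then show ?thesis using tz by (simp add: D_def J_def)
  qed simp
  have "r \<noteq> 0 \<or> s = 1 \<or> s = -1"
    using g(1) by (auto simp: zmult_eq_1_iff)
  then have "D holomorphic_on \<H>" unfolding D_def
  proof (intro holomorphic_intros theta_j_holomorphic th)
    show "(\<lambda>z. ?t (moebius p q r s z)) holomorphic_on \<H>"
      by (rule holomorphic_on_compose_gen[OF _ th, unfolded o_def])
        (use im nzd in \<open>auto simp: moebius_def intro!: holomorphic_intros\<close>)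
  qed auto
  then have Dc: "continuous_on \<H> D" by (rule holomorphic_on_imp_continuous_on)
  \<comment> \<open>Were \<open>D\<close> nonzero somewhere, it would be nonzero on an open set;
    there \<open>f\<close> would vanish, and hence everywhere.\<close>
  have "D z = 0"
  proof (rule ccontr)
    assume "D z \<noteq> 0"
    have op: "open (\<H> \<inter> D -` (- {0}))"
      by (rule continuous_open_preimage[OF Dc open_upper_half_plane]) auto
    have "f z0 = 0"
    proof (rule analytic_continuation_open[OF op open_upper_half_plane, of f "\<lambda>_. 0" z0])
      show "\<H> \<inter> D -` (- {0}) \<noteq> {}" using z \<open>D z \<noteq> 0\<close> by auto
      show "connected \<H>" by (rule convex_connected[OF convex_upper_half_plane])
    qed (use hol nz zero in auto)
    with nz show False by simp
  qed
  then show ?thesis by (simp add: D_def)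
qed

section \<open>The quotient by theta\<close>

locale plus_eigenform = weil_series k a l C for k a l C +
  fixes t :: nat
  assumes k_pos: "k > 0"
    and law: "\<And>p q r s z. p * s - q * r = 1 \<Longrightarrow> 4 dvd r \<Longrightarrow> Im z > 0 \<Longrightarrow>
        qseries a (moebius p q r s z) = theta_j r s z ^ (2 * k + 1) * qseries a z"
    and leading: "a t \<noteq> 0" "\<And>n. n < t \<Longrightarrow> a n = 0"
begin

lemma coeff_0: "a 0 = 0"
proof -
  have "norm l > 1" unfolding norm_l using k_pos by simp
  then have "l \<noteq> 1" by auto
  then show ?thesis using coeff_mult_4[of 0] by simp
qed

lemma t_pos: "t > 0"
  using leading coeff_0 by (cases "t = 0") auto

lemma odd_t: "odd t"
proof
  assume "even t"
  moreover have "t mod 4 \<noteq> 2" using coeff_2_mod_4 leading by blast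
  ultimately have "4 dvd t" by presburger
  then obtain n where n: "t = 4 * n" by (rule dvdE)
  then have "a n = 0" using t_pos by (intro leading) auto
  then show False using coeff_mult_4[of n] leading n by simp
qed

definition level :: int where "level = 4 * int t"

text \<open>The first factor is \<open>theta_eps s\<close> to the power \<open>- 2 * k\<close>, the
  second is the Jacobi symbol of \<open>t\<close> modulo \<open>\<bar>s\<bar>\<close>.\<close>

definition chi :: "int \<Rightarrow> complex" where
  "chi s = (if s mod 4 = 1 then 1 else (-1) ^ k) *
     of_int (\<Prod>p\<in>#prime_factorization (nat \<bar>s\<bar>). Legendre (int t) (int p))"

definition Q :: "complex \<Rightarrow> complex" where
  "Q z = qseries a z / qseries theta_coeff (of_nat t * z)"

lemma qseries_nonzero: obtains z where "Im z > 0" "qseries a z \<noteq> 0"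
proof (rule ccontr)
  assume *: "\<not> thesis"
  have "a = (\<lambda>_. 0)"
  proof (rule qseries_unique[OF unit unit_series_0])
    show "qseries a z = qseries (\<lambda>_. 0) z" if "Im z > 0" for z
      using * \<open>Im z > 0 \<Longrightarrow> qseries a z \<noteq> 0 \<Longrightarrow> thesis\<close> that
      by (auto simp: qseries_def pseries_def)
  qed
  then show False using leading by simp
qed

lemma Im_t_mult: "Im z > 0 \<Longrightarrow> Im (of_nat t * z) > 0"
  using t_pos by simp

text \<open>Multiplication by \<open>t\<close> conjugates the matrix to one with lower row
  \<open>(c, s)\<close>, where \<open>r = t * c\<close>. Both automorphy factors then contain the
  same square root, as \<open>r * z + s = c * (t * z) + s\<close>, so their quotient is an integral
  power; the two symbols differ by the Jacobi symbol of \<open>t\<close>.\<close>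

lemma Q_law:
  assumes g: "p * s - q * r = 1" "level dvd r" and z: "Im z > 0"
  shows "Q (moebius p q r s z) = chi s * (of_int r * z + of_int s) ^ k * Q z"
proof -
  obtain r' where r': "r = level * r'" using g(2) by (rule dvdE)
  define c where "c = 4 * r'"
  have rc: "r = int t * c" using r' by (simp add: level_def c_def)
  have g': "p * s - (int t * q) * c = 1" using g rc by (simp add: mult_ac)
  have cop: "coprime c s" by (rule det_imp_coprime[OF g'])
  have odd_s: "odd s"
  proof
    assume "even s"
    then have "even (p * s - (int t * q) * c)" by (simp add: c_def)
    with g' show False by simp
  qed
  obtain z0 where z0: "Im z0 > 0" "qseries a z0 \<noteq> 0" by (rule qseries_nonzero)
  have th: "qseries theta_coeff (moebius p (int t * q) c s u) = theta_j c s u * qseries theta_coeff u" if "Im u > 0" for u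
    by (rule theta_law[where f = "qseries a" and ?z0.0 = z0, OF qseries_holomorphic[OF unit] _ law z0 g' _ that])
      (auto simp: c_def)
  have tm: "of_nat t * moebius p q r s z = moebius p (int t * q) c s (of_nat t * z)"
    by (simp add: moebius_def rc algebra_simps)
  define L where "L = (\<Prod>p\<in>#prime_factorization (nat \<bar>s\<bar>). Legendre (int t) (int p))"
  have sh: "shimura_symbol r s = L * shimura_symbol c s"
    unfolding rc L_def using odd_s t_pos by (intro shimura_symbol_mult_pos) auto
  have pm: "shimura_symbol r s = 1 \<or> shimura_symbol r s = -1" "shimura_symbol c s = 1 \<or> shimura_symbol c s = -1"
    using shimura_symbol_cases[OF cop] shimura_symbol_cases[OF det_imp_coprime[OF g(1)]] by auto
  define E where "E = inverse (theta_eps s)"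
  define w where "w = csqrt (of_int r * z + of_int s)"
  have E2: "(E ^ 2) ^ k = (if s mod 4 = 1 then 1 else (-1) ^ k)" and E0: "E \<noteq> 0"
    by (auto simp: E_def theta_eps_def power_inverse minus_one_power_iff)
  have nz: "of_int r * z + of_int s \<noteq> (0::complex)"
    by (rule moebius_denom_nonzero[OF z]) (use g in auto)
  then have w: "w ^ 2 = of_int r * z + of_int s" "w \<noteq> 0" by (auto simp: w_def)
  have j1: "theta_j r s z = E * of_int (shimura_symbol r s) * w"
    by (simp add: theta_j_def E_def w_def)
  have j2: "theta_j c s (of_nat t * z) = E * of_int (shimura_symbol c s) * w"
    by (simp add: theta_j_def E_def w_def rc mult_ac)
  have "4 dvd r" by (simp add: rc c_def)
  have "Q (moebius p q r s z) = theta_j r s z ^ (2 * k + 1) / theta_j c s (of_nat t * z) * Q z"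
    using law[OF g(1) \<open>4 dvd r\<close> z] th[OF Im_t_mult[OF z]] by (simp add: Q_def tm)
  also have "theta_j r s z ^ (2 * k + 1) / theta_j c s (of_nat t * z) = chi s * (of_int r * z + of_int s) ^ k"
  proof -
    have "theta_j r s z ^ (2 * k + 1) / theta_j c s (of_nat t * z) =
       ((E * of_int (shimura_symbol r s) * w)\<^sup>2) ^ k * (of_int (shimura_symbol r s) / of_int (shimura_symbol c s))"
      unfolding j1 j2 using E0 w pm by (simp add: power_mult)
    also have "(E * of_int (shimura_symbol r s) * w)\<^sup>2 = E\<^sup>2 * w\<^sup>2"
      using pm by (auto simp: power_mult_distrib)
    also have "of_int (shimura_symbol r s) / of_int (shimura_symbol c s) = complex_of_int L"
      using sh pm by auto
    finally show ?thesis using E2 w by (simp add: power_mult_distrib chi_def L_def mult_ac)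
  qed
  finally show ?thesis .
qed

lemma Q_periodic: "Q (z + of_int n) = Q z"
proof -
  have "of_nat t * (z + of_int n) = of_nat t * z + of_int (int t * n)" by (simp add: algebra_simps)
  then show ?thesis unfolding Q_def by (simp only: qseries_add_of_int)
qed

lemma Q_nonzero: obtains z where "Im z > 0" "Q z \<noteq> 0"
  using qseries_nonzero theta_nonzero[OF Im_t_mult] by (metis Q_def divide_eq_0_iff)

lemma level_pos: "level > 0" using t_pos by (simp add: level_def)

lemma coprime_imp_matrix:
  assumes "coprime s level" obtains p q where "p * s - q * level = 1"
proof -
  obtain u v where "u * s + v * level = 1"
    using bezout_int[of s level] assms by auto
  then show ?thesis using that[of u "- v"] by simp
qed

text \<open>A translation turns the lower row \<open>(level, s)\<close> into
  \<open>(level, s')\<close> and leaves \<open>Q\<close> unchanged. Comparing both instances of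
  \<open>Q_law\<close> at a point where \<open>Q\<close> is nonzero takes the place of quadratic
  reciprocity.\<close>

lemma chi_periodic:
  assumes "coprime s level" "level dvd s' - s"
  shows "chi s' = chi s"
proof -
  obtain p q where pq: "p * s - q * level = 1" using assms(1) by (rule coprime_imp_matrix)
  obtain m where "s' - s = level * m" using assms(2) by (rule dvdE)
  then have m: "s' = s + m * level" by (simp add: algebra_simps)
  obtain z where z: "Im z > 0" "Q z \<noteq> 0" by (rule Q_nonzero)
  define w where "w = z + of_int (-m)"
  have w: "Im w > 0" "Q w = Q z" using z Q_periodic[of z "-m"] by (auto simp: w_def)
  have det: "p * s' - (q + m * p) * level = 1" using pq m by (simp add: algebra_simps)
  have "Q (moebius p (q + m * p) level s' w) = chi s' * (of_int level * w + of_int s') ^ k * Q w"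
    by (rule Q_law[OF det _ w(1)]) simp
  moreover have "moebius p (q + m * p) level s' w = moebius p q level s z"
    using moebius_translate[of p q m level s w] m by (simp add: w_def)
  moreover have "Q (moebius p q level s z) = chi s * (of_int level * z + of_int s) ^ k * Q z"
    by (rule Q_law[OF pq _ z(1)]) simp
  moreover have "of_int level * w + of_int s' = of_int level * z + of_int s"
    by (simp add: w_def m algebra_simps)
  moreover have "of_int level * z + of_int s \<noteq> 0"
    by (rule moebius_denom_nonzero[OF z(1)]) (use level_pos in auto)
  ultimately show ?thesis using z w by simp
qed

text \<open>A product of matrices with lower rows \<open>(level, s)\<close> and
  \<open>(level, s')\<close> is evaluated in two ways; its lower right entry is
  \<open>s * s'\<close> modulo \<open>level\<close>.\<close>

lemma chi_mult:
  assumes "coprime s level" "coprime s' level"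
  shows "chi (s * s') = chi s * chi s'"
proof -
  obtain p q where pq: "p * s - q * level = 1" using assms(1) by (rule coprime_imp_matrix)
  obtain p' q' where pq': "p' * s' - q' * level = 1" using assms(2) by (rule coprime_imp_matrix)
  obtain z where z: "Im z > 0" "Q z \<noteq> 0" by (rule Q_nonzero)
  define w where "w = moebius p' q' level s' z"
  have w: "Im w > 0" unfolding w_def using z pq' by (intro Im_moebius_pos) auto
  let ?j = "of_int level * z + of_int s' :: complex"
  have nz: "?j \<noteq> 0" "of_int level * w + of_int s \<noteq> 0"
    using level_pos by (intro moebius_denom_nonzero[OF z(1)] moebius_denom_nonzero[OF w]; simp)+
  have mc: "moebius p q level s w = moebius (p * p' + q * level) (p * q' + q * s') 
      (level * p' + s * level) (level * q' + s * s') z"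
    unfolding w_def using z pq' by (intro moebius_compose) auto
  have det: "(p * p' + q * level) * (level * q' + s * s') - (p * q' + q * s') * (level * p' + s * level) = 1"
  proof -
    have "(p * p' + q * level) * (level * q' + s * s') - (p * q' + q * s') * (level * p' + s * level)
      = (p * s - q * level) * (p' * s' - q' * level)" by (simp add: algebra_simps)
    then show ?thesis using pq pq' by simp
  qed
  have "Q (moebius p q level s w) = chi s * (of_int level * w + of_int s) ^ k * (chi s' * ?j ^ k * Q z)"
    using Q_law[OF pq _ w] Q_law[OF pq' _ z(1)] by (simp add: w_def)
  moreover have "Q (moebius p q level s w) = chi (level * q' + s * s') *
      (of_int (level * p' + s * level) * z + of_int (level * q' + s * s')) ^ k * Q z"
    unfolding mc by (rule Q_law[OF det _ z(1)]) simp
  moreover have "of_int (level * p' + s * level) * z + of_int (level * q' + s * s') = (of_int level * w + of_int s) * ?j"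
    using nz(1) by (simp add: w_def moebius_def field_simps)
  ultimately have "chi (level * q' + s * s') = chi s * chi s'"
    using z nz by (simp add: power_mult_distrib)
  moreover have "coprime (s * s') level" using assms by simp
  then have "chi (level * q' + s * s') = chi (s * s')" by (rule chi_periodic) simp
  ultimately show ?thesis by simp
qed

lemma norm_chi: "coprime s level \<Longrightarrow> norm (chi s) = 1"
proof -
  assume cop: "coprime s level"
  have "\<bar>Legendre (int t) (int p)\<bar> = 1" if "p \<in># prime_factorization (nat \<bar>s\<bar>)" for p
  proof -
    have "p dvd nat \<bar>s\<bar>" "prime p" using that by (auto simp: in_prime_factors_iff)
    then have "int p dvd s" "\<not> is_unit (int p)" by (auto simp: nat_dvd_iff prime_nat_iff)
    then have "\<not> int p dvd int t" using cop by (auto simp: coprime_def level_def dvd_mult)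
    then show ?thesis by (auto simp: Legendre_def cong_0_iff)
  qed
  moreover have "\<bar>\<Prod>p\<in>#A. Legendre (int t) (int p)\<bar> = 1" if "\<forall>p\<in>#A. \<bar>Legendre (int t) (int p)\<bar> = 1" for A :: "nat multiset"
    using that by (induction A) (auto simp: abs_mult)
  ultimately have "\<bar>\<Prod>p\<in>#prime_factorization (nat \<bar>s\<bar>). Legendre (int t) (int p)\<bar> = 1" by blast
  then have "norm (of_int (\<Prod>p\<in>#prime_factorization (nat \<bar>s\<bar>). Legendre (int t) (int p)) :: complex) = 1"
    by (metis norm_of_int of_int_1 of_int_abs)
  then show ?thesis by (simp add: chi_def norm_mult norm_power)
qed

end

section \<open>Products and dilations of series, factorization of integer matrices\<close>

lemma Cauchy_product_unit_series:
  assumes "unit_series a" "unit_series b"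
  defines "c \<equiv> \<lambda>n. \<Sum>i\<le>n. a i * b (n - i)"
  shows "unit_series c" "norm x < 1 \<Longrightarrow> pseries c x = pseries a x * pseries b x"
proof -
  have *: "(\<lambda>n. c n * x ^ n) sums (pseries a x * pseries b x)" if x: "norm x < 1" for x
  proof -
    have "(\<lambda>n. \<Sum>i\<le>n. (a i * x ^ i) * (b (n - i) * x ^ (n - i))) sums
       ((\<Sum>n. a n * x ^ n) * (\<Sum>n. b n * x ^ n))"
      by (intro Cauchy_product_sums unit_series_abs_summable assms x)
    moreover have "(\<Sum>i\<le>n. (a i * x ^ i) * (b (n - i) * x ^ (n - i))) = c n * x ^ n" for n
      unfolding c_def sum_distrib_right
    proof (rule sum.cong[OF refl])
      fix i assume "i \<in> {..n}"
      then have "x ^ n = x ^ i * x ^ (n - i)" by (simp flip: power_add)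
      then show "(a i * x ^ i) * (b (n - i) * x ^ (n - i)) = a i * b (n - i) * x ^ n" by simp
    qed
    ultimately show ?thesis by (simp add: pseries_def)
  qed
  then show "unit_series c" by (auto simp: unit_series_def sums_iff)
  show "norm x < 1 \<Longrightarrow> pseries c x = pseries a x * pseries b x"
    using * by (simp add: pseries_def sums_iff)
qed

lemma norm_power_less_1:
  fixes x :: "'a::real_normed_div_algebra"
  assumes "norm x < 1" "t > 0" shows "norm (x ^ t) < 1"
  using power_decreasing[of 1 t "norm x"] assms by (simp add: norm_power)

lemma unit_series_dilate:
  assumes a: "unit_series a" and t: "t > 0"
  defines "b \<equiv> \<lambda>n. if t dvd n then a (n div t) else 0"
  shows "unit_series b" "norm x < 1 \<Longrightarrow> pseries b x = pseries a (x ^ t)"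
proof -
  have *: "(\<lambda>n. b n * x ^ n) sums pseries a (x ^ t)" if "norm x < 1" for x
  proof -
    have "norm (x ^ t) < 1" using that t by (rule norm_power_less_1)
    then have "(\<lambda>n. a n * (x ^ t) ^ n) sums pseries a (x ^ t)" by (intro pseries_sums a)
    then have "(\<lambda>n. b (t * n) * x ^ (t * n)) sums pseries a (x ^ t)"
      using t by (simp add: b_def power_mult)
    then show ?thesis
      by (subst (asm) sums_mono_reindex[of "\<lambda>n. t * n" "\<lambda>n. b n * x ^ n"])
        (use t in \<open>auto simp: strict_mono_def b_def elim!: dvdE\<close>)
  qed
  then show "unit_series b" by (auto simp: unit_series_def sums_iff)
  show "norm x < 1 \<Longrightarrow> pseries b x = pseries a (x ^ t)"
    using * by (simp add: pseries_def sums_iff)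
qed

text \<open>Hermite normal form: the first column divided by its gcd is completed to a unimodular
  matrix by Bezout.\<close>

lemma upper_triangular_factor:
  fixes P R U V n :: int
  assumes det: "P * V - R * U = n" and n: "n > 0"
  obtains \<alpha> \<beta> \<delta> p q r s where "\<alpha> > 0" "\<delta> > 0" "\<alpha> * \<delta> = n" "p * s - q * r = 1"
    "P = p * \<alpha>" "U = r * \<alpha>" "R = p * \<beta> + q * \<delta>" "V = r * \<beta> + s * \<delta>"
proof -
  define \<alpha> where "\<alpha> = gcd P U"
  have "\<alpha> \<noteq> 0" using det n by (auto simp: \<alpha>_def)
  then have \<alpha>: "\<alpha> > 0" unfolding \<alpha>_def by (metis gcd_ge_0_int le_less)
  obtain p r where p: "P = p * \<alpha>" "U = r * \<alpha>" "coprime p r"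
    using gcd_coprime_exists[of P U] \<open>\<alpha> \<noteq> 0\<close> unfolding \<alpha>_def by blast
  obtain u v where uv: "u * p + v * r = 1"
    using bezout_int[of p r] p(3) by auto
  define \<delta> where "\<delta> = p * V - r * R"
  have ad: "\<alpha> * \<delta> = n" using det by (simp add: \<delta>_def p(1,2) algebra_simps)
  then have \<delta>: "\<delta> > 0" using \<alpha> n by (metis zero_less_mult_pos)
  define \<beta> where "\<beta> = u * R + v * V"
  have "p * \<beta> + (- v) * \<delta> = (u * p + v * r) * R" "r * \<beta> + u * \<delta> = (u * p + v * r) * V"
    by (simp_all add: \<beta>_def \<delta>_def algebra_simps)
  then show ?thesis using that[of \<alpha> \<delta> p u "- v" r \<beta>] \<alpha> \<delta> ad p uv by (simp add: mult.commute)
qed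

section \<open>The coefficients of the quotient and their growth\<close>

context plus_eigenform
begin

definition theta_t :: "nat \<Rightarrow> complex" where
  "theta_t n = (if t dvd n then theta_coeff (n div t) else 0)"

lemma unit_series_theta_t: "unit_series theta_t"
  unfolding theta_t_def[abs_def] by (rule unit_series_dilate[OF unit_series_theta t_pos])

lemma pseries_theta_t: "norm x < 1 \<Longrightarrow> pseries theta_t x = pseries theta_coeff (x ^ t)"
  unfolding theta_t_def[abs_def] by (rule unit_series_dilate[OF unit_series_theta t_pos])

lemma norm_power_t_less_1: "norm (x::complex) < 1 \<Longrightarrow> norm (x ^ t) < 1"
  using t_pos by (rule norm_power_less_1[rotated])

definition qc :: "nat \<Rightarrow> complex" where
  "qc = (SOME c. unit_series c \<and> (\<forall>x. norm x < 1 \<longrightarrow> pseries c x = pseries a x / pseries theta_t x))"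

text \<open>Theta has no zeros in the disc, so the quotient is holomorphic on all of it, the centre
  included.\<close>

lemma qc: "unit_series qc" "norm x < 1 \<Longrightarrow> pseries qc x = pseries a x / pseries theta_t x"
proof -
  have "(\<lambda>x. pseries a x / pseries theta_t x) holomorphic_on ball 0 1"
    by (intro holomorphic_intros pseries_holomorphic unit unit_series_theta_t)
      (simp add: pseries_theta_t pseries_theta_nonzero norm_power_t_less_1)
  then obtain c where "unit_series c" "\<And>x. norm x < 1 \<Longrightarrow> pseries c x = pseries a x / pseries theta_t x"
    by (rule unit_series_of_holomorphic) blast
  then have ex: "\<exists>c. unit_series c \<and> (\<forall>x. norm x < 1 \<longrightarrow> pseries c x = pseries a x / pseries theta_t x)" by blast
  from someI_ex[OF ex] show "unit_series qc" "norm x < 1 \<Longrightarrow> pseries qc x = pseries a x / pseries theta_t x"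
    unfolding qc_def by blast+
qed

lemma qseries_qc: "Im z > 0 \<Longrightarrow> qseries qc z = Q z"
  using qc(2)[of "qexp z"] pseries_theta_t[of "qexp z"]
  by (simp add: qseries_def Q_def norm_qexp_less_1_iff qexp_of_nat_mult)

lemma a_conv_qc: "a n = (\<Sum>i\<le>n. theta_t i * qc (n - i))"
proof -
  have "a = (\<lambda>n. \<Sum>i\<le>n. theta_t i * qc (n - i))"
  proof (rule pseries_unique[OF unit Cauchy_product_unit_series(1)[OF unit_series_theta_t qc(1)]])
    fix x :: complex assume x: "norm x < 1"
    have "pseries theta_t x \<noteq> 0"
      using x by (simp add: pseries_theta_t pseries_theta_nonzero norm_power_t_less_1)
    then show "pseries a x = pseries (\<lambda>n. \<Sum>i\<le>n. theta_t i * qc (n - i)) x"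
      using Cauchy_product_unit_series(2)[OF unit_series_theta_t qc(1) x] qc(2)[OF x] by simp
  qed
  then show ?thesis by metis
qed

lemma theta_t_less: "0 < i \<Longrightarrow> i < t \<Longrightarrow> theta_t i = 0" and theta_t_0 [simp]: "theta_t 0 = 1"
  by (auto simp: theta_t_def theta_coeff_def dest: dvd_imp_le)

lemma qc_eq_a:
  assumes "n < t" shows "qc n = a n"
proof -
  have "(\<Sum>i\<le>n. theta_t i * qc (n - i)) = (\<Sum>i\<in>{0}. theta_t i * qc (n - i))"
    by (rule sum.mono_neutral_right) (use assms in \<open>auto simp: theta_t_less\<close>)
  then show ?thesis using a_conv_qc[of n] by simp
qed

lemma qc_less: "n < t \<Longrightarrow> qc n = 0"
  using qc_eq_a leading by simp

text \<open>Only indices \<open>t * m\<^sup>2\<close> contribute from theta. With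
  \<open>j = n - m\<close> or \<open>j = n + m\<close> the two signs of \<open>m\<close> become the
  two halves of the range of \<open>j\<close>; its end points would carry
  \<open>qc 0 = 0\<close>.\<close>

lemma coeff_t_square:
  assumes n: "n > 0"
  shows "a (t * n\<^sup>2) = (\<Sum>j\<in>{1..<2*n}. qc (t * j * (2 * n - j)))"
proof -
  define g where "g m = qc (t * (n\<^sup>2 - m\<^sup>2))" for m
  have sub: "n\<^sup>2 - m\<^sup>2 = (n - m) * (n + m)" for m :: nat
  proof (cases "m \<le> n")
    case True
    then obtain d where "n = m + d" by (auto simp: le_iff_add)
    then show ?thesis by (simp add: power2_eq_square algebra_simps)
  next
    case False
    then have "n\<^sup>2 \<le> m\<^sup>2" by (intro power_mono) auto
    with False show ?thesis by simp
  qed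
  have "a (t * n\<^sup>2) = (\<Sum>i\<le>t * n\<^sup>2. theta_t i * qc (t * n\<^sup>2 - i))" by (rule a_conv_qc)
  also have "\<dots> = (\<Sum>i\<in>(\<lambda>m. t * m\<^sup>2) ` {..n}. theta_t i * qc (t * n\<^sup>2 - i))"
  proof (rule sum.mono_neutral_right)
    show "(\<lambda>m. t * m\<^sup>2) ` {..n} \<subseteq> {..t * n\<^sup>2}" by (auto intro: power_mono)
    show "\<forall>i\<in>{..t * n\<^sup>2} - (\<lambda>m. t * m\<^sup>2) ` {..n}. theta_t i * qc (t * n\<^sup>2 - i) = 0"
    proof
      fix i assume i: "i \<in> {..t * n\<^sup>2} - (\<lambda>m. t * m\<^sup>2) ` {..n}"
      have "theta_t i = 0"
      proof (rule ccontr)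
        assume "theta_t i \<noteq> 0"
        then have "t dvd i" "\<exists>m. i div t = m\<^sup>2"
          by (auto simp: theta_t_def theta_coeff_def split: if_splits intro: exI[of _ 0])
        then obtain m where "i div t = m\<^sup>2" by blast
        then have m: "i = t * m\<^sup>2" using \<open>t dvd i\<close> by (metis dvd_mult_div_cancel)
        then have "m\<^sup>2 \<le> n\<^sup>2" using i t_pos by simp
        then have "m \<le> n" by (rule power2_le_imp_le) simp
        with i m show False by auto
      qed
      then show "theta_t i * qc (t * n\<^sup>2 - i) = 0" by simp
    qed
  qed simp
  also have "\<dots> = (\<Sum>m\<le>n. theta_coeff (m\<^sup>2) * g m)"
    using t_pos by (subst sum.reindex) (auto simp: inj_on_def g_def theta_t_def diff_mult_distrib2)
  also have "{..n} = insert 0 {1..n}" by auto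
  also have "(\<Sum>m\<in>insert 0 {1..n}. theta_coeff (m\<^sup>2) * g m) = g 0 + (\<Sum>m\<in>{1..n}. 2 * g m)"
    by (subst sum.insert) (auto simp: theta_coeff_def)
  also have "(\<Sum>m\<in>{1..n}. 2 * g m) = (\<Sum>m\<in>{1..<n}. 2 * g m)"
  proof -
    have "g n = 0" using qc_less[OF t_pos] by (simp add: g_def)
    moreover have "{1..n} = insert n {1..<n}" using n by auto
    ultimately show ?thesis by simp
  qed
  also have "g 0 + (\<Sum>m\<in>{1..<n}. 2 * g m) = (\<Sum>j\<in>{1..<2*n}. qc (t * j * (2 * n - j)))"
  proof -
    let ?h = "\<lambda>j. qc (t * j * (2 * n - j))"
    have "(\<Sum>j\<in>{1..<n}. ?h j) = (\<Sum>m\<in>{1..<n}. g m)"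
      by (rule sum.reindex_bij_witness[of _ "\<lambda>m. n - m" "\<lambda>j. n - j"]) (auto simp: g_def sub mult_2 mult_2_right mult.assoc mult.commute mult.left_commute)
    moreover have "(\<Sum>j\<in>{n<..<2*n}. ?h j) = (\<Sum>m\<in>{1..<n}. g m)"
      by (rule sum.reindex_bij_witness[of _ "\<lambda>m. n + m" "\<lambda>j. j - n"]) (auto simp: g_def sub mult_2 mult_2_right mult.assoc mult.commute mult.left_commute)
    moreover have "?h n = g 0" by (simp add: g_def power2_eq_square mult_ac)
    moreover have "{1..<2*n} = {1..<n} \<union> ({n} \<union> {n<..<2*n})" using n by auto
    then have "(\<Sum>j\<in>{1..<2*n}. ?h j) = (\<Sum>j\<in>{1..<n}. ?h j) + (\<Sum>j\<in>{n} \<union> {n<..<2*n}. ?h j)"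
      by (simp only:) (rule sum.union_disjoint; auto)
    ultimately show ?thesis by (simp add: sum_distrib_left[symmetric])
  qed
  finally show ?thesis .
qed

text \<open>This factors the matrix multiplied on the left by the diagonal matrix of
  \<open>t\<close> and 1. As \<open>\<delta>\<close> divides the odd \<open>t\<close>, adding
  \<open>\<beta> * \<delta>\<close> to \<open>\<beta>\<close> makes it even. Both the diagonal and
  the triangular factor are then the identity modulo 2, which preserves the index of a
  branch.\<close>

lemma upper_triangular_factor_even:
  assumes pqrs: "p * s - q * r = (1::int)"
  obtains \<alpha> \<beta> \<delta> p' q' r' s' where "\<alpha> > 0" "\<delta> > 0" "\<alpha> * \<delta> = int t" "even \<beta>" "p' * s' - q' * r' = 1"
    "int t * p = p' * \<alpha>" "r = r' * \<alpha>" "int t * q = p' * \<beta> + q' * \<delta>" "s = r' * \<beta> + s' * \<delta>"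
proof -
  have det: "int t * p * s - int t * q * r = int t"
  proof -
    have "int t * p * s - int t * q * r = int t * (p * s - q * r)" by (simp add: algebra_simps)
    then show ?thesis using pqrs by simp
  qed
  have "int t > 0" using t_pos by simp
  obtain \<alpha> \<beta> \<delta> p' q' r' s' where *: "\<alpha> > 0" "\<delta> > 0" "\<alpha> * \<delta> = int t" "p' * s' - q' * r' = 1"
    "int t * p = p' * \<alpha>" "r = r' * \<alpha>" "int t * q = p' * \<beta> + q' * \<delta>" "s = r' * \<beta> + s' * \<delta>"
    by (rule upper_triangular_factor[OF det \<open>int t > 0\<close>])
  have "odd (\<alpha> * \<delta>)" unfolding *(3) using odd_t by simp
  then have "even (\<beta> + \<beta> * \<delta>)" by simp
  with * show ?thesis
    using that[of \<alpha> \<delta> "\<beta> + \<beta> * \<delta>" p' "s' - \<beta> * r'" "q' - \<beta> * p'" r'] by (simp add: algebra_simps)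
qed

end

text \<open>A branch of theta has at most a simple zero at its cusp, as a series in the nome. What
  remains after removing it has no zeros in the disc, hence is bounded below on a smaller closed
  disc.\<close>

lemma theta_branch_lower_bound:
  assumes y0: "y0 > 0"
  obtains c where "c > 0"
    "\<And>u v w. Im w \<ge> y0 \<Longrightarrow> norm (theta.branch u v w) \<ge> c * exp (- pi * Im w / 4)"
proof -
  let ?r = "exp (- pi * y0 / 4)"
  have r: "?r < 1" "?r \<ge> 0" using y0 by auto
  obtain c1 where c1: "c1 > 0" "\<And>x. norm x \<le> ?r \<Longrightarrow> norm (pseries theta_coeff x) \<ge> c1"
    by (rule pseries_bounded_below[OF unit_series_theta r pseries_theta_nonzero]) (assumption, rule that)
  obtain c2 where c2: "c2 > 0" "\<And>x. norm x \<le> ?r \<Longrightarrow> norm (pseries (\<lambda>n. theta.odd_coeff (n + 1)) x) \<ge> c2"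
    by (rule pseries_bounded_below[OF unit_series_shift[OF theta.unit_series_odd_coeff] r pseries_theta_odd_nonzero]) (assumption, rule that)
  have "norm (theta.branch u v w) \<ge> min c1 c2 * exp (- pi * Im w / 4)" if w: "Im w \<ge> y0" for u v w
  proof -
    let ?x = "theta.nome u v w"
    have w0: "Im w > 0" using w y0 by simp
    have "norm ?x \<le> exp (- pi * Im w / 4)" using w0 by (intro theta.norm_nome_le) simp
    also have "\<dots> \<le> ?r" using w by simp
    finally have x: "norm ?x \<le> ?r" .
    have br: "theta.branch u v w = pseries (theta.branch_coeff u) ?x"
      by (rule theta.branch_conv_pseries[OF w0])
    show ?thesis
    proof (cases "even u")
      case True
      then have "theta.branch_coeff u = theta.odd_coeff"
        by (simp add: theta.branch_coeff_def fun_eq_iff)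
      then have "theta.branch u v w = ?x * pseries (\<lambda>n. theta.odd_coeff (n + 1)) ?x"
        using br pseries_shift[OF theta.unit_series_odd_coeff, of 1 ?x] theta.norm_nome_less_1[OF w0, of u v]
        by (simp add: theta.odd_coeff_def)
      moreover have "norm ?x = exp (- pi * Im w / 4)" using True by (simp add: theta.norm_nome)
      moreover have "exp (- pi * Im w / 4) * min c1 c2 \<le> exp (- pi * Im w / 4) * norm (pseries (\<lambda>n. theta.odd_coeff (n + 1)) ?x)"
        using c2(2)[OF x] by (intro mult_left_mono) auto
      ultimately show ?thesis by (simp add: norm_mult mult.commute)
    next
      case False
      then have "theta.branch_coeff u = theta_coeff"
        by (simp add: theta.branch_coeff_def fun_eq_iff)
      moreover have "min c1 c2 * exp (- pi * Im w / 4) \<le> c1 * 1"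
        using c1(1) c2(1) w0 by (intro mult_mono) auto
      ultimately show ?thesis using br c1(2)[OF x] by simp
    qed
  qed
  with c1(1) c2(1) show ?thesis by (intro that[of "min c1 c2"]) auto
qed

context plus_eigenform
begin

lemma norm_Q_conv_pet:
  assumes z: "Im z > 0"
  shows "norm (Q z) = pet 1 1 (2 * z) / theta.pet 1 1 (2 * of_nat t * z) * 
     (real t powr (1/4) * (2 * Im z) powr - (real k / 2))"
proof -
  have e1: "norm (qseries a z) = pet 1 1 (2 * z) / (2 * Im z) powr (real k / 2 + 1/4)"
    using z by (simp add: pet_def branch_def)
  have e2: "norm (qseries theta_coeff (of_nat t * z)) = theta.pet 1 1 (2 * of_nat t * z) / (2 * real t * Im z) powr (1/4)"
    using z t_pos by (simp add: theta.pet_def theta.branch_def)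
  have e3: "(2 * real t * Im z) powr (1/4) / (2 * Im z) powr (real k / 2 + 1/4) = 
     real t powr (1/4) * (2 * Im z) powr - (real k / 2)"
  proof -
    have "(2 * real t * Im z) powr (1/4) = real t powr (1/4) * (2 * Im z) powr (1/4)"
      using z by (subst powr_mult[symmetric]) (auto simp: mult_ac)
    then show ?thesis unfolding powr_add powr_minus_divide using z by simp
  qed
  have gen: "(A / X) / (T / Y) = A / T * (Y / X)" for A X T Y :: real by simp
  show ?thesis unfolding Q_def norm_divide e1 e2 gen e3 ..
qed

text \<open>With \<open>2 * z\<close> moved to height \<open>v \<ge> 1/2\<close>, the numerator
  carries \<open>exp (- pi * t * v / 4)\<close>. The point for theta moves to height at most
  \<open>t * v\<close>, so the denominator loses no more than that. The exponentials cancel by the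
  choice of \<open>t\<close>, and powers of \<open>v \<le> 1 / Im (2 * z)\<close> remain.\<close>

lemma Q_growth:
  obtains B where "B > 0" "\<And>z. 0 < Im z \<Longrightarrow> Im z \<le> 1/2 \<Longrightarrow> norm (Q z) \<le> B / Im z ^ k"
proof -
  obtain B where B: "B > 0" "\<And>u v w. Im w \<ge> 1/2 \<Longrightarrow> norm (branch u v w) \<le> B * exp (- pi * real t * Im w / 4)"
    by (rule branch_bound[of t, OF leading(2)]) (assumption, rule that)
  have "1 / (2 * real t) > 0" using t_pos by simp
  then obtain c where c: "c > 0"
    "\<And>u v w. Im w \<ge> 1 / (2 * real t) \<Longrightarrow> norm (theta.branch u v w) \<ge> c * exp (- pi * Im w / 4)"
    by (rule theta_branch_lower_bound) (rule that)
  define K where "K = B / c * real t powr (1/4) * real t powr (1/4)"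
  have K: "K > 0" using B c t_pos by (simp add: K_def)
  have "norm (Q z) \<le> K / Im z ^ k" if z: "Im z > 0" "Im z \<le> 1/2" for z
  proof -
    define \<zeta> where "\<zeta> = 2 * z"
    have \<zeta>: "Im \<zeta> > 0" "Im \<zeta> \<le> 1" using z by (auto simp: \<zeta>_def)
    obtain p q r s w where g: "p * s - q * r = 1" "Im w \<ge> 1 / 2" "\<zeta> = moebius p q r s w"
      by (rule reduce_to_Im_ge_half[OF \<zeta>(1)])
    define v where "v = Im w"
    have v: "v \<ge> 1/2" "v > 0" using g by (auto simp: v_def)
    \<comment> \<open>The denominator is at least \<open>v\<close>: for \<open>r \<noteq> 0\<close>
      by its imaginary part, for \<open>r = 0\<close> because then
      \<open>v = Im \<zeta> \<le> 1\<close>.\<close>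
    have vle: "v \<le> 1 / Im \<zeta>"
    proof -
      have nrm: "norm (of_int r * w + of_int s) \<ge> v"
      proof (cases "r = 0")
        case True
        then have "s = 1 \<or> s = -1" using g(1) by (auto simp: zmult_eq_1_iff)
        moreover have "Im \<zeta> = v / (norm (of_int r * w + of_int s))\<^sup>2"
          using g v unfolding g(3) by (subst Im_moebius) (auto simp: v_def)
        ultimately show ?thesis using True \<zeta>(2) by auto
      next
        case False
        have "v * 1 \<le> v * \<bar>real_of_int r\<bar>" using False v by (intro mult_left_mono) linarith+
        also have "\<dots> = \<bar>Im (of_int r * w + of_int s)\<bar>" using v by (simp add: v_def abs_mult)
        also have "\<dots> \<le> norm (of_int r * w + of_int s)" by (rule abs_Im_le_cmod)
        finally show ?thesis by simp
      qed
      have "Im \<zeta> = v / (norm (of_int r * w + of_int s))\<^sup>2"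
        using g v unfolding g(3) by (subst Im_moebius) (auto simp: v_def)
      also have "\<dots> \<le> v / v\<^sup>2" using nrm v by (intro divide_left_mono power_mono mult_pos_pos) (auto intro: zero_less_power)
      finally have "Im \<zeta> \<le> 1 / v" using v by (simp add: power2_eq_square)
      then have "Im \<zeta> * v \<le> 1" using v by (simp add: pos_le_divide_eq)
      then show ?thesis using \<zeta> by (simp add: pos_le_divide_eq mult.commute)
    qed
    obtain \<alpha> \<beta> \<delta> p' q' r' s' where m: "\<alpha> > 0" "\<delta> > 0" "\<alpha> * \<delta> = int t" "even \<beta>" "p' * s' - q' * r' = 1"
      "int t * p = p' * \<alpha>" "r = r' * \<alpha>" "int t * q = p' * \<beta> + q' * \<delta>" "s = r' * \<beta> + s' * \<delta>"
      by (rule upper_triangular_factor_even[OF g(1)])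
    define w' where "w' = moebius \<alpha> \<beta> 0 \<delta> w"
    have w0: "Im w > 0" using v by (simp add: v_def)
    have imw': "Im w' = real_of_int \<alpha> * v / real_of_int \<delta>"
      using m(1,2) by (simp add: w'_def moebius_def v_def)
    have w'0: "Im w' > 0" using imw' m v by simp
    have ad: "real_of_int \<alpha> * real_of_int \<delta> = real t" using arg_cong[OF m(3), of real_of_int] by simp
    have \<alpha>1: "real_of_int \<alpha> \<ge> 1" "real_of_int \<delta> \<ge> 1" using m(1,2) by linarith+
    have \<alpha>t: "real_of_int \<alpha> \<le> real t" "real_of_int \<delta> \<le> real t"
      using \<alpha>1 ad mult_right_mono[of 1 "real_of_int \<alpha>" "real_of_int \<delta>"] mult_left_mono[of 1 "real_of_int \<delta>" "real_of_int \<alpha>"] by simp_all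
    have up: "Im w' \<le> real t * v"
    proof -
      have "real_of_int \<alpha> * v / real_of_int \<delta> \<le> real_of_int \<alpha> * v / 1"
        using \<alpha>1 v by (intro divide_left_mono) auto
      also have "\<dots> \<le> real t * v" using \<alpha>t v by simp
      finally show ?thesis using imw' by simp
    qed
    have low: "v / real t \<le> Im w'"
    proof -
      have "v / real t \<le> v / real_of_int \<delta>" using \<alpha>1 \<alpha>t v by (intro divide_left_mono) auto
      also have "\<dots> \<le> real_of_int \<alpha> * v / real_of_int \<delta>" using \<alpha>1 v by (intro divide_right_mono) auto
      finally show ?thesis using imw' by simp
    qed
    have tz: "2 * of_nat t * z = moebius p' q' r' s' w'"
    proof -
      have "2 * of_nat t * z = of_nat t * moebius p q r s w" by (simp add: g(3)[symmetric] \<zeta>_def)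
      also have "\<dots> = moebius (int t * p) (int t * q) r s w" by (simp add: moebius_def algebra_simps)
      also have "\<dots> = moebius (p' * \<alpha> + q' * 0) (p' * \<beta> + q' * \<delta>) (r' * \<alpha> + s' * 0) (r' * \<beta> + s' * \<delta>) w"
        by (simp only: m(6-9)) simp
      also have "\<dots> = moebius p' q' r' s' w'"
        unfolding w'_def using w0 m(1,2) by (intro moebius_compose[symmetric]) auto
      finally show ?thesis .
    qed
    have "odd (\<alpha> * \<delta>)" using m(3) odd_t by simp
    then have "odd \<alpha>" "odd \<delta>" by simp_all
    have par1: "even (p' + r') = even (p + r)"
    proof -
      have "even (p' * \<alpha> + r' * \<alpha>) = even (int t * p + r)" using m(6,7) by simp
      then show ?thesis using \<open>odd \<alpha>\<close> odd_t by simp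
    qed
    have par2: "even (q' + s') = even (q + s)"
    proof -
      have "even ((p' * \<beta> + q' * \<delta>) + (r' * \<beta> + s' * \<delta>)) = even (int t * q + s)" using m(8,9) by simp
      then show ?thesis using \<open>odd \<delta>\<close> \<open>even \<beta>\<close> odd_t by simp
    qed
    have pf: "pet 1 1 (2 * z) = pet (p + r) (q + s) w"
      using pet_moebius[OF g(1) w0] by (simp add: g(3)[symmetric] \<zeta>_def)
    have pth: "theta.pet 1 1 (2 * of_nat t * z) = theta.pet (p + r) (q + s) w'"
      using theta.pet_moebius[OF m(5) w'0] theta.pet_parity[OF par1 par2] by (simp add: tz)
    define E where "E = exp (- pi * real t * v / 4)"
    have E: "E > 0" by (simp add: E_def)
    have uf: "pet (p + r) (q + s) w \<le> B * E * v powr (real k / 2 + 1/4)"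
      unfolding pet_def v_def[symmetric] E_def using B(2)[OF g(2), of "p + r" "q + s"]
      by (intro mult_right_mono) (auto simp: v_def)
    have lth: "theta.pet (p + r) (q + s) w' \<ge> c * E * (v / real t) powr (1/4)"
    proof -
      have "1 / (2 * real t) \<le> v / real t" using v t_pos by (simp add: field_simps)
      then have "c * exp (- pi * Im w' / 4) \<le> norm (theta.branch (p + r) (q + s) w')"
        using low by (intro c(2)) linarith
      moreover have "E \<le> exp (- pi * Im w' / 4)" using up by (simp add: E_def)
      then have "c * E \<le> c * exp (- pi * Im w' / 4)" using c by simp
      ultimately have "c * E \<le> norm (theta.branch (p + r) (q + s) w')" by linarith
      moreover have "(v / real t) powr (1/4) \<le> Im w' powr (1/4)"
        using low v t_pos by (intro powr_mono2) auto
      ultimately show ?thesis unfolding theta.pet_def using c E by (intro mult_mono) auto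
    qed
    have "pet 1 1 (2 * z) / theta.pet 1 1 (2 * of_nat t * z) \<le> 
       B * E * v powr (real k / 2 + 1/4) / (c * E * (v / real t) powr (1/4))"
      unfolding pf pth using uf lth B c E v t_pos by (intro frac_le) auto
    also have "\<dots> = B / c * real t powr (1/4) * v powr (real k / 2)"
    proof -
      have gen: "B * E * (V * X) / (c * E * (X / T)) = B / c * T * V" if "X > 0" "T > 0" for V X T :: real
        using E c that by (simp add: field_simps)
      have "(v / real t) powr (1/4) = v powr (1/4) / real t powr (1/4)" using v by (simp add: powr_divide)
      then show ?thesis using gen[of "v powr (1/4)" "real t powr (1/4)" "v powr (real k / 2)"] v t_pos
        unfolding powr_add by simp
    qed
    finally have rat: "pet 1 1 (2 * z) / theta.pet 1 1 (2 * of_nat t * z) \<le> B / c * real t powr (1/4) * v powr (real k / 2)" .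
    have "norm (Q z) \<le> (B / c * real t powr (1/4) * v powr (real k / 2)) * (real t powr (1/4) * (2 * Im z) powr - (real k / 2))"
      unfolding norm_Q_conv_pet[OF z(1)] using rat by (rule mult_right_mono) auto
    also have "\<dots> = K * (v powr (real k / 2) * Im \<zeta> powr - (real k / 2))"
      by (simp add: K_def \<zeta>_def mult_ac)
    also have "\<dots> \<le> K * ((1 / Im \<zeta>) powr (real k / 2) * Im \<zeta> powr - (real k / 2))"
      using K vle v by (intro mult_left_mono mult_right_mono powr_mono2) auto
    also have "(1 / Im \<zeta>) powr (real k / 2) * Im \<zeta> powr - (real k / 2) = Im \<zeta> powr - real k"
    proof -
      have "(1 / Im \<zeta>) powr (real k / 2) = Im \<zeta> powr - (real k / 2)"
        unfolding powr_minus_divide using \<zeta> by (simp add: powr_divide)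
      then show ?thesis using \<zeta> by (simp flip: powr_add)
    qed
    also have "Im \<zeta> powr - real k = 1 / Im \<zeta> ^ k"
      unfolding powr_minus_divide using \<zeta> by (simp add: powr_realpow)
    also have "K * (1 / Im \<zeta> ^ k) \<le> K * (1 / Im z ^ k)"
      using K z by (intro mult_left_mono divide_left_mono power_mono) (auto simp: \<zeta>_def)
    finally show ?thesis by simp
  qed
  with K show ?thesis by (rule that)
qed

text \<open>Cauchy's inequality at height \<open>1 / (2 * n)\<close>, where the \<open>n\<close>-th
  power of the radius is the constant \<open>exp (- pi)\<close> and \<open>Q_growth\<close> applies
  for every \<open>n > 0\<close>.\<close>

lemma qc_bound:
  obtains B where "B > 0" "\<And>n. norm (qc n) \<le> B * real n ^ k"
proof -
  obtain B where B: "B > 0" "\<And>z. 0 < Im z \<Longrightarrow> Im z \<le> 1/2 \<Longrightarrow> norm (Q z) \<le> B / Im z ^ k"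
    by (rule Q_growth) (rule that)
  have "norm (qc n) \<le> (B * 2 ^ k * exp pi) * real n ^ k" for n
  proof (cases "n = 0")
    case True
    then show ?thesis using qc_less[OF t_pos] B(1) by simp
  next
    case False
    define y where "y = 1 / (2 * real n)"
    have y: "0 < y" "y \<le> 1/2" using False by (auto simp: y_def field_simps)
    have "norm (qc n) \<le> (B / y ^ k) / exp (- 2 * pi * y) ^ n"
    proof (rule pseries_coeff_bound[OF qc(1)])
      fix x :: complex assume x: "norm x = exp (- 2 * pi * y)"
      then have "x \<noteq> 0" by auto
      then obtain z where z: "qexp z = x" by (rule qexp_surj)
      then have "Im z = y" using x norm_qexp[of z] by simp
      then show "norm (pseries qc x) \<le> B / y ^ k"
        using B(2)[of z] y qseries_qc[of z] z by (simp add: qseries_def)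
    qed (use y in auto)
    also have "exp (- 2 * pi * y) ^ n = exp (- pi)"
      using False by (subst exp_of_nat_mult[symmetric]) (simp add: y_def)
    also have "(B / y ^ k) / exp (- pi) = (B * 2 ^ k * exp pi) * real n ^ k"
      using False by (simp add: y_def power_divide power_mult_distrib exp_minus field_simps)
    finally show ?thesis .
  qed
  with B(1) show ?thesis by (intro that[of "B * 2 ^ k * exp pi"]) auto
qed

end

section \<open>Hecke operators\<close>

context plus_eigenform
begin

text \<open>The standard triangular representatives of determinant \<open>n\<close>. Coprimality of
  \<open>a\<close> and \<open>level\<close> reflects that the character is 0 elsewhere.\<close>

definition hecke_reps :: "int \<Rightarrow> (int \<times> int \<times> int) set" where
  "hecke_reps n = {(a, b, d). a > 0 \<and> d > 0 \<and> a * d = n \<and> coprime a level \<and> 0 \<le> b \<and> b < d}"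

text \<open>This is \<open>n\<close> times the classical Hecke operator of weight
  \<open>k\<close>.\<close>

definition hecke :: "int \<Rightarrow> complex \<Rightarrow> complex" where
  "hecke n z = (\<Sum>(a, b, d)\<in>hecke_reps n. chi a * of_int a ^ k * Q (moebius a b 0 d z))"

lemma finite_hecke_reps: "finite (hecke_reps n)"
proof (rule finite_subset)
  show "hecke_reps n \<subseteq> {0..n} \<times> {0..n} \<times> {0..n}"
  proof
    fix x assume "x \<in> hecke_reps n"
    then obtain a b d where x: "x = (a, b, d)" "a > 0" "d > 0" "a * d = n" "0 \<le> b" "b < d"
      by (auto simp: hecke_reps_def)
    have "a \<le> n" "d \<le> n"
      using x mult_left_mono[of 1 d a] mult_right_mono[of 1 a d] by auto
    with x show "x \<in> {0..n} \<times> {0..n} \<times> {0..n}" by auto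
  qed
qed auto

text \<open>The product of a representative and the given matrix is factored again as unimodular
  times triangular, and \<open>\<beta>\<close> is reduced modulo \<open>\<delta>\<close>. The new
  \<open>\<alpha>\<close> is coprime to the level because \<open>p' * \<alpha>\<close> is congruent
  to \<open>e\<close>.\<close>

lemma hecke_rep_mult:
  assumes M: "(e, b, d) \<in> hecke_reps n" and g: "p * s - q * r = 1" "level dvd r" "level dvd p - 1"
  obtains a' b' d' p' q' r' s' where "(a', b', d') \<in> hecke_reps n" "p' * s' - q' * r' = 1" "level dvd r'"
    "e * p + b * r = p' * a'" "d * r = r' * a'" "e * q + b * s = p' * b' + q' * d'" "d * s = r' * b' + s' * d'"
proof -
  have M': "e > 0" "d > 0" "e * d = n" "coprime e level" "0 \<le> b" "b < d"
    using M by (auto simp: hecke_reps_def)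
  then have n: "n > 0" by auto
  have det: "(e * p + b * r) * (d * s) - (e * q + b * s) * (d * r) = n"
  proof -
    have "(e * p + b * r) * (d * s) - (e * q + b * s) * (d * r) = (e * d) * (p * s - q * r)"
      by (simp add: algebra_simps)
    then show ?thesis using g M' by simp
  qed
  obtain \<alpha> \<beta> \<delta> p' q' r' s' where *: "\<alpha> > 0" "\<delta> > 0" "\<alpha> * \<delta> = n" "p' * s' - q' * r' = 1"
    "e * p + b * r = p' * \<alpha>" "d * r = r' * \<alpha>" "e * q + b * s = p' * \<beta> + q' * \<delta>" "d * s = r' * \<beta> + s' * \<delta>"
    by (rule upper_triangular_factor[OF det n])
  define m where "m = \<beta> div \<delta>"
  define \<beta>' where "\<beta>' = \<beta> mod \<delta>"
  have \<beta>: "\<beta> = m * \<delta> + \<beta>'" by (simp add: m_def \<beta>'_def)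
  have "coprime (p' * \<alpha>) level"
  proof -
    have "(e * p + b * r) - e = e * (p - 1) + b * r" by (simp add: algebra_simps)
    moreover have "level dvd e * (p - 1) + b * r" using g(2,3) by simp
    ultimately have lv: "level dvd p' * \<alpha> - e" using *(5) by simp
    show ?thesis
    proof (rule coprimeI)
      fix c assume c: "c dvd p' * \<alpha>" "c dvd level"
      then have "c dvd p' * \<alpha> - e" using lv by (rule_tac dvd_trans)
      then have "c dvd e" using c(1) by (simp add: dvd_diff_right_iff dvd_diff_left_iff)
      then show "is_unit c" using M'(4) c(2) by (auto simp: coprime_def)
    qed
  qed
  then have cop: "coprime \<alpha> level" by simp
  have "level dvd r' * \<alpha>" using *(6) g(2) by (metis dvd_mult)
  then have "level dvd r'" using cop by (simp add: coprime_dvd_mult_left_iff coprime_commute)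
  moreover have "(\<alpha>, \<beta>', \<delta>) \<in> hecke_reps n"
    using * cop by (simp add: hecke_reps_def \<beta>'_def)
  moreover have "p' * (s' + m * r') - (q' + m * p') * r' = 1"
    using *(4) by (simp add: algebra_simps)
  ultimately show ?thesis
    using that[of \<alpha> \<beta>' \<delta> p' "s' + m * r'" "q' + m * p'" r'] * by (simp add: \<beta> algebra_simps)
qed

text \<open>Two representatives with the same image differ by a unimodular left factor. Positivity
  makes its upper left entry 1, and the range of \<open>b\<close> excludes a translation.\<close>

lemma hecke_rep_unique:
  assumes M1: "(a1, b1, d1) \<in> hecke_reps n" and M2: "(a2, b2, d2) \<in> hecke_reps n"
    and g: "p * s - q * r = 1"
    and e1: "p1 * s1 - q1 * r1 = 1" "a1 * p + b1 * r = p1 * a'" "d1 * r = r1 * a'"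
      "a1 * q + b1 * s = p1 * b' + q1 * d'" "d1 * s = r1 * b' + s1 * d'"
    and e2: "p2 * s2 - q2 * r2 = 1" "a2 * p + b2 * r = p2 * a'" "d2 * r = r2 * a'"
      "a2 * q + b2 * s = p2 * b' + q2 * d'" "d2 * s = r2 * b' + s2 * d'"
  shows "(a1, b1, d1) = (a2, b2, d2)"
proof -
  have key: "a1 = (p1 * s2 - q1 * r2) * a2 \<and> b1 = (p1 * s2 - q1 * r2) * b2 + (q1 * p2 - p1 * q2) * d2"
    if e1: "p1 * s1 - q1 * r1 = 1" "a1 * p + b1 * r = p1 * a'" "d1 * r = r1 * a'"
      "a1 * q + b1 * s = p1 * b' + q1 * d'" "d1 * s = r1 * b' + s1 * d'"
    and e2: "p2 * s2 - q2 * r2 = 1" "a2 * p + b2 * r = p2 * a'" "d2 * r = r2 * a'"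
      "a2 * q + b2 * s = p2 * b' + q2 * d'" "d2 * s = r2 * b' + s2 * d'"
    for p1 q1 r1 s1 a1 b1 d1 p2 q2 r2 s2 a2 b2 d2 :: int
  proof -
    \<comment> \<open>\<open>(x, y)\<close> is the upper row of the first representative minus the
      unimodular factor times the second; the matrix of determinant 1 annihilates it from the right,
      so it is 0.\<close>
    define x where "x = a1 - (p1 * s2 - q1 * r2) * a2"
    define y where "y = b1 - ((p1 * s2 - q1 * r2) * b2 + (q1 * p2 - p1 * q2) * d2)"
    have "x * p + y * r = (a1 * p + b1 * r) - (p1 * s2 - q1 * r2) * (a2 * p + b2 * r) - (q1 * p2 - p1 * q2) * (d2 * r)"
      by (simp add: x_def y_def algebra_simps)
    also have "\<dots> = p1 * a' * (1 - (p2 * s2 - q2 * r2))"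
      unfolding e1 e2(2-) by (simp add: algebra_simps)
    finally have xy1: "x * p + y * r = 0" using e2(1) by simp
    have "x * q + y * s = (a1 * q + b1 * s) - (p1 * s2 - q1 * r2) * (a2 * q + b2 * s) - (q1 * p2 - p1 * q2) * (d2 * s)"
      by (simp add: x_def y_def algebra_simps)
    also have "\<dots> = (p1 * b' + q1 * d') * (1 - (p2 * s2 - q2 * r2))"
      unfolding e1 e2(2-) by (simp add: algebra_simps)
    finally have xy2: "x * q + y * s = 0" using e2(1) by simp
    have "x * (p * s - q * r) = (x * p + y * r) * s - (x * q + y * s) * r"
      "y * (p * s - q * r) = (x * q + y * s) * p - (x * p + y * r) * q"
      by (simp_all add: algebra_simps)
    then have "x = 0" "y = 0" unfolding xy1 xy2 g by simp_all
    then show ?thesis by (simp add: x_def y_def)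
  qed
  have k1: "a1 = (p1 * s2 - q1 * r2) * a2" "b1 = (p1 * s2 - q1 * r2) * b2 + (q1 * p2 - p1 * q2) * d2"
    using key[OF e1 e2] by auto
  have k2: "a2 = (p2 * s1 - q2 * r1) * a1" "b2 = (p2 * s1 - q2 * r1) * b1 + (q2 * p1 - p2 * q1) * d1"
    using key[OF e2 e1] by auto
  have pos: "a1 > 0" "a2 > 0" "d1 > 0" "d2 > 0" "a1 * d1 = n" "a2 * d2 = n" "0 \<le> b1" "b1 < d1" "0 \<le> b2" "b2 < d2"
    using M1 M2 by (auto simp: hecke_reps_def)
  have "a2 dvd a1" by (subst k1(1)) simp
  moreover have "a1 dvd a2" by (subst k2(1)) simp
  ultimately have a: "a1 = a2" using pos by (simp add: zdvd_antisym_nonneg)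
  have "a1 * d1 = a1 * d2" using pos(5,6) a by simp
  then have d: "d1 = d2" using pos(1) by simp
  have "p1 * s2 - q1 * r2 = 1" using k1(1) a pos(1) by simp
  then have "b1 = b2 + (q1 * p2 - p1 * q2) * d2" using k1(2) by simp
  then have "b1 mod d2 = b2 mod d2" by simp
  then have "b1 = b2" using pos d by simp
  with a d show ?thesis by simp
qed

text \<open>Right multiplication permutes the representatives up to left factors covered by
  \<open>Q_law\<close>. The condition on \<open>p\<close> makes \<open>a'\<close> congruent to
  \<open>a * s'\<close>, so that the character of the left factor is absorbed into
  \<open>chi a'\<close>.\<close>

lemma hecke_law:
  assumes g: "p * s - q * r = 1" "level dvd r" "level dvd p - 1" and z: "Im z > 0"
  shows "hecke n (moebius p q r s z) = (of_int r * z + of_int s) ^ k * hecke n z"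
proof -
  define R where "R = (\<lambda>(a, b, d) (a', b', d'). \<exists>p' q' r' s'. p' * s' - q' * r' = 1 \<and> level dvd r' \<and>
    a * p + b * r = p' * a' \<and> d * r = r' * a' \<and> a * q + b * s = p' * b' + q' * d' \<and> d * s = r' * b' + s' * d')"
  have "\<exists>M'. M' \<in> hecke_reps n \<and> R M M'" if M0: "M \<in> hecke_reps n" for M
  proof -
    obtain a b d where M: "M = (a, b, d)" by (cases M)
    obtain a' b' d' p' q' r' s' where "(a', b', d') \<in> hecke_reps n" "p' * s' - q' * r' = 1" "level dvd r'"
      "a * p + b * r = p' * a'" "d * r = r' * a'" "a * q + b * s = p' * b' + q' * d'" "d * s = r' * b' + s' * d'"
      by (rule hecke_rep_mult[OF M0[unfolded M] g])
    then show ?thesis unfolding M by (intro exI[of _ "(a', b', d')"]) (auto simp: R_def)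
  qed
  then have "\<forall>M\<in>hecke_reps n. \<exists>M'. M' \<in> hecke_reps n \<and> R M M'" by simp
  from bchoice[OF this] obtain \<Psi> where "\<forall>M\<in>hecke_reps n. \<Psi> M \<in> hecke_reps n \<and> R M (\<Psi> M)" ..
  then have \<Psi>: "\<Psi> M \<in> hecke_reps n \<and> R M (\<Psi> M)" if "M \<in> hecke_reps n" for M using that by simp
  have inj: "inj_on \<Psi> (hecke_reps n)"
  proof (rule inj_onI)
    fix M1 M2 assume M: "M1 \<in> hecke_reps n" "M2 \<in> hecke_reps n" "\<Psi> M1 = \<Psi> M2"
    obtain a1 b1 d1 a2 b2 d2 a' b' d' where eq: "M1 = (a1, b1, d1)" "M2 = (a2, b2, d2)" "\<Psi> M1 = (a', b', d')"
      by (cases M1; cases M2; cases "\<Psi> M1")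
    obtain p1 q1 r1 s1 where e1: "p1 * s1 - q1 * r1 = 1" "a1 * p + b1 * r = p1 * a'" "d1 * r = r1 * a'"
      "a1 * q + b1 * s = p1 * b' + q1 * d'" "d1 * s = r1 * b' + s1 * d'"
      using \<Psi>[OF M(1)] eq by (auto simp: R_def)
    obtain p2 q2 r2 s2 where e2: "p2 * s2 - q2 * r2 = 1" "a2 * p + b2 * r = p2 * a'" "d2 * r = r2 * a'"
      "a2 * q + b2 * s = p2 * b' + q2 * d'" "d2 * s = r2 * b' + s2 * d'"
      using \<Psi>[OF M(2)] eq M(3) by (auto simp: R_def)
    show "M1 = M2" unfolding eq
      by (rule hecke_rep_unique[OF M(1)[unfolded eq] M(2)[unfolded eq] g(1) e1 e2])
  qed
  have surj: "\<Psi> ` hecke_reps n = hecke_reps n"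
    by (rule endo_inj_surj[OF finite_hecke_reps _ inj]) (use \<Psi> in blast)
  let ?w = "\<lambda>(a, b, d) z. chi a * of_int a ^ k * Q (moebius a b 0 d z)"
  have w: "?w M (moebius p q r s z) = (of_int r * z + of_int s) ^ k * ?w (\<Psi> M) z" if M: "M \<in> hecke_reps n" for M
  proof -
    obtain a b d a' b' d' where eq: "M = (a, b, d)" "\<Psi> M = (a', b', d')" by (cases M; cases "\<Psi> M")
    obtain p' q' r' s' where e: "p' * s' - q' * r' = 1" "level dvd r'" "a * p + b * r = p' * a'" "d * r = r' * a'"
      "a * q + b * s = p' * b' + q' * d'" "d * s = r' * b' + s' * d'"
      using \<Psi>[OF M] eq by (auto simp: R_def)
    have m: "a > 0" "d > 0" "a * d = n" "coprime a level" and m': "a' > 0" "d' > 0" "a' * d' = n" "coprime a' level"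
      using M \<Psi>[OF M] eq by (auto simp: hecke_reps_def)
    have n: "n > 0" using m by auto
    define u where "u = moebius a' b' 0 d' z"
    have u: "Im u > 0" unfolding u_def using z m' by (intro Im_moebius_pos) auto
    have "moebius a b 0 d (moebius p q r s z) = moebius (a * p + b * r) (a * q + b * s) (d * r) (d * s) z"
      using moebius_compose[OF z, of p s q r a b 0 d] g(1) by simp
    also have "\<dots> = moebius p' q' r' s' u"
      unfolding e(3-6) u_def using moebius_compose[OF z, of a' d' b' 0 p' q' r' s'] m' n by simp
    finally have mm: "moebius a b 0 d (moebius p q r s z) = moebius p' q' r' s' u" .
    have fac: "(of_int r' * u + of_int s') * of_int d' = of_int d * (of_int r * z + of_int s :: complex)"
    proof -
      have "(of_int r' * u + of_int s') * of_int d' = of_int (r' * a') * z + of_int (r' * b' + s' * d')"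
        using m' by (simp add: u_def moebius_def field_simps)
      also have "\<dots> = of_int (d * r) * z + of_int (d * s)" using e by simp
      finally show ?thesis by (simp add: algebra_simps)
    qed
    have ch: "chi a * chi s' = chi a'"
    proof -
      have cs: "coprime s' level"
      proof (rule coprimeI)
        fix c assume c: "c dvd s'" "c dvd level"
        then have "c dvd r'" using e(2) by (metis dvd_trans)
        with c have "c dvd p' * s' - q' * r'" by simp
        then show "is_unit c" using e(1) by simp
      qed
      have "a' - a * s' = a' * (p' * s' - q' * r') - a * s'" using e(1) by simp
      also have "\<dots> = s' * (a * p + b * r) - a' * q' * r' - a * s'" by (simp add: e(3) algebra_simps)
      also have "\<dots> = s' * a * (p - 1) + s' * b * r - a' * q' * r'" by (simp add: algebra_simps)
      finally have "level dvd a' - a * s'" using g(2,3) e(2) by simp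
      moreover have "coprime (a * s') level" using m(4) cs by simp
      ultimately have "chi a' = chi (a * s')" by (intro chi_periodic)
      then show ?thesis using chi_mult[OF m(4) cs] by simp
    qed
    have "?w M (moebius p q r s z) = chi a * of_int a ^ k * (chi s' * (of_int r' * u + of_int s') ^ k * Q u)"
      using Q_law[OF e(1,2) u] mm by (simp add: eq)
    also have "\<dots> = chi a' * (of_int a * (of_int r' * u + of_int s')) ^ k * Q u"
      by (simp add: ch[symmetric] power_mult_distrib mult_ac)
    also have "of_int a * (of_int r' * u + of_int s') = of_int a' * (of_int r * z + of_int s :: complex)"
    proof -
      have "of_int a * ((of_int r' * u + of_int s') * of_int d') = of_int (a * d) * (of_int r * z + of_int s :: complex)"
        unfolding fac by simp
      also have "\<dots> = of_int a' * (of_int r * z + of_int s :: complex) * of_int d'"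
        unfolding m(3) m'(3)[symmetric] by simp
      finally show ?thesis using m'(2) by simp
    qed
    finally show ?thesis by (simp add: eq(2)[unfolded eq(1)] eq(1) u_def power_mult_distrib mult_ac)
  qed
  have "hecke n (moebius p q r s z) = (\<Sum>M\<in>hecke_reps n. ?w M (moebius p q r s z))"
    unfolding hecke_def by (rule sum.cong) auto
  also have "\<dots> = (\<Sum>M\<in>hecke_reps n. (of_int r * z + of_int s) ^ k * ?w (\<Psi> M) z)"
    by (rule sum.cong[OF refl w])
  also have "\<dots> = (of_int r * z + of_int s) ^ k * (\<Sum>M\<in>hecke_reps n. ?w (\<Psi> M) z)"
    by (rule sum_distrib_left[symmetric])
  also have "(\<Sum>M\<in>hecke_reps n. ?w (\<Psi> M) z) = (\<Sum>M\<in>\<Psi> ` hecke_reps n. ?w M z)"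
    by (rule sum.reindex[OF inj, unfolded o_def, symmetric])
  also have "\<dots> = hecke n z" unfolding surj hecke_def by (rule sum.cong) auto
  finally show ?thesis .
qed

end

section \<open>Lambert series\<close>

lemma summable_power_geometric:
  fixes \<sigma> :: real
  assumes "0 \<le> \<sigma>" "\<sigma> < 1"
  shows "summable (\<lambda>n. real n ^ s * \<sigma> ^ n)"
proof (cases "\<sigma> = 0")
  case True
  then show ?thesis by (intro summable_finite[of "{0}"]) auto
next
  case False
  define \<tau> where "\<tau> = sqrt \<sigma>"
  have \<tau>: "0 < \<tau>" "\<tau> < 1" "\<sigma> = \<tau> * \<tau>" using assms False by (auto simp: \<tau>_def)
  have "(\<lambda>n. real n ^ s * \<tau> ^ n) \<longlonglongrightarrow> 0"
    using \<tau> by real_asymp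
  then have "Bseq (\<lambda>n. real n ^ s * \<tau> ^ n)" by (intro convergent_imp_Bseq convergentI)
  then obtain K where K: "K > 0" "\<And>n. norm (real n ^ s * \<tau> ^ n) \<le> K" by (auto simp: Bseq_def)
  show ?thesis
  proof (rule summable_comparison_test'[of "\<lambda>n. K * \<tau> ^ n" 0])
    show "norm (real n ^ s * \<sigma> ^ n) \<le> K * \<tau> ^ n" for n
    proof -
      have "norm (real n ^ s * \<sigma> ^ n) = norm (real n ^ s * \<tau> ^ n) * \<tau> ^ n"
        using \<tau> by (simp add: power_mult_distrib abs_mult)
      also have "\<dots> \<le> K * \<tau> ^ n" using K(2)[of n] \<tau> by (intro mult_right_mono) auto
      finally show ?thesis .
    qed
  qed (use \<tau> in \<open>auto intro!: summable_mult summable_geometric\<close>)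
qed

lemma summable_on_power_geometric:
  fixes \<sigma> :: real
  assumes "0 \<le> \<sigma>" "\<sigma> < 1"
  shows "(\<lambda>n. real n ^ s * \<sigma> ^ n) summable_on UNIV"
  using summable_power_geometric[OF assms, of s] assms
  by (intro norm_summable_imp_summable_on) (simp add: abs_mult)

lemma summable_on_product_nonneg:
  fixes f :: "'a \<Rightarrow> real" and g :: "'b \<Rightarrow> real"
  assumes "f summable_on A" "g summable_on B" "\<And>x. f x \<ge> 0" "\<And>y. g y \<ge> 0"
  shows "(\<lambda>(x, y). f x * g y) summable_on A \<times> B"
proof (rule summable_on_SigmaI)
  show "((\<lambda>y. case (x, y) of (x, y) \<Rightarrow> f x * g y) has_sum f x * infsum g B) B" for x
    using has_sum_cmult_right[OF has_sum_infsum[OF assms(2)], of "f x"] by simp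
  show "(\<lambda>x. f x * infsum g B) summable_on A"
    by (intro summable_on_cmult_left assms)
qed (use assms in auto)

lemma unit_series_poly_bound:
  assumes "\<And>n. norm (c n) \<le> B * real n ^ s" "B \<ge> 0"
  shows "unit_series c"
  unfolding unit_series_def
proof (intro allI impI)
  fix x :: complex assume x: "norm x < 1"
  show "summable (\<lambda>n. c n * x ^ n)"
  proof (rule summable_comparison_test'[of "\<lambda>n. B * (real n ^ s * norm x ^ n)" 0])
    show "norm (c n * x ^ n) \<le> B * (real n ^ s * norm x ^ n)" for n
      using mult_right_mono[OF assms(1)[of n], of "norm x ^ n"] by (simp add: norm_mult norm_power mult_ac)
  qed (use x summable_power_geometric[of "norm x" s] in \<open>auto intro!: summable_mult\<close>)
qed

text \<open>As \<open>m + n \<le> 2 * m * n\<close>, the decay can be shared between the two indices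
  of a double series.\<close>

lemma power_mult_le_split:
  fixes \<rho> :: real
  assumes "0 \<le> \<rho>" "\<rho> \<le> 1" "m > 0" "n > 0"
  shows "\<rho> ^ (m * n) \<le> sqrt \<rho> ^ m * sqrt \<rho> ^ n"
proof -
  have "\<rho> ^ (m * n) = sqrt \<rho> ^ (2 * (m * n))"
    using assms by (simp add: power_mult)
  also have "\<dots> \<le> sqrt \<rho> ^ (m + n)"
  proof (rule power_decreasing)
    have "m \<le> m * n" "n \<le> m * n" using assms by auto
    then show "m + n \<le> 2 * (m * n)" by linarith
  qed (use assms in auto)
  finally show ?thesis by (simp add: power_add)
qed

lemma bij_betw_divisor_pairs:
  "bij_betw (\<lambda>(y::nat, a::nat). (a, y div a)) (Sigma {1..} (\<lambda>y. {a. a dvd y})) ({1..} \<times> {1::nat..})"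
  by (rule bij_betwI[of _ _ _ "\<lambda>(a, j). (a * j, a)"])
    (auto simp: Suc_le_eq dvd_pos_nat elim!: dvdE)

lemma has_sum_divisor_pairs:
  fixes f :: "nat \<times> nat \<Rightarrow> complex"
  assumes "(f has_sum S) UNIV" "\<And>a. f (a, 0) = 0" "\<And>j. f (0, j) = 0"
  shows "((\<lambda>y. \<Sum>a | a dvd y. f (a, y div a)) has_sum S) {1..}"
proof -
  have "(f has_sum S) ({1..} \<times> {1..})"
  proof (rule has_sum_cong_neutral[THEN iffD1, OF _ _ _ assms(1)])
    fix x :: "nat \<times> nat" assume "x \<in> UNIV - {1..} \<times> {1::nat..}"
    then show "f x = 0" using assms(2,3) by (cases x) (auto simp: not_le)
  qed auto
  then have "((\<lambda>x. f ((\<lambda>(y, a). (a, y div a)) x)) has_sum S) (Sigma {1..} (\<lambda>y. {a. a dvd y}))"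
    using has_sum_reindex_bij_betw[OF bij_betw_divisor_pairs, of f S] by simp
  then show ?thesis
  proof (rule has_sum_Sigma')
    fix y :: nat assume "y \<in> {1..}"
    then have "finite {a. a dvd y}" by (intro finite_divisors_nat) auto
    from has_sum_finite[OF this]
    show "((\<lambda>a. f ((\<lambda>(y, a). (a, y div a)) (y, a))) has_sum (\<Sum>a | a dvd y. f (a, y div a))) {a. a dvd y}"
      by simp
  qed
qed

lemma pseries_even_part:
  assumes c: "unit_series c" and x: "norm x < 1"
  shows "pseries c x + pseries c (- x) = 2 * pseries (\<lambda>n. c (2 * n)) (x\<^sup>2)"
proof -
  have "(\<lambda>n. c n * x ^ n + c n * (- x) ^ n) sums (pseries c x + pseries c (- x))"
    using x by (intro sums_add pseries_sums c) auto
  then have "(\<lambda>n. c (2 * n) * x ^ (2 * n) + c (2 * n) * (- x) ^ (2 * n)) sums (pseries c x + pseries c (- x))"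
  proof (subst sums_mono_reindex[of "\<lambda>n. 2 * n" "\<lambda>n. c n * x ^ n + c n * (- x) ^ n"])
    fix n assume "n \<notin> range ((*) (2::nat))"
    then have "odd n" by (auto elim!: evenE)
    then show "c n * x ^ n + c n * (- x) ^ n = 0" by simp
  qed (auto simp: strict_mono_def)
  then have "(\<lambda>n. (2 * (c (2 * n) * (x\<^sup>2) ^ n)) / 2) sums ((pseries c x + pseries c (- x)) / 2)"
    by (intro sums_divide) (simp add: power_mult)
  then have "pseries (\<lambda>n. c (2 * n)) (x\<^sup>2) = (pseries c x + pseries c (- x)) / 2"
    by (simp add: pseries_def sums_iff)
  then show ?thesis by (simp add: mult.commute)
qed

context plus_eigenform
begin

definition chi_nat :: "nat \<Rightarrow> complex" where
  "chi_nat m = (if coprime (int m) level then chi (int m) else 0)"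

lemma norm_chi_nat: "norm (chi_nat m) \<le> 1"
  using norm_chi by (simp add: chi_nat_def)

lemma chi_nat_even: "even m \<Longrightarrow> chi_nat m = 0"
proof -
  assume "even m"
  then have "\<not> coprime (int m) level"
    by (auto simp: coprime_def level_def intro!: exI[of _ 2])
  then show ?thesis by (simp add: chi_nat_def)
qed

lemma chi_nat_0 [simp]: "chi_nat 0 = 0" by (rule chi_nat_even) simp

lemma chi_nat_1: "chi_nat (Suc 0) = 1"
  by (simp add: chi_nat_def chi_def)

text \<open>On the side of Dirichlet series this multiplies that of \<open>c\<close> by the
  L-function of the character shifted by \<open>k - 1\<close>, as in Shimura's lift.\<close>

definition lambert :: "(nat \<Rightarrow> complex) \<Rightarrow> complex \<Rightarrow> nat \<times> nat \<Rightarrow> complex" where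
  "lambert c x = (\<lambda>(m, n). chi_nat m * of_nat m ^ (k - 1) * c n * x ^ (m * n))"

lemma lambert_abs_summable:
  assumes c: "\<And>n. norm (c n) \<le> B * real n ^ s" and B: "B \<ge> 0" and s: "s > 0" and x: "norm x < 1"
  shows "(\<lambda>p. norm (lambert c x p)) summable_on UNIV"
proof -
  let ?r = "sqrt (norm x)"
  have r: "0 \<le> ?r" "?r < 1" using x by auto
  have "(\<lambda>(m, n). (real m ^ (k - 1) * ?r ^ m) * (B * (real n ^ s * ?r ^ n))) summable_on UNIV \<times> UNIV"
    by (intro summable_on_product_nonneg summable_on_cmult_right summable_on_power_geometric r) (use r B in auto)
  then have "(\<lambda>(m, n). (real m ^ (k - 1) * ?r ^ m) * (B * (real n ^ s * ?r ^ n))) summable_on UNIV" by simp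
  then show ?thesis
  proof (rule Infinite_Sum.abs_summable_on_comparison_test'[where f = "lambert c x"])
    fix p :: "nat \<times> nat"
    obtain m n where p: "p = (m, n)" by (cases p)
    have c0: "c 0 = 0" using c[of 0] s by (simp add: power_0_left)
    show "norm (lambert c x p) \<le> (\<lambda>(m, n). (real m ^ (k - 1) * ?r ^ m) * (B * (real n ^ s * ?r ^ n))) p"
    proof (cases "m = 0 \<or> n = 0")
      case True
      then have "lambert c x p = 0" using c0 by (auto simp: lambert_def p)
      then show ?thesis using r B by (simp add: p)
    next
      case False
      have "norm (lambert c x p) = norm (chi_nat m) * (real m ^ (k - 1) * norm (c n) * norm x ^ (m * n))"
        by (simp add: lambert_def p norm_mult norm_power)
      also have "\<dots> \<le> 1 * (real m ^ (k - 1) * (B * real n ^ s) * (?r ^ m * ?r ^ n))"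
        using x False B by (intro mult_mono norm_chi_nat c power_mult_le_split mult_nonneg_nonneg) auto
      finally show ?thesis by (simp add: p mult_ac)
    qed
  qed
qed

definition lambert_sum :: "(nat \<Rightarrow> complex) \<Rightarrow> complex \<Rightarrow> complex" where
  "lambert_sum c x = infsum (lambert c x) UNIV"

lemma lambert_has_sum:
  assumes "\<And>n. norm (c n) \<le> B * real n ^ s" "B \<ge> 0" "s > 0" "norm x < 1"
  shows "(lambert c x has_sum lambert_sum c x) UNIV"
  unfolding lambert_sum_def
  by (rule has_sum_infsum[OF abs_summable_summable[OF lambert_abs_summable[OF assms]]])

lemma lambert_has_sum_outer:
  assumes c: "\<And>n. norm (c n) \<le> B * real n ^ s" "B \<ge> 0" "s > 0" and x: "norm x < 1"
  shows "((\<lambda>m. chi_nat m * of_nat m ^ (k - 1) * pseries c (x ^ m)) has_sum lambert_sum c x) UNIV"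
proof -
  have "(lambert c x has_sum lambert_sum c x) (UNIV \<times> UNIV)"
    using lambert_has_sum[OF c x] by simp
  then show ?thesis
  proof (rule has_sum_SigmaD)
    fix m :: nat
    show "((\<lambda>n. lambert c x (m, n)) has_sum chi_nat m * of_nat m ^ (k - 1) * pseries c (x ^ m)) UNIV"
    proof (cases "m = 0")
      case False
      then have m: "m > 0" by simp
      have xm: "norm (x ^ m) < 1" by (rule norm_power_less_1[OF x m])
      have u: "unit_series c" by (rule unit_series_poly_bound[OF c(1,2)])
      have "((\<lambda>n. c n * (x ^ m) ^ n) has_sum pseries c (x ^ m)) UNIV"
        by (rule norm_summable_imp_has_sum[OF unit_series_abs_summable[OF u xm] pseries_sums[OF u xm]])
      then have "((\<lambda>n. chi_nat m * of_nat m ^ (k - 1) * (c n * (x ^ m) ^ n)) has_sum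
          chi_nat m * of_nat m ^ (k - 1) * pseries c (x ^ m)) UNIV"
        by (rule has_sum_cmult_right)
      then show ?thesis by (simp only: lambert_def prod.case power_mult mult.assoc)
    next
      case True
      then have "chi_nat m = 0" by simp
      then have "lambert c x (m, n) = 0" "chi_nat m * of_nat m ^ (k - 1) * pseries c (x ^ m) = 0" for n
        by (simp_all only: lambert_def prod.case mult_zero_left)
      then show ?thesis by (simp only: has_sum_0_simp)
    qed
  qed
qed

definition lambert_coeff :: "(nat \<Rightarrow> complex) \<Rightarrow> nat \<Rightarrow> complex" where
  "lambert_coeff c n = (if n = 0 then 0 else \<Sum>m | m dvd n. chi_nat m * of_nat m ^ (k - 1) * c (n div m))"

lemma lambert_pseries:
  assumes c: "\<And>n. norm (c n) \<le> B * real n ^ s" "B \<ge> 0" "s > 0"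
  shows "unit_series (lambert_coeff c)" "norm x < 1 \<Longrightarrow> pseries (lambert_coeff c) x = lambert_sum c x"
proof -
  have c0: "c 0 = 0" using c(1)[of 0] c(3) by (simp add: power_0_left)
  have *: "(\<lambda>n. lambert_coeff c n * x ^ n) sums lambert_sum c x" if x: "norm x < 1" for x
  proof -
    have "((\<lambda>y. \<Sum>m | m dvd y. lambert c x (m, y div m)) has_sum lambert_sum c x) {1..}"
      by (rule has_sum_divisor_pairs[OF lambert_has_sum[OF c x]]) (auto simp: lambert_def c0)
    then have "((\<lambda>n. lambert_coeff c n * x ^ n) has_sum lambert_sum c x) UNIV"
    proof (rule has_sum_cong_neutral[THEN iffD1, rotated 3])
      show "(\<Sum>m | m dvd y. lambert c x (m, y div m)) = lambert_coeff c y * x ^ y" if "y \<in> {1..} \<inter> UNIV" for y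
        using that by (simp add: lambert_coeff_def lambert_def sum_distrib_right)
    qed (auto simp: lambert_coeff_def)
    then show ?thesis by (rule has_sum_imp_sums)
  qed
  then show "unit_series (lambert_coeff c)" by (auto simp: unit_series_def sums_iff)
  show "norm x < 1 \<Longrightarrow> pseries (lambert_coeff c) x = lambert_sum c x"
    using * by (simp add: pseries_def sums_iff)
qed

text \<open>Even \<open>m\<close> are killed by \<open>chi_nat\<close>, and for odd \<open>m\<close>
  a change of sign of \<open>x\<close> is one of \<open>x ^ m\<close>. So the extraction of even
  exponents acts on \<open>c\<close> alone.\<close>

lemma lambert_sum_even_part:
  assumes c: "\<And>n. norm (c n) \<le> B * real n ^ s" "B \<ge> 0" "s > 0" and x: "norm x < 1"
  shows "lambert_sum c x + lambert_sum c (- x) = 2 * lambert_sum (\<lambda>n. c (2 * n)) (x\<^sup>2)"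
proof -
  have c2: "norm (c (2 * n)) \<le> (B * 2 ^ s) * real n ^ s" for n
    using c(1)[of "2 * n"] by (simp add: power_mult_distrib)
  have B2: "B * 2 ^ s \<ge> 0" using c(2) by simp
  have x2: "norm (x\<^sup>2) < 1" using x by (rule norm_power_less_1) simp
  have out: "((\<lambda>m. chi_nat m * of_nat m ^ (k - 1) * pseries (\<lambda>n. c (2 * n)) ((x\<^sup>2) ^ m))
      has_sum lambert_sum (\<lambda>n. c (2 * n)) (x\<^sup>2)) UNIV"
    by (rule lambert_has_sum_outer[where c = "\<lambda>n. c (2 * n)", OF c2 B2 c(3) x2])
  have "((\<lambda>m. chi_nat m * of_nat m ^ (k - 1) * pseries c (x ^ m) + chi_nat m * of_nat m ^ (k - 1) * pseries c ((- x) ^ m))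
     has_sum lambert_sum c x + lambert_sum c (- x)) UNIV"
    using x by (intro has_sum_add lambert_has_sum_outer[OF c]) auto
  moreover have "chi_nat m * of_nat m ^ (k - 1) * pseries c (x ^ m) + chi_nat m * of_nat m ^ (k - 1) * pseries c ((- x) ^ m)
     = 2 * (chi_nat m * of_nat m ^ (k - 1) * pseries (\<lambda>n. c (2 * n)) ((x\<^sup>2) ^ m))" for m
  proof (cases "even m")
    case True
    then show ?thesis by (simp add: chi_nat_even)
  next
    case False
    then have "m > 0" by (cases m) auto
    then have "norm (x ^ m) < 1" using x by (intro norm_power_less_1)
    then have "pseries c (x ^ m) + pseries c (- (x ^ m)) = 2 * pseries (\<lambda>n. c (2 * n)) ((x ^ m)\<^sup>2)"
      by (rule pseries_even_part[OF unit_series_poly_bound[OF c(1,2)]])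
    moreover have "(- x) ^ m = - (x ^ m)" using False by (rule power_minus_odd)
    moreover have "(x ^ m)\<^sup>2 = (x\<^sup>2) ^ m" by (simp only: mult.commute power_mult[symmetric])
    ultimately have "pseries c (x ^ m) + pseries c ((- x) ^ m) = 2 * pseries (\<lambda>n. c (2 * n)) ((x\<^sup>2) ^ m)"
      by (simp only:)
    then show ?thesis by (simp only: distrib_left[symmetric] mult.left_commute[of 2])
  qed
  ultimately have "((\<lambda>m. 2 * (chi_nat m * of_nat m ^ (k - 1) * pseries (\<lambda>n. c (2 * n)) ((x\<^sup>2) ^ m)))
     has_sum lambert_sum c x + lambert_sum c (- x)) UNIV" by (simp only:)
  moreover have "((\<lambda>m. 2 * (chi_nat m * of_nat m ^ (k - 1) * pseries (\<lambda>n. c (2 * n)) ((x\<^sup>2) ^ m)))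
     has_sum 2 * lambert_sum (\<lambda>n. c (2 * n)) (x\<^sup>2)) UNIV"
    by (rule has_sum_cmult_right[OF out])
  ultimately show ?thesis by (rule has_sum_unique)
qed

end

section \<open>The two-variable kernel\<close>

lemma qexp_sum_roots:
  assumes "d > 0"
  shows "(\<Sum>b<d. qexp (of_nat n / of_nat d) ^ b) = (if d dvd n then of_nat d else 0)"
proof -
  define r where "r = qexp (of_nat n / of_nat d)"
  have rd: "r ^ d = 1"
    using qexp_of_nat_mult[of d "of_nat n / of_nat d"] assms by (simp add: r_def)
  have dvd: "d dvd n" if "r = 1"
  proof -
    have e: "exp (2 * of_real pi * \<i> * (of_nat n / of_nat d)) = 1" using that by (simp add: r_def qexp_def)
    have z: "2 * of_real pi * \<i> * (of_nat n / of_nat d :: complex) = \<i> * of_real (2 * pi * (real n / real d))" by simp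
    have "Im (2 * of_real pi * \<i> * (of_nat n / of_nat d :: complex)) = 2 * pi * (real n / real d)"
      unfolding z by (simp only: Im_i_times Re_complex_of_real)
    with e obtain m :: int where "2 * pi * (real n / real d) = of_int (2 * m) * pi" by (auto simp only: exp_eq_1)
    then have "(2 * pi) * (real n / real d) = (2 * pi) * of_int m" by (simp only: of_int_mult of_int_numeral mult_ac)
    then have "real n / real d = of_int m" by (simp only: mult_cancel_left) simp
    then have "real n = of_int m * real d" using assms by (simp add: field_simps)
    then have "int n = m * int d" by (metis of_int_eq_iff of_int_mult of_int_of_nat_eq)
    then show "d dvd n" by (metis dvd_triv_right int_dvd_int_iff)
  qed
  show ?thesis
  proof (cases "d dvd n")
    case True
    then obtain m where "n = d * m" by (rule dvdE)
    then have "r = 1" using assms by (simp add: r_def)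
    with True show ?thesis by (simp add: r_def)
  next
    case False
    then have "(\<Sum>b<d. r ^ b) = (r ^ d - 1) / (r - 1)" by (intro geometric_sum) (use dvd in auto)
    with False rd show ?thesis by (simp add: r_def)
  qed
qed

lemma qseries_average:
  assumes c: "unit_series c" and d: "d > 0" and w: "Im w > 0"
  shows "(\<Sum>b<d. qseries c ((w + of_nat b) / of_nat d)) = of_nat d * pseries (\<lambda>n. c (d * n)) (qexp w)"
proof -
  define x where "x = qexp (w / of_nat d)"
  have wd: "Im (w / of_nat d) > 0" using w d by simp
  have x: "norm x < 1" unfolding x_def norm_qexp_less_1_iff by (rule wd)
  have xd: "x ^ d = qexp w" using qexp_of_nat_mult[of d "w / of_nat d"] d by (simp add: x_def)
  have "(\<lambda>n. c n * qexp ((w + of_nat b) / of_nat d) ^ n) sums qseries c ((w + of_nat b) / of_nat d)" for b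
    using wd by (intro qseries_sums c) (simp add: add_divide_distrib)
  then have "(\<lambda>n. \<Sum>b<d. c n * qexp ((w + of_nat b) / of_nat d) ^ n) sums (\<Sum>b<d. qseries c ((w + of_nat b) / of_nat d))"
    by (rule sums_sum)
  moreover have "(\<Sum>b<d. c n * qexp ((w + of_nat b) / of_nat d) ^ n) = (if d dvd n then of_nat d * (c n * x ^ n) else 0)" for n
  proof -
    have "qexp ((w + of_nat b) / of_nat d) ^ n = x ^ n * qexp (of_nat n / of_nat d) ^ b" for b
    proof -
      have "qexp ((w + of_nat b) / of_nat d) ^ n = x ^ n * qexp (of_nat n * (of_nat b / of_nat d))"
        by (simp only: add_divide_distrib qexp_add power_mult_distrib x_def qexp_of_nat_mult)
      also have "of_nat n * (of_nat b / of_nat d) = of_nat b * (of_nat n / of_nat d :: complex)" by simp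
      finally show ?thesis by (simp only: qexp_of_nat_mult)
    qed
    then have "(\<Sum>b<d. c n * qexp ((w + of_nat b) / of_nat d) ^ n) = c n * x ^ n * (\<Sum>b<d. qexp (of_nat n / of_nat d) ^ b)"
      by (simp only: sum_distrib_left mult.assoc)
    then show ?thesis using qexp_sum_roots[OF d, of n] by simp
  qed
  ultimately have 1: "(\<lambda>n. if d dvd n then of_nat d * (c n * x ^ n) else 0) sums (\<Sum>b<d. qseries c ((w + of_nat b) / of_nat d))"
    by (simp only:)
  have "(\<lambda>n. if d dvd d * n then of_nat d * (c (d * n) * x ^ (d * n)) else 0) sums (\<Sum>b<d. qseries c ((w + of_nat b) / of_nat d))"
    using 1 d by (subst sums_mono_reindex[of "\<lambda>n. d * n" "\<lambda>n. if d dvd n then of_nat d * (c n * x ^ n) else 0"])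
      (auto simp: strict_mono_def elim!: dvdE)
  then have "(\<lambda>n. of_nat d * (c (d * n) * qexp w ^ n)) sums (\<Sum>b<d. qseries c ((w + of_nat b) / of_nat d))"
    by (simp add: power_mult xd)
  then have "(\<lambda>n. c (d * n) * qexp w ^ n) sums ((\<Sum>b<d. qseries c ((w + of_nat b) / of_nat d)) / of_nat d)"
    using sums_divide[of "\<lambda>n. of_nat d * (c (d * n) * qexp w ^ n)" _ "of_nat d"] d by simp
  then have "pseries (\<lambda>n. c (d * n)) (qexp w) = (\<Sum>b<d. qseries c ((w + of_nat b) / of_nat d)) / of_nat d"
    by (simp add: pseries_def sums_iff)
  then show ?thesis using d by simp
qed

context plus_eigenform
begin

lemma qc_0 [simp]: "qc 0 = 0" by (rule qc_less[OF t_pos])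

text \<open>
  The sum of \<open>triple (qexp z1) (qexp z2)\<close> is modular in \<open>z1\<close>, since its coefficient at a power of
  \<open>qexp z2\<close> is a multiple of a Hecke transform of \<open>Q\<close>; it is modular in \<open>z2\<close> as well, since it is
  symmetric under exchange of \<open>j\<close> and \<open>n\<close>.
\<close>

definition triple :: "complex \<Rightarrow> complex \<Rightarrow> (nat \<times> nat) \<times> nat \<Rightarrow> complex" where
  "triple x1 x2 = (\<lambda>((m, j), n). chi_nat m * of_nat m ^ (k - 1) * qc (t * j * n) * x1 ^ (m * n) * x2 ^ (m * j))"

definition triple_sum :: "complex \<Rightarrow> complex \<Rightarrow> complex" where
  "triple_sum x1 x2 = infsum (triple x1 x2) UNIV"

text \<open>\<open>qc\<close> grows polynomially, and for positive indices
  \<open>m + j + n \<le> 2 * (m * n + m * j)\<close> spreads the geometric decay over all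
  three.\<close>

lemma triple_has_sum:
  assumes x: "norm x1 < 1" "norm x2 < 1"
  shows "(triple x1 x2 has_sum triple_sum x1 x2) UNIV"
proof -
  obtain B where B: "B > 0" "\<And>n. norm (qc n) \<le> B * real n ^ k" by (rule qc_bound) (rule that)
  define \<rho> where "\<rho> = max (norm x1) (norm x2)"
  define r where "r = sqrt \<rho>"
  have \<rho>: "0 \<le> \<rho>" "\<rho> < 1" "norm x1 \<le> \<rho>" "norm x2 \<le> \<rho>" using x by (auto simp: \<rho>_def le_max_iff_disj)
  have r: "0 \<le> r" "r < 1" "r ^ 2 = \<rho>" using \<rho> by (auto simp: r_def)
  let ?f = "\<lambda>n. real n ^ (k - 1) * r ^ n" and ?g = "\<lambda>n. real n ^ k * r ^ n"
  let ?b = "\<lambda>((m, j), n). (?f m * ?g j) * (B * real t ^ k * ?g n)"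
  have s1: "(\<lambda>(m, j). ?f m * ?g j) summable_on UNIV \<times> UNIV"
    by (rule summable_on_product_nonneg[OF summable_on_power_geometric summable_on_power_geometric]) (use r in auto)
  have s2: "(\<lambda>n. B * real t ^ k * ?g n) summable_on UNIV"
    by (rule summable_on_cmult_right[OF summable_on_power_geometric[OF r(1,2)]])
  have "(\<lambda>(p, n). (\<lambda>(m, j). ?f m * ?g j) p * (B * real t ^ k * ?g n)) summable_on (UNIV \<times> UNIV) \<times> UNIV"
    by (rule summable_on_product_nonneg[OF s1 s2]) (use r B in auto)
  also have "(\<lambda>(p, n). (\<lambda>(m, j). ?f m * ?g j) p * (B * real t ^ k * ?g n)) = ?b" by auto
  finally have "?b summable_on UNIV" by simp
  then have "(\<lambda>p. norm (triple x1 x2 p)) summable_on UNIV"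
  proof (rule Infinite_Sum.abs_summable_on_comparison_test'[where f = "triple x1 x2"])
    fix p :: "(nat \<times> nat) \<times> nat"
    obtain m j n where p: "p = ((m, j), n)" by (cases p) auto
    show "norm (triple x1 x2 p) \<le> ?b p"
    proof (cases "m = 0 \<or> j = 0 \<or> n = 0")
      case True
      then have "triple x1 x2 p = 0" by (auto simp: triple_def p)
      then show ?thesis using r B by (simp add: p)
    next
      case False
      have pw: "norm x1 ^ (m * n) * norm x2 ^ (m * j) \<le> r ^ m * r ^ j * r ^ n"
      proof -
        have "norm x1 ^ (m * n) * norm x2 ^ (m * j) \<le> \<rho> ^ (m * n) * \<rho> ^ (m * j)"
          using \<rho> by (intro mult_mono power_mono) auto
        also have "\<dots> = r ^ (2 * (m * n + m * j))"
          by (simp only: power_mult[of r 2] r(3) power_add)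
        also have "\<dots> \<le> r ^ (m + j + n)"
        proof (rule power_decreasing)
          have "m \<le> m * n" "n \<le> m * n" "j \<le> m * j" using False by auto
          then show "m + j + n \<le> 2 * (m * n + m * j)" unfolding distrib_left by linarith
        qed (use r in auto)
        finally show ?thesis by (simp add: power_add)
      qed
      have "norm (triple x1 x2 p) = norm (chi_nat m) * (real m ^ (k - 1)) * norm (qc (t * j * n)) * (norm x1 ^ (m * n) * norm x2 ^ (m * j))"
        by (simp add: triple_def p norm_mult norm_power)
      also have "\<dots> \<le> 1 * real m ^ (k - 1) * (B * real (t * j * n) ^ k) * (r ^ m * r ^ j * r ^ n)"
        by (intro mult_mono norm_chi_nat B(2) pw mult_nonneg_nonneg) (use B r in auto)
      also have "\<dots> = ?b p" by (simp add: p power_mult_distrib)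
      finally show ?thesis .
    qed
  qed
  then show ?thesis unfolding triple_sum_def by (rule has_sum_infsum[OF abs_summable_summable])
qed

lemma triple_sum_commute:
  assumes x: "norm x1 < 1" "norm x2 < 1"
  shows "triple_sum x1 x2 = triple_sum x2 x1"
proof -
  let ?h = "\<lambda>((m, j), n). ((m, n), j) :: (nat \<times> nat) \<times> nat"
  have "bij_betw ?h UNIV UNIV" by (rule bij_betwI[of _ _ _ ?h]) auto
  from has_sum_reindex_bij_betw[OF this, of "triple x2 x1" "triple_sum x2 x1"]
  have "((\<lambda>p. triple x2 x1 (?h p)) has_sum triple_sum x2 x1) UNIV" using triple_has_sum[OF x(2,1)] by simp
  also have "(\<lambda>p. triple x2 x1 (?h p)) = triple x1 x2"
    by (auto simp: fun_eq_iff triple_def mult_ac)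
  finally show ?thesis using triple_has_sum[OF x] has_sum_unique by blast
qed

lemma unit_series_qc_dilate: "unit_series (\<lambda>n. qc (t * j * n))"
proof -
  obtain B where B: "B > 0" "\<And>n. norm (qc n) \<le> B * real n ^ k" by (rule qc_bound) (rule that)
  show ?thesis
  proof (rule unit_series_poly_bound)
    show "norm (qc (t * j * n)) \<le> (B * real (t * j) ^ k) * real n ^ k" for n
      using B(2)[of "t * j * n"] by (simp add: power_mult_distrib mult_ac)
  qed (use B in auto)
qed

text \<open>The sum over \<open>n\<close> is carried out first, then terms are sorted by the
  exponent \<open>y = m * j\<close> of \<open>x2\<close>.\<close>

lemma triple_sum_outer:
  assumes x: "norm x1 < 1" "norm x2 < 1"
  shows "((\<lambda>y. (\<Sum>m | m dvd y. chi_nat m * of_nat m ^ (k - 1) * pseries (\<lambda>n. qc (t * (y div m) * n)) (x1 ^ m)) * x2 ^ y)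
     has_sum triple_sum x1 x2) {1..}"
proof -
  let ?f = "\<lambda>(m, j). chi_nat m * of_nat m ^ (k - 1) * pseries (\<lambda>n. qc (t * j * n)) (x1 ^ m) * x2 ^ (m * j)"
  have "(triple x1 x2 has_sum triple_sum x1 x2) (UNIV \<times> UNIV)" using triple_has_sum[OF x] by simp
  then have f: "(?f has_sum triple_sum x1 x2) UNIV"
  proof (rule has_sum_SigmaD)
    fix p :: "nat \<times> nat"
    obtain m j where p: "p = (m, j)" by (cases p)
    show "((\<lambda>n. triple x1 x2 (p, n)) has_sum ?f p) UNIV"
    proof (cases "m = 0")
      case True
      then have "triple x1 x2 (p, n) = 0" "?f p = 0" for n by (simp_all add: triple_def p)
      then show ?thesis by (simp only: has_sum_0_simp)
    next
      case False
      then have m: "m > 0" by simp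
      have xm: "norm (x1 ^ m) < 1" by (rule norm_power_less_1[OF x(1) m])
      let ?c = "chi_nat m * of_nat m ^ (k - 1)"
      have "((\<lambda>n. qc (t * j * n) * (x1 ^ m) ^ n) has_sum pseries (\<lambda>n. qc (t * j * n)) (x1 ^ m)) UNIV"
        by (rule norm_summable_imp_has_sum[OF unit_series_abs_summable[OF unit_series_qc_dilate xm] pseries_sums[OF unit_series_qc_dilate xm]])
      then have "((\<lambda>n. ?c * (qc (t * j * n) * (x1 ^ m) ^ n)) has_sum ?c * pseries (\<lambda>n. qc (t * j * n)) (x1 ^ m)) UNIV"
        by (rule has_sum_cmult_right)
      then have "((\<lambda>n. ?c * (qc (t * j * n) * (x1 ^ m) ^ n) * x2 ^ (m * j)) has_sum ?c * pseries (\<lambda>n. qc (t * j * n)) (x1 ^ m) * x2 ^ (m * j)) UNIV"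
        by (rule has_sum_cmult_left)
      then show ?thesis by (simp only: triple_def p prod.case power_mult mult.assoc)
    qed
  qed
  have "((\<lambda>y. \<Sum>m | m dvd y. ?f (m, y div m)) has_sum triple_sum x1 x2) {1..}"
    by (rule has_sum_divisor_pairs[OF f]) (simp_all add: pseries_def)
  also have "((\<lambda>y. \<Sum>m | m dvd y. ?f (m, y div m)) has_sum triple_sum x1 x2) {1..} \<longleftrightarrow> ?thesis"
    by (rule has_sum_cong) (simp add: sum_distrib_right)
  finally show ?thesis .
qed

text \<open>A divisor of \<open>t * y\<close> coprime to the level divides \<open>y\<close>, so the
  other diagonal entry is \<open>d = t * (y div m)\<close>. The sum over \<open>b\<close> retains
  the exponents divisible by \<open>d\<close> with a factor \<open>d\<close>, and
  \<open>m ^ k * d = t * y * m ^ (k - 1)\<close>.\<close>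

lemma hecke_expansion:
  assumes y: "y > 0" and z: "Im z > 0"
  shows "hecke (int (t * y)) z =
    of_nat (t * y) * (\<Sum>m | m dvd y. chi_nat m * of_nat m ^ (k - 1) * pseries (\<lambda>n. qc (t * (y div m) * n)) (qexp z ^ m))"
proof -
  let ?D = "{m. m dvd y \<and> coprime (int m) level}"
  let ?d = "\<lambda>m. t * (y div m)"
  have fin: "finite {m. m dvd y}" using y by (intro finite_divisors_nat) auto
  have finD: "finite ?D" by (rule finite_subset[OF _ fin]) auto
  have pos: "m > 0" "y div m > 0" "m * ?d m = t * y" "?d m > 0" if "m dvd y" for m
    using that y t_pos by (auto elim!: dvdE)
  let ?\<phi> = "\<lambda>(m, b). (int m, int b, int (?d m))"
  have "bij_betw ?\<phi> (Sigma ?D (\<lambda>m. {..<?d m})) (hecke_reps (int (t * y)))"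
  proof (rule bij_betwI')
    fix p q assume "p \<in> Sigma ?D (\<lambda>m. {..<?d m})" "q \<in> Sigma ?D (\<lambda>m. {..<?d m})"
    show "?\<phi> p = ?\<phi> q \<longleftrightarrow> p = q" by (cases p; cases q) auto
  next
    fix p assume p: "p \<in> Sigma ?D (\<lambda>m. {..<?d m})"
    then obtain m b where mb: "p = (m, b)" "m dvd y" "coprime (int m) level" "b < ?d m" by auto
    have "int m * int (?d m) = int (t * y)" by (simp only: of_nat_mult[symmetric] pos(3)[OF mb(2)])
    then show "?\<phi> p \<in> hecke_reps (int (t * y))" using mb pos[OF mb(2)]
      by (simp only: hecke_reps_def) (simp only: mem_Collect_eq prod.case of_nat_0_less_iff of_nat_0_le_iff of_nat_less_iff simp_thms)
  next
    fix w assume "w \<in> hecke_reps (int (t * y))"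
    then obtain e b d where w: "w = (e, b, d)" "e > 0" "d > 0" "e * d = int (t * y)" "coprime e level" "0 \<le> b" "b < d"
      by (auto simp: hecke_reps_def)
    define m where "m = nat e"
    have e: "e = int m" using w by (simp add: m_def)
    have "int m * int (nat d) = int (t * y)" using w e by simp
    then have md: "m * nat d = t * y" by (simp only: of_nat_mult[symmetric] of_nat_eq_iff)
    have "coprime (int m) (int t)" using w(5) by (simp add: level_def e)
    then have "coprime m t" by simp
    moreover have "m dvd t * y" using md by (metis dvd_triv_left)
    ultimately have my: "m dvd y" by (simp add: coprime_dvd_mult_right_iff)
    then have "m * nat d = m * ?d m" using md pos(3) by simp
    then have "nat d = ?d m" using pos(1)[OF my] by simp
    then have d: "d = int (?d m)" using w(3) by linarith
    have "nat b < ?d m" using w(6,7) d by (simp only: nat_less_iff)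
    then have "(m, nat b) \<in> Sigma ?D (\<lambda>m. {..<?d m})" using my w(5) e by simp
    moreover have "w = ?\<phi> (m, nat b)" using w d e by simp
    ultimately show "\<exists>p\<in>Sigma ?D (\<lambda>m. {..<?d m}). w = ?\<phi> p" by blast
  qed
  then have "hecke (int (t * y)) z = (\<Sum>(m, b)\<in>Sigma ?D (\<lambda>m. {..<?d m}). chi (int m) * of_int (int m) ^ k * Q (moebius (int m) (int b) 0 (int (?d m)) z))"
    unfolding hecke_def by (subst sum.reindex_bij_betw[symmetric]) (auto intro!: sum.cong)
  also have "\<dots> = (\<Sum>m\<in>?D. \<Sum>b<?d m. chi (int m) * of_int (int m) ^ k * Q (moebius (int m) (int b) 0 (int (?d m)) z))"
    using finD by (subst sum.Sigma) auto
  also have "\<dots> = (\<Sum>m\<in>?D. of_nat (t * y) * (chi_nat m * of_nat m ^ (k - 1) * pseries (\<lambda>n. qc (?d m * n)) (qexp z ^ m)))"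
  proof (rule sum.cong[OF refl])
    fix m assume "m \<in> ?D"
    then have m: "m dvd y" "coprime (int m) level" by auto
    have w: "Im (of_nat m * z) > 0" using pos[OF m(1)] z by simp
    have "Q (moebius (int m) (int b) 0 (int (?d m)) z) = qseries qc ((of_nat m * z + of_nat b) / of_nat (?d m))" for b
    proof -
      have "Im ((of_nat m * z + of_nat b) / of_nat (?d m)) > 0" using w pos[OF m(1)] by (simp only: add_divide_distrib) simp
      then show ?thesis by (simp add: qseries_qc moebius_def)
    qed
    then have "(\<Sum>b<?d m. chi (int m) * of_int (int m) ^ k * Q (moebius (int m) (int b) 0 (int (?d m)) z)) =
       chi (int m) * of_nat m ^ k * (\<Sum>b<?d m. qseries qc ((of_nat m * z + of_nat b) / of_nat (?d m)))"
      by (simp add: sum_distrib_left)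
    also have "(\<Sum>b<?d m. qseries qc ((of_nat m * z + of_nat b) / of_nat (?d m))) = of_nat (?d m) * pseries (\<lambda>n. qc (?d m * n)) (qexp z ^ m)"
      using qseries_average[OF qc(1) pos(4)[OF m(1)] w] by (simp only: qexp_of_nat_mult)
    also have "chi (int m) * of_nat m ^ k * (of_nat (?d m) * pseries (\<lambda>n. qc (?d m * n)) (qexp z ^ m)) =
      of_nat (m * ?d m) * (chi (int m) * of_nat m ^ (k - 1) * pseries (\<lambda>n. qc (?d m * n)) (qexp z ^ m))"
      using k_pos by (cases k) (simp_all add: mult_ac)
    finally show "(\<Sum>b<?d m. chi (int m) * of_int (int m) ^ k * Q (moebius (int m) (int b) 0 (int (?d m)) z)) =
       of_nat (t * y) * (chi_nat m * of_nat m ^ (k - 1) * pseries (\<lambda>n. qc (?d m * n)) (qexp z ^ m))"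
      using m by (simp only: pos(3)[OF m(1)] chi_nat_def if_True)
  qed
  also have "\<dots> = (\<Sum>m | m dvd y. of_nat (t * y) * (chi_nat m * of_nat m ^ (k - 1) * pseries (\<lambda>n. qc (?d m * n)) (qexp z ^ m)))"
    by (rule sum.mono_neutral_left[OF fin]) (auto simp: chi_nat_def)
  finally show ?thesis by (simp only: sum_distrib_left)
qed

lemma triple_sum_law:
  assumes g: "p * s - q * r = 1" "level dvd r" "level dvd p - 1" and z: "Im z > 0" and x: "norm x < 1"
  shows "triple_sum (qexp (moebius p q r s z)) x = (of_int r * z + of_int s) ^ k * triple_sum (qexp z) x"
proof -
  let ?S = "\<lambda>z y. \<Sum>m | m dvd y. chi_nat m * of_nat m ^ (k - 1) * pseries (\<lambda>n. qc (t * (y div m) * n)) (qexp z ^ m)"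
  let ?w = "moebius p q r s z" and ?J = "(of_int r * z + of_int s) ^ k"
  have w: "Im ?w > 0" using z g by (intro Im_moebius_pos) auto
  have hs: "((\<lambda>y. ?S z y * x ^ y) has_sum triple_sum (qexp z) x) {1..}" if "Im z > 0" for z
    using that x by (intro triple_sum_outer) (simp_all add: norm_qexp_less_1_iff)
  have "?S ?w y = ?J * ?S z y" if "y \<in> {1..}" for y
  proof -
    have y: "y > 0" using that by simp
    have "of_nat (t * y) * ?S ?w y = of_nat (t * y) * (?J * ?S z y)"
      using hecke_law[OF g z, of "int (t * y)"] hecke_expansion[OF y z] hecke_expansion[OF y w]
      by (simp only: mult.left_commute)
    moreover have "(of_nat (t * y) :: complex) \<noteq> 0" using y t_pos by simp
    ultimately show ?thesis by (simp only: mult_cancel_left simp_thms)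
  qed
  then have "((\<lambda>y. ?S ?w y * x ^ y) has_sum triple_sum (qexp ?w) x) {1..} \<longleftrightarrow>
     ((\<lambda>y. ?J * (?S z y * x ^ y)) has_sum triple_sum (qexp ?w) x) {1..}"
    by (intro has_sum_cong) (simp only: mult.assoc)
  with hs[OF w] have "((\<lambda>y. ?J * (?S z y * x ^ y)) has_sum triple_sum (qexp ?w) x) {1..}" by simp
  moreover have "((\<lambda>y. ?J * (?S z y * x ^ y)) has_sum ?J * triple_sum (qexp z) x) {1..}"
    by (rule has_sum_cmult_right[OF hs[OF z]])
  ultimately show ?thesis by (rule has_sum_unique)
qed

definition diag_coeff :: "nat \<Rightarrow> complex" where
  "diag_coeff m = (\<Sum>i\<le>m. qc (t * i * (m - i)))"

lemma diag_coeff_bound: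
  obtains B where "B \<ge> 0" "\<And>m. norm (diag_coeff m) \<le> B * real m ^ (2 * k + 1)"
proof -
  obtain B where B: "B > 0" "\<And>n. norm (qc n) \<le> B * real n ^ k" by (rule qc_bound) (rule that)
  have "norm (diag_coeff m) \<le> (2 * B * real t ^ k) * real m ^ (2 * k + 1)" for m
  proof (cases "m = 0")
    case True then show ?thesis by (simp add: diag_coeff_def)
  next
    case False
    have "norm (diag_coeff m) \<le> (\<Sum>i\<le>m. B * (real t * (real m * real m)) ^ k)"
      unfolding diag_coeff_def
    proof (rule sum_norm_le)
      fix i assume "i \<in> {..m}"
      have "norm (qc (t * i * (m - i))) \<le> B * real (t * i * (m - i)) ^ k" by (rule B)
      also have "\<dots> \<le> B * real (t * (m * m)) ^ k"
      proof (intro mult_left_mono power_mono)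
        have "t * i * (m - i) \<le> t * (m * m)"
          unfolding mult.assoc using \<open>i \<in> _\<close> by (intro mult_le_mono) auto
        then show "real (t * i * (m - i)) \<le> real (t * (m * m))" by (simp only: of_nat_le_iff)
      qed (use B in auto)
      finally show "norm (qc (t * i * (m - i))) \<le> B * (real t * (real m * real m)) ^ k"
        by (simp only: of_nat_mult)
    qed
    also have "\<dots> = (real m + 1) * (B * (real t ^ k * real m ^ (2 * k)))"
      by (simp add: power_mult_distrib mult_2 power_add)
    also have "\<dots> \<le> (2 * real m) * (B * (real t ^ k * real m ^ (2 * k)))"
      using False B(1) by (intro mult_right_mono) auto
    finally show ?thesis by (simp add: mult_ac)
  qed
  then show ?thesis using that[of "2 * B * real t ^ k"] B(1) by simp
qed

text \<open>On the diagonal the exponents add up to \<open>m * (j + n)\<close>; the terms with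
  \<open>j + n = N\<close> are collected in \<open>diag_coeff N\<close>.\<close>

lemma triple_sum_diag:
  assumes x: "norm x < 1"
  shows "triple_sum x x = lambert_sum diag_coeff x"
proof -
  let ?h = "\<lambda>((m, N), i). ((m, i), N - i) :: (nat \<times> nat) \<times> nat"
  let ?A = "Sigma (UNIV \<times> UNIV) (\<lambda>(m, N). {..N}) :: ((nat \<times> nat) \<times> nat) set"
  have "bij_betw ?h ?A UNIV"
    by (rule bij_betwI[of _ _ _ "\<lambda>((m, i), j). ((m, i + j), i)"]) auto
  from has_sum_reindex_bij_betw[OF this, of "triple x x" "triple_sum x x"]
  have "((\<lambda>p. triple x x (?h p)) has_sum triple_sum x x) ?A" using triple_has_sum[OF x x] by simp
  then have "(lambert diag_coeff x has_sum triple_sum x x) (UNIV \<times> UNIV)"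
  proof (rule has_sum_SigmaD)
    fix p :: "nat \<times> nat"
    obtain m N where p: "p = (m, N)" by (cases p)
    have "triple x x (?h (p, i)) = chi_nat m * of_nat m ^ (k - 1) * qc (t * i * (N - i)) * x ^ (m * N)" if "i \<le> N" for i
    proof -
      have "m * (N - i) + m * i = m * N" using that by (simp flip: distrib_left)
      then have "x ^ (m * (N - i)) * x ^ (m * i) = x ^ (m * N)" by (simp only: power_add[symmetric])
      then show ?thesis by (simp add: p triple_def)
    qed
    then have "(\<Sum>i\<le>N. triple x x (?h (p, i))) = (\<Sum>i\<le>N. chi_nat m * of_nat m ^ (k - 1) * qc (t * i * (N - i)) * x ^ (m * N))"
      by (intro sum.cong) auto
    also have "\<dots> = lambert diag_coeff x p"
      by (simp add: lambert_def p diag_coeff_def sum_distrib_left sum_distrib_right)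
    finally have eq: "(\<Sum>i\<le>N. triple x x (?h (p, i))) = lambert diag_coeff x p" .
    have "((\<lambda>i. triple x x (?h (p, i))) has_sum (\<Sum>i\<le>N. triple x x (?h (p, i)))) {..N}"
      by (rule has_sum_finite) simp
    then show "((\<lambda>i. triple x x (?h (p, i))) has_sum lambert diag_coeff x p) (case p of (m, N) \<Rightarrow> {..N})"
      unfolding eq by (simp add: p)
  qed
  then have "(lambert diag_coeff x has_sum triple_sum x x) UNIV" by simp
  moreover obtain B where "B \<ge> 0" "\<And>m. norm (diag_coeff m) \<le> B * real m ^ (2 * k + 1)"
    by (rule diag_coeff_bound) (rule that)
  then have "(lambert diag_coeff x has_sum lambert_sum diag_coeff x) UNIV"
    by (intro lambert_has_sum x) auto
  ultimately show ?thesis by (rule has_sum_unique)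
qed

text \<open>Each variable contributes weight \<open>k\<close>; the symmetry of the kernel brings the
  second variable into the position where \<open>triple_sum_law\<close> applies.\<close>

lemma diag_law:
  assumes g: "p * s - q * r = 1" "level dvd r" "level dvd p - 1" and z: "Im z > 0"
  shows "lambert_sum diag_coeff (qexp (moebius p q r s z)) = (of_int r * z + of_int s) ^ (2 * k) * lambert_sum diag_coeff (qexp z)"
proof -
  let ?w = "moebius p q r s z" and ?J = "(of_int r * z + of_int s) ^ k"
  have w: "Im ?w > 0" using z g by (intro Im_moebius_pos) auto
  have x: "norm (qexp z) < 1" "norm (qexp ?w) < 1" using z w by (simp_all only: norm_qexp_less_1_iff)
  have "lambert_sum diag_coeff (qexp ?w) = triple_sum (qexp ?w) (qexp ?w)"
    by (rule triple_sum_diag[OF x(2), symmetric])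
  also have "\<dots> = ?J * triple_sum (qexp z) (qexp ?w)" by (rule triple_sum_law[OF g z x(2)])
  also have "triple_sum (qexp z) (qexp ?w) = triple_sum (qexp ?w) (qexp z)" by (rule triple_sum_commute[OF x])
  also have "\<dots> = ?J * triple_sum (qexp z) (qexp z)" by (rule triple_sum_law[OF g z x(1)])
  also have "triple_sum (qexp z) (qexp z) = lambert_sum diag_coeff (qexp z)" by (rule triple_sum_diag[OF x(1)])
  finally show ?thesis by (simp add: mult_2 power_add)
qed

end

section \<open>The lift to integral weight\<close>

lemma power_le_fact_exp:
  assumes "x \<ge> 0" shows "x ^ n \<le> fact n * exp (x::real)"
proof -
  have "x ^ n /\<^sub>R fact n \<le> (\<Sum>j. x ^ j /\<^sub>R fact j)"
    using sum_le_suminf[OF summable_exp_generic[of x], of "{n}"] assms by simp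
  then have "x ^ n / fact n \<le> exp x" by (simp add: exp_def divide_inverse mult.commute)
  then show ?thesis by (simp add: field_simps)
qed

lemma powr_le_exp_half:
  obtains A where "A > 0" "\<And>u. u > 0 \<Longrightarrow> u powr (real k + 1/2) \<le> A * exp (u / 2)"
proof -
  define A :: real where "A = 2 ^ k * fact k + 2 ^ (k + 1) * fact (k + 1)"
  have "A > 0" unfolding A_def by (intro add_pos_pos mult_pos_pos) auto
  moreover have "u powr (real k + 1/2) \<le> A * exp (u / 2)" if u: "u > 0" for u :: real
  proof -
    have pw: "u ^ n \<le> 2 ^ n * fact n * exp (u / 2)" for n
      using power_le_fact_exp[of "u / 2" n] u by (simp add: power_divide field_simps)
    have "sqrt u \<le> 1 + u"
    proof (rule real_le_lsqrt)
      show "u \<le> (1 + u)\<^sup>2" using u by (simp add: power2_eq_square algebra_simps)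
    qed (use u in auto)
    have "u powr (real k + 1/2) = u ^ k * sqrt u"
      using u by (simp add: powr_add powr_realpow powr_half_sqrt)
    also have "\<dots> \<le> u ^ k * (1 + u)" using u \<open>sqrt u \<le> 1 + u\<close> by (intro mult_left_mono) auto
    also have "\<dots> = u ^ k + u ^ (k + 1)" by (simp add: algebra_simps)
    also have "\<dots> \<le> 2 ^ k * fact k * exp (u / 2) + 2 ^ (k + 1) * fact (k + 1) * exp (u / 2)"
      by (intro add_mono pw)
    also have "\<dots> = A * exp (u / 2)" unfolding A_def by (rule distrib_right[symmetric])
    finally show ?thesis .
  qed
  ultimately show ?thesis by (rule that)
qed

text \<open>Half of the decay \<open>exp (- n * Y)\<close> pays for the power of \<open>n\<close>,
  at the price of \<open>Y powr - (k + 1/2)\<close>; the other half leaves a geometric series of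
  size at most \<open>2 / Y\<close>.\<close>

lemma pseries_exp_growth:
  assumes c: "\<And>n. norm (c n) \<le> B * real n powr (real k + 1/2)" and B: "B \<ge> 0"
  obtains A where "A > 0" "\<And>x Y. Y > 0 \<Longrightarrow> norm x = exp (- Y) \<Longrightarrow> norm (pseries c x) \<le> A * Y powr - (real k + 3/2)"
proof -
  obtain A where A: "A > 0" "\<And>u. u > 0 \<Longrightarrow> u powr (real k + 1/2) \<le> A * exp (u / 2)" by (rule powr_le_exp_half) (rule that)
  show ?thesis
  proof (rule that[of "2 * (B * A) + 1"])
    show "2 * (B * A) + 1 > 0" using A B by (simp add: add_nonneg_pos)
    fix x :: complex and Y :: real assume Y: "Y > 0" and x: "norm x = exp (- Y)"
    let ?s = "real k + 1/2"
    define r where "r = exp (- Y / 2)"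
    have r: "0 < r" "r < 1" using Y by (auto simp: r_def)
    have g: "(\<lambda>n. B * A * Y powr - ?s * r ^ Suc n) sums (B * A * Y powr - ?s * (r * (1 / (1 - r))))"
      unfolding power_Suc using r by (intro sums_mult geometric_sums) auto
    have le: "norm (c (Suc n) * x ^ Suc n) \<le> B * A * Y powr - ?s * r ^ Suc n" for n
    proof -
      let ?n = "real (Suc n)"
      have rn: "r ^ Suc n = exp (- (?n * Y) / 2)"
        unfolding r_def by (simp only: exp_of_nat_mult[symmetric]) (simp add: mult_ac)
      have xn: "norm x ^ Suc n = exp (- (?n * Y))"
        unfolding x by (simp only: exp_of_nat_mult[symmetric]) simp
      have "?n powr ?s * Y powr ?s \<le> A * exp (?n * Y / 2)"
        using A(2)[of "?n * Y"] Y by (simp add: powr_mult)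
      then have "?n powr ?s * Y powr ?s * Y powr - ?s \<le> A * exp (?n * Y / 2) * Y powr - ?s"
        by (rule mult_right_mono) simp
      then have 1: "?n powr ?s \<le> A * exp (?n * Y / 2) * Y powr - ?s"
        using Y by (simp add: mult.assoc flip: powr_add)
      have "norm (c (Suc n) * x ^ Suc n) = norm (c (Suc n)) * exp (- (?n * Y))"
        by (simp only: norm_mult norm_power xn)
      also have "\<dots> \<le> B * (A * exp (?n * Y / 2) * Y powr - ?s) * exp (- (?n * Y))"
      proof (rule mult_right_mono)
        have "norm (c (Suc n)) \<le> B * ?n powr ?s" by (rule c)
        also have "\<dots> \<le> B * (A * exp (?n * Y / 2) * Y powr - ?s)" by (rule mult_left_mono[OF 1 B])
        finally show "norm (c (Suc n)) \<le> B * (A * exp (?n * Y / 2) * Y powr - ?s)" .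
      qed simp
      also have "\<dots> = B * A * Y powr - ?s * (exp (?n * Y / 2) * exp (- (?n * Y)))"
        by (simp only: mult_ac)
      also have "exp (?n * Y / 2) * exp (- (?n * Y)) = r ^ Suc n"
        unfolding rn by (simp only: exp_add[symmetric]) (simp add: field_simps)
      finally show ?thesis .
    qed
    have sm: "summable (\<lambda>n. norm (c (Suc n) * x ^ Suc n))"
      by (rule summable_comparison_test'[OF sums_summable[OF g], of 0]) (use le in auto)
    have "norm (\<Sum>n. c (Suc n) * x ^ Suc n) \<le> B * A * Y powr - ?s * (r * (1 / (1 - r)))"
      unfolding sums_unique[OF g] by (rule norm_suminf_le[OF le sums_summable[OF g]])
    moreover have "pseries c x = (\<Sum>n. c (Suc n) * x ^ Suc n)"
    proof -
      have "c 0 = 0" using c[of 0] by simp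
      moreover have "summable (\<lambda>n. c n * x ^ n)"
        using summable_norm_cancel[OF sm] by (subst (asm) summable_Suc_iff)
      ultimately show ?thesis using suminf_split_head[of "\<lambda>n. c n * x ^ n"] by (simp add: pseries_def)
    qed
    moreover have "r * (1 / (1 - r)) \<le> 2 / Y"
    proof -
      have "1 + Y / 2 \<le> exp (Y / 2)" by (rule exp_ge_add_one_self)
      also have "exp (Y / 2) = 1 / r" by (simp add: r_def exp_minus field_simps)
      finally have "Y / 2 * r \<le> 1 - r" using r by (simp add: field_simps)
      then show ?thesis using r Y by (simp add: field_simps)
    qed
    then have "B * A * Y powr - ?s * (r * (1 / (1 - r))) \<le> B * A * Y powr - ?s * (2 / Y)"
      using A B by (intro mult_left_mono) auto
    moreover have "Y powr - ?s * (2 / Y) = 2 * Y powr - (real k + 3/2)"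
    proof -
      have "- (real k + 3/2) = - ?s - 1" by simp
      then have "Y powr - (real k + 3/2) = Y powr (- ?s - 1)" by (simp only:)
      also have "\<dots> = Y powr - ?s / Y" unfolding powr_diff using Y by simp
      finally show ?thesis by simp
    qed
    ultimately have "norm (pseries c x) \<le> B * A * (2 * Y powr - (real k + 3/2))"
      by (simp only: mult.assoc) 
    also have "\<dots> = (2 * (B * A)) * Y powr - (real k + 3/2)" by (simp only: mult_ac)
    also have "\<dots> \<le> (2 * (B * A) + 1) * Y powr - (real k + 3/2)" by (intro mult_right_mono) auto
    finally show "norm (pseries c x) \<le> (2 * (B * A) + 1) * Y powr - (real k + 3/2)" .
  qed
qed

lemma qexp_half_add: "qexp ((z + 1) / 2) = - qexp (z / 2)"
  using qexp_add[of "z / 2" "1 / 2"] by (simp add: add_divide_distrib)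

lemma qexp_half_square: "(qexp (z / 2))\<^sup>2 = qexp z"
  using qexp_of_nat_mult[of 2 "z / 2"] by simp

context plus_eigenform
begin

text \<open>Hecke's estimate: the bound on \<open>pet\<close> is used on the circle at height
  \<open>1 / n\<close>.\<close>

lemma coeff_bound:
  obtains B where "B > 0" "\<And>n. norm (a n) \<le> B * real n powr (real k / 2 + 1/4)"
proof -
  obtain M where M: "M > 0" "\<And>u v z. Im z > 0 \<Longrightarrow> odd u \<or> odd v \<Longrightarrow> pet u v z \<le> M"
    by (rule pet_bounded[OF coeff_0]) (rule that)
  let ?e = "real k / 2 + 1/4"
  have "norm (a n) \<le> M * exp (2 * pi) * real n powr ?e" for n
  proof (cases "n = 0")
    case True then show ?thesis by (simp add: coeff_0)
  next
    case False
    define r where "r = exp (- 2 * pi / real n)"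
    have r: "0 < r" "r < 1" using False by (auto simp: r_def divide_less_0_iff)
    have "norm (a n) \<le> M * real n powr ?e / r ^ n"
    proof (rule pseries_coeff_bound[OF unit r])
      fix x :: complex assume x: "norm x = r"
      then have "x \<noteq> 0" using r by auto
      then obtain z where z: "qexp z = x" by (rule qexp_surj)
      have "exp (- 2 * pi * Im z) = exp (- 2 * pi / real n)" using x norm_qexp[of z] z by (simp add: r_def)
      then have "- 2 * pi * Im z = - 2 * pi * (1 / real n)" by simp
      then have Im: "Im z = 1 / real n" by (simp only: mult_cancel_left) simp
      have "pet 1 1 (2 * z) \<le> M" using False by (intro M(2)) (auto simp: Im)
      then have "norm (qseries a z) * (2 / real n) powr ?e \<le> M" by (simp add: pet_def branch_def Im)
      moreover have "(1 / real n) powr ?e \<le> (2 / real n) powr ?e" by (rule powr_mono2) (auto simp: divide_right_mono)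
      then have "norm (qseries a z) * (1 / real n) powr ?e \<le> norm (qseries a z) * (2 / real n) powr ?e"
        by (rule mult_left_mono) simp
      ultimately have "norm (qseries a z) * (1 / real n) powr ?e \<le> M" by linarith
      then have "norm (qseries a z) \<le> M * real n powr ?e"
        using False by (simp add: powr_divide field_simps)
      then show "norm (pseries a x) \<le> M * real n powr ?e" by (simp add: qseries_def z)
    qed
    also have "r ^ n = exp (- (2 * pi))" using False unfolding r_def by (simp only: exp_of_nat_mult[symmetric]) simp
    finally show ?thesis by (simp add: exp_minus field_simps)
  qed
  then show ?thesis using M(1) by (intro that[of "M * exp (2 * pi)"]) auto
qed

definition square_coeff :: "nat \<Rightarrow> complex" where
  "square_coeff n = a (t * n\<^sup>2)"

lemma square_coeff_bound:
  obtains B where "B > 0" "\<And>n. norm (square_coeff n) \<le> B * real n powr (real k + 1/2)"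
proof -
  obtain B where B: "B > 0" "\<And>n. norm (a n) \<le> B * real n powr (real k / 2 + 1/4)" by (rule coeff_bound) (rule that)
  let ?e = "real k / 2 + 1/4"
  have "norm (square_coeff n) \<le> B * real t powr ?e * real n powr (real k + 1/2)" for n
  proof -
    have "real (n\<^sup>2) powr ?e = real n powr (real k + 1/2)"
    proof (cases "n = 0")
      case False
      then have "real (n\<^sup>2) powr ?e = (real n powr 2) powr ?e" by simp
      also have "\<dots> = real n powr (2 * ?e)" by (rule powr_powr)
      finally show ?thesis by (simp add: algebra_simps)
    qed simp
    then show ?thesis using B(2)[of "t * n\<^sup>2"] by (simp add: square_coeff_def powr_mult mult_ac)
  qed
  then show ?thesis using B(1) t_pos by (intro that[of "B * real t powr ?e"]) auto
qed

lemma square_coeff_diag: "square_coeff n = diag_coeff (2 * n)"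
proof (cases "n = 0")
  case True then show ?thesis by (simp add: square_coeff_def diag_coeff_def coeff_0)
next
  case False
  have "diag_coeff (2 * n) = (\<Sum>j\<in>{1..<2*n}. qc (t * j * (2 * n - j)))"
    unfolding diag_coeff_def
  proof (rule sum.mono_neutral_right)
    show "\<forall>i\<in>{..2 * n} - {1..<2 * n}. qc (t * i * (2 * n - i)) = 0"
    proof
      fix i assume "i \<in> {..2 * n} - {1..<2 * n}"
      then have "i = 0 \<or> i = 2 * n" by auto
      then show "qc (t * i * (2 * n - i)) = 0" by auto
    qed
  qed auto
  then show ?thesis using coeff_t_square[of n] False by (simp add: square_coeff_def)
qed

lemma square_coeff_double: "square_coeff (2 * n) = l * square_coeff n"
  using coeff_mult_4[of "t * n\<^sup>2"] by (simp add: square_coeff_def power_mult_distrib mult.left_commute)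

lemma square_coeff_power_bound:
  obtains B where "B \<ge> 0" "\<And>n. norm (square_coeff n) \<le> B * real n ^ (2 * k + 1)"
proof -
  obtain B where B: "B \<ge> 0" "\<And>m. norm (diag_coeff m) \<le> B * real m ^ (2 * k + 1)" by (rule diag_coeff_bound) (rule that)
  have "norm (square_coeff n) \<le> (B * 2 ^ (2 * k + 1)) * real n ^ (2 * k + 1)" for n
    unfolding square_coeff_diag using B(2)[of "2 * n"] by (simp only: of_nat_mult of_nat_numeral power_mult_distrib mult.assoc)
  then show ?thesis using that[of "B * 2 ^ (2 * k + 1)"] B(1) by simp
qed

definition F :: "complex \<Rightarrow> complex" where
  "F z = lambert_sum square_coeff (qexp z)"

lemma F_qseries: "unit_series (lambert_coeff square_coeff)" "Im z > 0 \<Longrightarrow> F z = qseries (lambert_coeff square_coeff) z"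
proof -
  obtain B where B: "B \<ge> 0" "\<And>n. norm (square_coeff n) \<le> B * real n ^ (2 * k + 1)" by (rule square_coeff_power_bound) (rule that)
  have p: "2 * k + 1 > 0" by simp
  show "unit_series (lambert_coeff square_coeff)" by (rule lambert_pseries(1)[OF B(2,1) p])
  show "F z = qseries (lambert_coeff square_coeff) z" if "Im z > 0"
    unfolding F_def qseries_def
    by (rule lambert_pseries(2)[OF B(2,1) p, symmetric]) (simp only: norm_qexp_less_1_iff that)
qed

lemma lambert_coeff_square_1: "lambert_coeff square_coeff 1 \<noteq> 0"
  using leading(1) by (simp add: lambert_coeff_def chi_nat_1 square_coeff_def)

text \<open>The even-indexed diagonal sums are the coefficients at \<open>t * n\<^sup>2\<close>, so
  \<open>F\<close> is the even part of the restricted kernel. This is how it inherits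
  modularity.\<close>

lemma F_diag:
  assumes z: "Im z > 0"
  shows "2 * F z = lambert_sum diag_coeff (qexp (z / 2)) + lambert_sum diag_coeff (qexp ((z + 1) / 2))"
proof -
  obtain B where B: "B \<ge> 0" "\<And>m. norm (diag_coeff m) \<le> B * real m ^ (2 * k + 1)" by (rule diag_coeff_bound) (rule that)
  have "norm (qexp (z / 2)) < 1" using z by (simp only: norm_qexp_less_1_iff) simp
  from lambert_sum_even_part[OF B(2,1) _ this]
  have "lambert_sum diag_coeff (qexp (z / 2)) + lambert_sum diag_coeff (- qexp (z / 2)) =
    2 * lambert_sum (\<lambda>n. diag_coeff (2 * n)) ((qexp (z / 2))\<^sup>2)" by simp
  then show ?thesis by (simp only: F_def qexp_half_add qexp_half_square square_coeff_diag[symmetric])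
qed

lemma F_double:
  assumes z: "Im z > 0"
  shows "F (z / 2) + F ((z + 1) / 2) = 2 * l * F z"
proof -
  obtain B where B: "B \<ge> 0" "\<And>n. norm (square_coeff n) \<le> B * real n ^ (2 * k + 1)" by (rule square_coeff_power_bound) (rule that)
  have "norm (qexp (z / 2)) < 1" using z by (simp only: norm_qexp_less_1_iff) simp
  from lambert_sum_even_part[OF B(2,1) _ this]
  have 1: "F (z / 2) + F ((z + 1) / 2) = 2 * lambert_sum (\<lambda>n. square_coeff (2 * n)) (qexp z)"
    by (simp add: F_def qexp_half_add qexp_half_square)
  have "lambert (\<lambda>n. square_coeff (2 * n)) (qexp z) = (\<lambda>p. l * lambert square_coeff (qexp z) p)"
    by (simp add: fun_eq_iff lambert_def square_coeff_double)
  then have "lambert_sum (\<lambda>n. square_coeff (2 * n)) (qexp z) = l * F z"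
    unfolding lambert_sum_def F_def by (simp only: infsum_cmult_right')
  with 1 show ?thesis by simp
qed

text \<open>For even \<open>q\<close> the conjugates of the matrix under the maps from
  \<open>z\<close> to \<open>z / 2\<close> and to \<open>(z + 1) / 2\<close> are integral, so the
  two terms of \<open>F_diag\<close> transform separately. Both conjugates satisfy the congruences
  of \<open>diag_law\<close>; \<open>e\<close> is the upper right entry of the second.\<close>

lemma F_law:
  assumes g: "p * s - q * r = 1" "level dvd r" "level dvd p - 1" "even q" and z: "Im z > 0"
  shows "F (moebius p q r s z) = (of_int r * z + of_int s) ^ (2 * k) * F z"
proof -
  let ?w = "moebius p q r s z"
  have w: "Im ?w > 0" using z g by (intro Im_moebius_pos) auto
  have "even level" by (simp add: level_def)
  then have "even r" "even (p - 1)" using g(2,3) by (blast intro: dvd_trans)+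
  then have ev: "even r" "odd p" by auto
  have "odd s"
  proof
    assume "even s"
    then have "even (p * s - q * r)" using ev by simp
    with g(1) show False by simp
  qed
  obtain q' where q': "q = 2 * q'" using g(4) by (rule evenE)
  have "even (q + s - p - r)" using ev \<open>odd s\<close> g(4) by simp
  then obtain e where e: "q + s - p - r = 2 * e" by (rule evenE)
  have nz: "of_int r * z + of_int s \<noteq> (0::complex)"
    by (rule moebius_denom_nonzero[OF z]) (use g in auto)
  have m1: "moebius p q' (2 * r) s (z / 2) = ?w / 2"
    using nz by (simp add: moebius_def q' field_simps)
  have num: "of_int (p + r) * ((z + 1) / 2) + of_int e = (of_int p * z + of_int q + (of_int r * z + of_int s)) / (2::complex)"
  proof -
    have "(of_int (2 * e) :: complex) = of_int (q + s - p - r)" unfolding e ..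
    then have "(of_int e :: complex) = of_int (q + s - p - r) / 2" by (simp add: mult.commute)
    then show ?thesis by (simp add: add_divide_distrib diff_divide_distrib algebra_simps)
  qed
  have den: "of_int (2 * r) * ((z + 1) / 2) + of_int (s - r) = of_int r * z + (of_int s :: complex)"
    by (simp add: field_simps)
  have half: "(n + d) / 2 / d = (n / d + 1) / 2" if "d \<noteq> 0" for n d :: complex
    using that by (simp add: field_simps)
  have m2: "moebius (p + r) e (2 * r) (s - r) ((z + 1) / 2) = (?w + 1) / 2"
    unfolding moebius_def num den by (rule half[OF nz])
  have d1: "p * s - q' * (2 * r) = 1" using g(1) q' by simp
  have d2: "(p + r) * (s - r) - e * (2 * r) = 1"
  proof -
    have "e * (2 * r) = (q + s - p - r) * r" unfolding e by simp
    then show ?thesis using g(1) by (simp add: algebra_simps)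
  qed
  have "2 * F ?w = lambert_sum diag_coeff (qexp (moebius p q' (2 * r) s (z / 2)))
      + lambert_sum diag_coeff (qexp (moebius (p + r) e (2 * r) (s - r) ((z + 1) / 2)))"
    unfolding m1 m2 by (rule F_diag[OF w])
  also have "lambert_sum diag_coeff (qexp (moebius p q' (2 * r) s (z / 2))) =
      (of_int (2 * r) * (z / 2) + of_int s) ^ (2 * k) * lambert_sum diag_coeff (qexp (z / 2))"
    using g(2,3) z by (intro diag_law d1) auto
  also have "lambert_sum diag_coeff (qexp (moebius (p + r) e (2 * r) (s - r) ((z + 1) / 2))) =
      (of_int (2 * r) * ((z + 1) / 2) + of_int (s - r)) ^ (2 * k) * lambert_sum diag_coeff (qexp ((z + 1) / 2))"
  proof (intro diag_law d2)
    have "level dvd (p - 1) + r" using g(2,3) by (rule dvd_add[rotated])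
    then show "level dvd p + r - 1" by (simp add: algebra_simps)
  qed (use g z in auto)
  also have "of_int (2 * r) * ((z + 1) / 2) + of_int (s - r) = of_int r * z + (of_int s :: complex)" by (rule den)
  also have "of_int (2 * r) * (z / 2) + of_int s = of_int r * z + (of_int s :: complex)" by simp
  also have "(of_int r * z + of_int s) ^ (2 * k) * lambert_sum diag_coeff (qexp (z / 2)) +
      (of_int r * z + of_int s) ^ (2 * k) * lambert_sum diag_coeff (qexp ((z + 1) / 2)) =
      (of_int r * z + of_int s) ^ (2 * k) * (2 * F z)"
    unfolding F_diag[OF z] by (rule distrib_left[symmetric])
  finally show ?thesis by simp
qed

text \<open>The \<open>m\<close>-th term is at most a constant times
  \<open>m ^ (k - 1) * (m * Im z) powr - (k + 3/2)\<close>; the powers of \<open>m\<close> combine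
  to the summable exponent \<open>- 5/2\<close>.\<close>

lemma F_growth:
  obtains K where "K > 0" "\<And>z. Im z > 0 \<Longrightarrow> norm (F z) \<le> K * Im z powr - (real k + 3/2)"
proof -
  obtain B where B: "B > 0" "\<And>n. norm (square_coeff n) \<le> B * real n powr (real k + 1/2)"
    by (rule square_coeff_bound) (rule that)
  obtain A where A: "A > 0" "\<And>x Y. Y > 0 \<Longrightarrow> norm x = exp (- Y) \<Longrightarrow> norm (pseries square_coeff x) \<le> A * Y powr - (real k + 3/2)"
    by (rule pseries_exp_growth[OF B(2)]) (use B(1) that in auto)
  obtain B' where B': "B' \<ge> 0" "\<And>n. norm (square_coeff n) \<le> B' * real n ^ (2 * k + 1)" by (rule square_coeff_power_bound) (rule that)
  let ?e = "- (real k + 3/2)"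
  have sm: "summable (\<lambda>m. real m powr - (5/2))" by (simp add: summable_real_powr_iff)
  define S where "S = (\<Sum>m. real m powr - (5/2))"
  have "S \<ge> 0" unfolding S_def by (rule suminf_nonneg[OF sm]) simp
  have "norm (F z) \<le> (A * (2 * pi) powr ?e * (S + 1)) * Im z powr ?e" if z: "Im z > 0" for z
  proof -
    let ?y = "Im z"
    let ?f = "\<lambda>m. chi_nat m * of_nat m ^ (k - 1) * pseries square_coeff (qexp z ^ m)"
    have "(?f has_sum F z) UNIV"
      unfolding F_def by (rule lambert_has_sum_outer[OF B'(2,1)]) (use z in \<open>simp_all add: norm_qexp_less_1_iff\<close>)
    then have f: "F z = suminf ?f" by (rule has_sum_imp_sums[THEN sums_unique])
    have le: "norm (?f m) \<le> A * (2 * pi) powr ?e * ?y powr ?e * real m powr - (5/2)" for m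
    proof (cases "m = 0")
      case False
      have x: "norm (qexp z ^ m) = exp (- (2 * pi * ?y * real m))"
        by (simp only: norm_power norm_qexp exp_of_nat_mult[symmetric]) (simp add: mult_ac)
      have "norm (?f m) = norm (chi_nat m) * (real m ^ (k - 1) * norm (pseries square_coeff (qexp z ^ m)))"
        by (simp only: norm_mult norm_power norm_of_nat mult.assoc)
      also have "\<dots> \<le> 1 * (real m ^ (k - 1) * (A * (2 * pi * ?y * real m) powr ?e))"
        using z False by (intro mult_mono norm_chi_nat A(2) x mult_nonneg_nonneg) auto
      also have "(2 * pi * ?y * real m) powr ?e = (2 * pi) powr ?e * ?y powr ?e * real m powr ?e"
        using z by (simp only: powr_mult)
      also have "real m ^ (k - 1) = real m powr (real k - 1)"
        using False k_pos by (simp add: powr_realpow[symmetric] of_nat_diff)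
      also have "1 * (real m powr (real k - 1) * (A * ((2 * pi) powr ?e * ?y powr ?e * real m powr ?e))) =
         A * (2 * pi) powr ?e * ?y powr ?e * (real m powr (real k - 1) * real m powr ?e)" by (simp only: mult_ac mult_1)
      also have "real m powr (real k - 1) * real m powr ?e = real m powr - (5/2)"
        by (simp only: powr_add[symmetric]) simp
      finally show ?thesis .
    qed (use A in simp)
    have "norm (F z) \<le> (\<Sum>m. A * (2 * pi) powr ?e * ?y powr ?e * real m powr - (5/2))"
      unfolding f by (rule norm_suminf_le[OF le summable_mult[OF sm]])
    also have "\<dots> = A * (2 * pi) powr ?e * ?y powr ?e * S" unfolding S_def by (rule suminf_mult[OF sm])
    also have "\<dots> \<le> A * (2 * pi) powr ?e * ?y powr ?e * (S + 1)" using A by (intro mult_left_mono) auto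
    finally show ?thesis by (simp only: mult_ac)
  qed
  moreover have "A * (2 * pi) powr ?e * (S + 1) > 0" using A \<open>S \<ge> 0\<close> by (intro mult_pos_pos) auto
  ultimately show ?thesis by (rule that[rotated])
qed

end

section \<open>The maximum principle\<close>

lemma qexp_eq_iff: "qexp z = qexp w \<longleftrightarrow> (\<exists>n::int. z = w + of_int n)"
proof
  assume "qexp z = qexp w"
  then obtain n :: int where "2 * of_real pi * \<i> * z = 2 * of_real pi * \<i> * w + of_int (2 * n) * pi * \<i>"
    unfolding qexp_def exp_eq by blast
  then have "(2 * of_real pi * \<i>) * z = (2 * of_real pi * \<i>) * (w + of_int n)" by (simp add: algebra_simps)
  then have "z = w + of_int n" by (simp only: mult_cancel_left) simp
  then show "\<exists>n::int. z = w + of_int n" ..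
next
  assume "\<exists>n::int. z = w + of_int n"
  then show "qexp z = qexp w" by (auto simp: qexp_add)
qed

lemma periodic_add_of_int:
  fixes f :: "complex \<Rightarrow> 'a"
  assumes per: "\<And>z. Im z > 0 \<Longrightarrow> f (z + 1) = f z" and z: "Im z > 0"
  shows "f (z + of_int n) = f z"
proof (induction n rule: int_induct[of _ 0])
  case (step1 i)
  then show ?case using per[of "z + of_int i"] z by (simp add: add.assoc)
next
  case (step2 i)
  then show ?case using per[of "z + of_int (i - 1)"] z by simp
qed simp

text \<open>The function descends to the punctured disc, and the uniform limit 0 makes the
  singularity at the centre removable, with value 0.\<close>

lemma periodic_imp_qseries:
  assumes hol: "f holomorphic_on {z. Im z > 0}" and per: "\<And>z. Im z > 0 \<Longrightarrow> f (z + 1) = f z"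
    and lim: "\<And>\<epsilon>. \<epsilon> > 0 \<Longrightarrow> \<exists>Y. \<forall>z. Im z \<ge> Y \<longrightarrow> Im z > 0 \<longrightarrow> norm (f z) < \<epsilon>"
  obtains c where "unit_series c" "c 0 = 0" "\<And>z. Im z > 0 \<Longrightarrow> f z = qseries c z"
proof -
  define G where "G w = (if w = 0 then 0 else f (SOME z. qexp z = w))" for w
  have G: "G (qexp z) = f z" if z: "Im z > 0" for z
  proof -
    have "qexp (SOME u. qexp u = qexp z) = qexp z" by (rule someI[of _ z]) simp
    then obtain n :: int where "(SOME u. qexp u = qexp z) = z + of_int n" by (auto simp only: qexp_eq_iff)
    then show ?thesis using periodic_add_of_int[of f, OF per z] by (simp add: G_def)
  qed
  have "G holomorphic_on ball 0 1 - {0}"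
  proof -
    have "G field_differentiable at w0" if w0: "w0 \<in> ball 0 1 - {0}" for w0
    proof -
      have nz: "w0 \<noteq> 0" using w0 by simp
      obtain z0 where z0: "qexp z0 = w0" by (rule qexp_surj[OF nz])
      \<comment> \<open>\<open>L\<close> is a local inverse of \<open>qexp\<close> near
        \<open>w0\<close>: on \<open>S\<close> the quotient \<open>w / w0\<close> stays in the right
        half plane, where \<open>Ln\<close> is holomorphic.\<close>
      define L where "L w = z0 + Ln (w / w0) / (2 * of_real pi * \<i>)" for w
      define S where "S = ball w0 (norm w0) \<inter> ball 0 1"
      have Re: "Re (w / w0) > 0" if "w \<in> S" for w
      proof -
        have "norm (w0 - w) < norm w0" using that by (simp add: S_def dist_norm)
        then have "norm (1 - w / w0) < 1" using nz by (simp add: field_simps norm_divide flip: norm_minus_commute)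
        then have "\<bar>Re (1 - w / w0)\<bar> < 1" using abs_Re_le_cmod order_le_less_trans by blast
        then show ?thesis by simp
      qed
      have qL: "qexp (L w) = w" if "w \<in> S" for w
      proof -
        have "w / w0 \<noteq> 0" using Re[OF that] by auto
        then have "qexp (Ln (w / w0) / (2 * of_real pi * \<i>)) = w / w0" by (simp add: qexp_def)
        then show ?thesis using nz by (simp add: L_def qexp_add z0)
      qed
      have ImL: "Im (L w) > 0" if "w \<in> S" for w
        using qL[OF that] that by (simp add: S_def flip: norm_qexp_less_1_iff)
      have "L holomorphic_on S"
        unfolding L_def using nz by (intro holomorphic_intros) (auto simp: complex_nonpos_Reals_iff dest: Re)
      then have "(f \<circ> L) holomorphic_on S"
        by (rule holomorphic_on_compose_gen[OF _ hol]) (use ImL in auto)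
      moreover have "open S" by (auto simp: S_def)
      moreover have "w0 \<in> S" using w0 by (auto simp: S_def)
      moreover have "(f \<circ> L) w = G w" if "w \<in> S" for w
        using G[OF ImL[OF that]] qL[OF that] by simp
      ultimately show ?thesis
        by (metis holomorphic_on_imp_differentiable_at holomorphic_transform)
    qed
    then show ?thesis by (auto simp: holomorphic_on_def field_differentiable_at_within)
  qed
  moreover have "(G \<longlongrightarrow> G w) (at w within ball 0 1)" if "w \<in> {0}" for w
  proof -
    have "(G \<longlongrightarrow> 0) (at 0)"
    proof (rule LIM_I)
      fix e :: real assume "e > 0"
      from lim[OF this] obtain Y where Y: "\<And>z. Im z \<ge> Y \<Longrightarrow> Im z > 0 \<Longrightarrow> norm (f z) < e" by blast
      show "\<exists>\<delta>>0. \<forall>w. w \<noteq> 0 \<and> norm (w - 0) < \<delta> \<longrightarrow> norm (G w - 0) < e"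
      proof (intro exI[of _ "exp (- 2 * pi * max Y 0)"] conjI allI impI)
        fix w :: complex assume w: "w \<noteq> 0 \<and> norm (w - 0) < exp (- 2 * pi * max Y 0)"
        then obtain z where z: "qexp z = w" using qexp_surj by blast
        then have "- 2 * pi * Im z < - 2 * pi * max Y 0" using w norm_qexp[of z] by simp
        then have "max Y 0 < Im z" by simp
        then have "Im z \<ge> Y" "Im z > 0" by auto
        then show "norm (G w - 0) < e" using Y G z by auto
      qed simp
    qed
    then show ?thesis using that by (auto simp: G_def intro: tendsto_within_subset)
  qed
  ultimately have "G holomorphic_on ball 0 1" by (rule_tac no_isolated_singularity') auto
  then obtain c where c: "unit_series c" "\<And>x. norm x < 1 \<Longrightarrow> pseries c x = G x" by (rule unit_series_of_holomorphic) (rule that)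
  have "pseries c 0 = c 0" by (simp add: pseries_def)
  then have "c 0 = 0" using c(2)[of 0] by (simp add: G_def)
  moreover have "f z = qseries c z" if "Im z > 0" for z
    using c(2)[of "qexp z"] G[OF that] that by (simp add: qseries_def norm_qexp_less_1_iff)
  ultimately show ?thesis by (rule that[OF c(1)])
qed

lemma qseries_exp_decay:
  assumes c: "unit_series c" "c 0 = 0"
  obtains B where "B > 0" "\<And>z. Im z \<ge> 1 \<Longrightarrow> norm (qseries c z) \<le> B * exp (- 2 * pi * Im z)"
proof -
  have r: "exp (- 2 * pi) < (1::real)" by simp
  obtain B where B: "B > 0" "\<And>x. norm x \<le> exp (- 2 * pi) \<Longrightarrow> norm (pseries (\<lambda>n. c (n + 1)) x) \<le> B"
    by (rule pseries_bounded[OF unit_series_shift[OF c(1), of 1] r]) (rule that)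
  show ?thesis
  proof (rule that[OF B(1)])
    fix z assume z: "Im z \<ge> 1"
    have x: "norm (qexp z) \<le> exp (- 2 * pi)" "norm (qexp z) < 1" using z by (auto simp: norm_qexp norm_qexp_less_1_iff)
    have "qseries c z = qexp z * pseries (\<lambda>n. c (n + 1)) (qexp z)"
      unfolding qseries_def using pseries_shift[OF c(1), of 1 "qexp z"] c(2) x by simp
    also have "norm \<dots> \<le> norm (qexp z) * B" unfolding norm_mult by (intro mult_left_mono B(2) x) auto
    finally show "norm (qseries c z) \<le> B * exp (- 2 * pi * Im z)" by (simp add: norm_qexp mult.commute)
  qed
qed

section \<open>The lift at the cusps\<close>

context plus_eigenform
begin

definition slash :: "int \<Rightarrow> int \<Rightarrow> int \<Rightarrow> int \<Rightarrow> complex \<Rightarrow> complex" where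
  "slash p q r s z = F (moebius p q r s z) / (of_int r * z + of_int s) ^ (2 * k)"

lemma F_holomorphic: "F holomorphic_on {z. Im z > 0}"
  using qseries_holomorphic[OF F_qseries(1)] by (rule holomorphic_transform) (simp add: F_qseries(2))

lemma slash_holomorphic:
  assumes g: "p * s - q * r = 1"
  shows "slash p q r s holomorphic_on {z. Im z > 0}"
proof -
  have nz: "of_int r * z + of_int s \<noteq> (0::complex)" if "Im z > 0" for z
    by (rule moebius_denom_nonzero[OF that]) (use g in auto)
  have "moebius p q r s holomorphic_on {z. Im z > 0}"
    unfolding moebius_def using nz by (intro holomorphic_intros) auto
  moreover have "moebius p q r s ` {z. Im z > 0} \<subseteq> {z. Im z > 0}"
    using g by (auto intro!: Im_moebius_pos)
  ultimately have "(F \<circ> moebius p q r s) holomorphic_on {z. Im z > 0}"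
    by (rule holomorphic_on_compose_gen[OF _ F_holomorphic])
  then have "(\<lambda>z. F (moebius p q r s z)) holomorphic_on {z. Im z > 0}" by (simp add: o_def)
  then have "(\<lambda>z. F (moebius p q r s z) / (of_int r * z + of_int s) ^ (2 * k)) holomorphic_on {z. Im z > 0}"
    using nz by (intro holomorphic_on_divide holomorphic_on_power holomorphic_intros) auto
  then show ?thesis by (simp add: slash_def[abs_def])
qed

lemma slash_periodic:
  assumes g: "p * s - q * r = 1" and z: "Im z > 0"
  shows "slash p q r s (z + of_int level) = slash p q r s z"
proof -
  let ?w = "moebius p q r s z"
  have w: "Im ?w > 0" using z g by (intro Im_moebius_pos) auto
  have nz: "of_int r * z + of_int s \<noteq> (0::complex)"
    by (rule moebius_denom_nonzero[OF z]) (use g in auto)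
  \<comment> \<open>This is the conjugate of the translation by \<open>level\<close> under the given
    matrix. It is the identity modulo \<open>level\<close>, so \<open>F_law\<close> applies.\<close>
  let ?p = "1 - level * p * r" and ?q = "level * p\<^sup>2" and ?r = "- (level * r\<^sup>2)" and ?s = "1 + level * r * p"
  have det: "?p * ?s - ?q * ?r = 1" by (simp add: algebra_simps power2_eq_square)
  have m: "moebius p q r s (z + of_int level) = moebius ?p ?q ?r ?s ?w"
  proof -
    have "moebius ?p ?q ?r ?s ?w = moebius (?p * p + ?q * r) (?p * q + ?q * s) (?r * p + ?s * r) (?r * q + ?s * s) z"
      using moebius_compose[OF z, of p s q r] g by simp
    also have "?p * p + ?q * r = p" by (simp add: algebra_simps power2_eq_square)
    also have "?p * q + ?q * s = q + level * p"
    proof -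
      have "?p * q + ?q * s = q + level * p * (p * s - q * r)" by (simp add: algebra_simps power2_eq_square)
      then show ?thesis using g by simp
    qed
    also have "?r * p + ?s * r = r" by (simp add: algebra_simps power2_eq_square)
    also have "?r * q + ?s * s = s + level * r"
    proof -
      have "?r * q + ?s * s = s + level * r * (p * s - q * r)" by (simp add: algebra_simps power2_eq_square)
      then show ?thesis using g by simp
    qed
    finally show ?thesis using moebius_translate[of p q level r s z] by simp
  qed
  have j: "(of_int ?r * ?w + of_int ?s) * (of_int r * z + of_int s) = of_int r * (z + of_int level) + (of_int s :: complex)"
  proof -
    have "(of_int ?r * ?w + of_int ?s) * (of_int r * z + of_int s) =
      of_int ?r * (of_int p * z + of_int q) + of_int ?s * (of_int r * z + of_int s)"
      using nz by (simp add: moebius_def field_simps)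
    also have "\<dots> = of_int r * z + of_int s + of_int (level * r * (p * s - q * r))"
      by (simp add: algebra_simps power2_eq_square)
    finally show ?thesis using g by (simp add: algebra_simps)
  qed
  have nz': "of_int ?r * ?w + of_int ?s \<noteq> (0::complex)"
  proof (rule moebius_denom_nonzero[OF w det_imp_row_nonzero[of ?p ?s ?q]])
    show "?p * ?s - ?q * ?r \<noteq> 0" unfolding det by simp
  qed
  have "F (moebius ?p ?q ?r ?s ?w) = (of_int ?r * ?w + of_int ?s) ^ (2 * k) * F ?w"
    by (rule F_law[OF det _ _ _ w]) (auto simp: level_def)
  then show ?thesis unfolding slash_def m j[symmetric] power_mult_distrib using nz' by simp
qed

text \<open>
  This is where \<open>k \<ge> 2\<close> enters: the growth of \<open>F\<close> bounds its transforms by a multiple of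
  \<open>Im z powr (3/2 - k)\<close>.
\<close>

lemma slash_tendsto_0:
  assumes k: "k \<ge> 2" and g: "p * s - q * r = 1" and \<epsilon>: "\<epsilon> > 0"
  shows "\<exists>Y. \<forall>z. Im z \<ge> Y \<longrightarrow> Im z > 0 \<longrightarrow> norm (slash p q r s (of_int level * z)) < \<epsilon>"
proof -
  obtain K where K: "K > 0" "\<And>z. Im z > 0 \<Longrightarrow> norm (F z) \<le> K * Im z powr - (real k + 3/2)"
    by (rule F_growth) (rule that)
  let ?N = "real_of_int level"
  define D where "D = \<bar>of_int r\<bar> * (?N + 1) + \<bar>of_int s :: real\<bar>"
  have N: "?N \<ge> 1" using level_pos by simp
  have D: "D \<ge> 0" using N by (simp add: D_def)
  \<comment> \<open>In a strip of bounded real part the denominator is at most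
    \<open>D * Im z\<close>, and after cancellation only its third power survives.\<close>
  have bound: "norm (slash p q r s z) \<le> K * D ^ 3 * Im z powr - (1/2)" if z: "Im z \<ge> 1" "\<bar>Re z\<bar> \<le> ?N" for z
  proof -
    let ?y = "Im z" and ?j = "norm (of_int r * z + of_int s :: complex)"
    have y: "?y > 0" using z by simp
    have nz: "of_int r * z + of_int s \<noteq> (0::complex)"
      by (rule moebius_denom_nonzero[OF y]) (use g in auto)
    then have j: "?j > 0" by simp
    have "?j \<le> \<bar>of_int r\<bar> * norm z + \<bar>of_int s\<bar>"
      using norm_triangle_ineq[of "of_int r * z" "of_int s"] by (simp add: norm_mult)
    also have "norm z \<le> ?N + ?y" using cmod_le[of z] z y by linarith
    also have "?N + ?y \<le> ?N * ?y + ?y" using N z mult_left_mono[of 1 ?y ?N] by simp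
    finally have "?j \<le> \<bar>of_int r\<bar> * (?N * ?y + ?y) + \<bar>of_int s\<bar>" by (simp add: mult_left_mono)
    also have "\<bar>of_int s :: real\<bar> \<le> \<bar>of_int s\<bar> * ?y" using z mult_left_mono[of 1 ?y "\<bar>of_int s\<bar>"] by simp
    finally have jD: "?j \<le> D * ?y" by (simp add: D_def algebra_simps)
    have Im: "Im (moebius p q r s z) = ?y / ?j\<^sup>2" using Im_moebius[OF y, of p s q r] g by simp
    have "norm (slash p q r s z) = norm (F (moebius p q r s z)) / ?j ^ (2 * k)"
      by (simp add: slash_def norm_divide norm_power)
    also have "\<dots> \<le> K * (?y / ?j\<^sup>2) powr - (real k + 3/2) / ?j ^ (2 * k)"
      using K(2)[of "moebius p q r s z"] Im y j by (intro divide_right_mono) auto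
    also have "(?y / ?j\<^sup>2) powr - (real k + 3/2) = ?y powr - (real k + 3/2) * ?j ^ (2 * k + 3)"
    proof -
      have "(?j\<^sup>2) powr (real k + 3/2) = (?j powr 2) powr (real k + 3/2)" using j by simp
      also have "\<dots> = ?j powr real (2 * k + 3)" unfolding powr_powr by (simp add: algebra_simps)
      also have "\<dots> = ?j ^ (2 * k + 3)" using j by (rule powr_realpow)
      finally have "(?j\<^sup>2) powr - (real k + 3/2) = 1 / ?j ^ (2 * k + 3)" unfolding powr_minus_divide by simp
      then show ?thesis using y j by (simp add: powr_divide)
    qed
    also have "K * (?y powr - (real k + 3/2) * ?j ^ (2 * k + 3)) / ?j ^ (2 * k) = K * ?y powr - (real k + 3/2) * ?j ^ 3"
      using j by (simp add: power_add)
    also have "\<dots> \<le> K * ?y powr - (real k + 3/2) * (D * ?y) ^ 3"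
      using jD j K(1) by (intro mult_left_mono power_mono) auto
    also have "\<dots> = K * D ^ 3 * (?y powr - (real k + 3/2) * ?y powr 3)" using y by (simp add: power_mult_distrib)
    also have "?y powr - (real k + 3/2) * ?y powr 3 \<le> ?y powr - (1/2)"
      unfolding powr_add[symmetric] using z k by (intro powr_mono) auto
    finally show ?thesis using K(1) D by (simp add: mult_left_mono)
  qed
  define E where "E = K * D ^ 3"
  have E: "E \<ge> 0" using K D by (simp add: E_def)
  show ?thesis
  proof (intro exI[of _ "(E / \<epsilon> + 1)\<^sup>2"] allI impI)
    fix z assume z: "Im z \<ge> (E / \<epsilon> + 1)\<^sup>2" "Im z > 0"
    define u where "u = of_int level * (z + of_int (- \<lfloor>Re z\<rfloor>))"
    have "(E / \<epsilon> + 1)\<^sup>2 \<ge> 1\<^sup>2" using E \<epsilon> by (intro power_mono) auto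
    then have "Im z \<ge> 1" using z by simp
    have "?N * Im z \<ge> Im z" using N z(2) mult_right_mono[of 1 ?N "Im z"] by simp
    then have Imu: "Im u \<ge> Im z" by (simp add: u_def)
    have "0 \<le> Re z - of_int \<lfloor>Re z\<rfloor>" "Re z - of_int \<lfloor>Re z\<rfloor> \<le> 1" by linarith+
    then have "\<bar>?N * (Re z - of_int \<lfloor>Re z\<rfloor>)\<bar> \<le> ?N" using N by (simp add: abs_mult mult_left_le)
    then have Reu: "\<bar>Re u\<bar> \<le> ?N" by (simp add: u_def)
    have per: "slash p q r s (of_int level * z) = slash p q r s u"
      unfolding u_def
      by (rule periodic_add_of_int[of "\<lambda>z. slash p q r s (of_int level * z)", symmetric])
        (use slash_periodic[OF g] level_pos z(2) in \<open>auto simp: distrib_left\<close>)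
    have "sqrt (Im u) \<ge> E / \<epsilon> + 1" using z(1) Imu by (intro real_le_rsqrt) linarith
    then have sq: "sqrt (Im u) > E / \<epsilon>" "sqrt (Im u) > 0" using Imu z(2) by auto
    have "norm (slash p q r s u) \<le> E * Im u powr - (1/2)"
      unfolding E_def using Imu \<open>Im z \<ge> 1\<close> Reu by (intro bound) auto
    also have "\<dots> = E / sqrt (Im u)"
      unfolding powr_minus_divide using Imu \<open>Im z \<ge> 1\<close> by (simp add: powr_half_sqrt)
    also have "\<dots> < \<epsilon>" using sq \<epsilon> by (simp add: field_simps)
    finally show "norm (slash p q r s (of_int level * z)) < \<epsilon>" unfolding per .
  qed
qed

section \<open>The invariant height of the lift and its maximum\<close>

definition height :: "complex \<Rightarrow> real" where
  "height z = norm (F z) * Im z ^ k"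

lemma height_slash:
  assumes g: "p * s - q * r = 1" and z: "Im z > 0"
  shows "height (moebius p q r s z) = norm (slash p q r s z) * Im z ^ k"
proof -
  have "Im (moebius p q r s z) = Im z / (norm (of_int r * z + of_int s))\<^sup>2"
    using Im_moebius[OF z, of p s q r] g by simp
  then show ?thesis
    by (simp add: height_def slash_def norm_divide norm_power power_divide flip: power_mult)
qed

text \<open>The Fourier expansion turns mere convergence to 0 at a cusp into exponential decay,
  which outweighs \<open>Im z ^ k\<close>.\<close>

lemma height_decay:
  assumes k: "k \<ge> 2" and g: "p * s - q * r = 1" and \<epsilon>: "\<epsilon> > 0"
  shows "\<exists>Y. \<forall>z. Im z \<ge> Y \<longrightarrow> Im z > 0 \<longrightarrow> height (moebius p q r s z) < \<epsilon>"
proof -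
  let ?N = "real_of_int level" and ?f = "\<lambda>z. slash p q r s (of_int level * z)"
  have N: "?N \<ge> 1" using level_pos by simp
  have "?f holomorphic_on {z. Im z > 0}"
  proof -
    have "(slash p q r s \<circ> (\<lambda>z. of_int level * z)) holomorphic_on {z. Im z > 0}"
      by (rule holomorphic_on_compose_gen[OF _ slash_holomorphic[OF g]]) (use N in \<open>auto intro!: holomorphic_intros\<close>)
    then show ?thesis by (simp add: o_def)
  qed
  moreover have "?f (z + 1) = ?f z" if "Im z > 0" for z
    using slash_periodic[OF g, of "of_int level * z"] N that by (simp add: distrib_left)
  ultimately obtain c where c: "unit_series c" "c 0 = 0" "\<And>z. Im z > 0 \<Longrightarrow> ?f z = qseries c z"
    by (rule periodic_imp_qseries[OF _ _ slash_tendsto_0[OF k g]]) (assumption | rule that)+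
  obtain B where B: "B > 0" "\<And>z. Im z \<ge> 1 \<Longrightarrow> norm (qseries c z) \<le> B * exp (- 2 * pi * Im z)"
    by (rule qseries_exp_decay[OF c(1,2)]) (rule that)
  have "((\<lambda>y. B * exp (- 2 * pi * (y / ?N)) * y ^ k) \<longlongrightarrow> 0) at_top"
    using N by real_asymp
  then have "eventually (\<lambda>y. B * exp (- 2 * pi * (y / ?N)) * y ^ k < \<epsilon>) at_top"
    by (rule order_tendstoD) (rule \<epsilon>)
  then obtain Y where Y: "\<And>y. y \<ge> Y \<Longrightarrow> B * exp (- 2 * pi * (y / ?N)) * y ^ k < \<epsilon>"
    by (auto simp: eventually_at_top_linorder)
  show ?thesis
  proof (intro exI[of _ "max Y ?N"] allI impI)
    fix z assume z: "Im z \<ge> max Y ?N" "Im z > 0"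
    have "Im (z / of_int level) \<ge> 1" using z N by (simp add: field_simps)
    then have "norm (?f (z / of_int level)) \<le> B * exp (- 2 * pi * Im (z / of_int level))"
      unfolding c(3)[OF less_le_trans[OF zero_less_one \<open>Im (z / of_int level) \<ge> 1\<close>]] by (rule B(2))
    then have "norm (slash p q r s z) \<le> B * exp (- 2 * pi * (Im z / ?N))" using level_pos by simp
    then have "height (moebius p q r s z) \<le> B * exp (- 2 * pi * (Im z / ?N)) * Im z ^ k"
      unfolding height_slash[OF g z(2)] using z(2) by (intro mult_right_mono) auto
    also have "\<dots> < \<epsilon>" using z(1) by (intro Y) auto
    finally show "height (moebius p q r s z) < \<epsilon>" .
  qed
qed


lemma height_invariant:
  assumes g: "p * s - q * r = 1" "level dvd r" "level dvd p - 1" "even q" and z: "Im z > 0"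
  shows "height (moebius p q r s z) = height z"
proof -
  have nz: "of_int r * z + of_int s \<noteq> (0::complex)"
    by (rule moebius_denom_nonzero[OF z]) (use g in auto)
  then show ?thesis
    unfolding height_slash[OF g(1) z] slash_def F_law[OF g z] by (simp add: height_def)
qed

text \<open>The first matrix times the inverse of the second is the identity modulo
  \<open>level\<close>, and such a matrix preserves the height. So the height has only finitely many
  transforms.\<close>

lemma height_moebius_cong:
  assumes g: "p * s - q * r = 1" and g': "p' * s' - q' * r' = 1"
    and c: "level dvd p' - p" "level dvd q' - q" "level dvd r' - r" "level dvd s' - s"
    and z: "Im z > 0"
  shows "height (moebius p' q' r' s' z) = height (moebius p q r s z)"
proof -
  let ?w = "moebius p q r s z"
  have w: "Im ?w > 0" using z g by (intro Im_moebius_pos) auto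
  let ?P = "p' * s - q' * r" and ?Q = "q' * p - p' * q" and ?R = "r' * s - s' * r" and ?S = "s' * p - r' * q"
  have det: "?P * ?S - ?Q * ?R = 1"
  proof -
    have "?P * ?S - ?Q * ?R = (p' * s' - q' * r') * (p * s - q * r)" by (simp add: algebra_simps)
    then show ?thesis using g g' by simp
  qed
  have "?P - 1 = (p' - p) * s - (q' - q) * r" using g by (simp add: algebra_simps)
  moreover have "?Q = (q' - q) * p - (p' - p) * q" "?R = (r' - r) * s - (s' - s) * r" by (simp_all add: algebra_simps)
  ultimately have lv: "level dvd ?P - 1" "level dvd ?Q" "level dvd ?R" using c by simp_all
  have "even level" by (simp add: level_def)
  then have "even ?Q" using lv(2) dvd_trans by blast
  have "moebius ?P ?Q ?R ?S ?w = moebius (?P * p + ?Q * r) (?P * q + ?Q * s) (?R * p + ?S * r) (?R * q + ?S * s) z"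
    using g by (intro moebius_compose z) simp
  also have "?P * p + ?Q * r = p' * (p * s - q * r)" by (simp add: algebra_simps)
  also have "?P * q + ?Q * s = q' * (p * s - q * r)" by (simp add: algebra_simps)
  also have "?R * p + ?S * r = r' * (p * s - q * r)" by (simp add: algebra_simps)
  also have "?R * q + ?S * s = s' * (p * s - q * r)" by (simp add: algebra_simps)
  finally have "moebius p' q' r' s' z = moebius ?P ?Q ?R ?S ?w" using g by simp
  then show ?thesis using height_invariant[OF det lv(3,1) \<open>even ?Q\<close> w] by simp
qed

lemma continuous_on_height: "continuous_on {z. Im z > 0} height"
  unfolding height_def[abs_def]
  by (intro continuous_intros holomorphic_on_imp_continuous_on F_holomorphic)

text \<open>In place of a fundamental domain, one rectangle \<open>K\<close> is combined with
  representatives of the classes of matrices modulo \<open>level\<close>. Above \<open>K\<close>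
  every transform is below the positive value \<open>m\<close>; on \<open>K\<close> the values form
  the compact set \<open>V\<close>, which contains \<open>m\<close>.\<close>

lemma height_attains_max:
  assumes k: "k \<ge> 2" and z1: "Im z1 > 0" "F z1 \<noteq> 0"
  obtains z0 where "Im z0 > 0" "height z0 > 0" "\<And>z. Im z > 0 \<Longrightarrow> height z \<le> height z0"
proof -
  define m where "m = height z1"
  have m: "m > 0" using z1 by (simp add: m_def height_def)
  define act where "act = (\<lambda>(p, q, r, s). moebius p q r s)"
  define T where "T = {(p, q, r, s). p * s - q * r = (1::int)}"
  define \<rho> where "\<rho> = (\<lambda>(p, q, r, s). (p mod level, q mod level, r mod level, s mod level))"
  have "\<rho> ` T \<subseteq> {0..<level} \<times> {0..<level} \<times> {0..<level} \<times> {0..<level}"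
    using level_pos by (auto simp: \<rho>_def)
  then have fin: "finite (\<rho> ` T)" by (rule finite_subset) auto
  define rep where "rep = inv_into T \<rho>"
  have rep: "rep \<tau> \<in> T" if "\<tau> \<in> \<rho> ` T" for \<tau>
    unfolding rep_def by (rule inv_into_into[OF that])
  have act_pos: "Im (act \<sigma> z) > 0" if "\<sigma> \<in> T" "Im z > 0" for \<sigma> z
    using that by (auto simp: act_def T_def intro!: Im_moebius_pos)
  have cong: "height (act \<sigma> z) = height (act (rep (\<rho> \<sigma>)) z)" if \<sigma>: "\<sigma> \<in> T" and z: "Im z > 0" for \<sigma> z
  proof -
    obtain p q r s where 1: "\<sigma> = (p, q, r, s)" by (cases \<sigma>)
    obtain p' q' r' s' where 2: "rep (\<rho> \<sigma>) = (p', q', r', s')" by (cases "rep (\<rho> \<sigma>)")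
    have "\<rho> (rep (\<rho> \<sigma>)) = \<rho> \<sigma>" unfolding rep_def by (rule f_inv_into_f) (use \<sigma> in auto)
    then have "p mod level = p' mod level" "q mod level = q' mod level" "r mod level = r' mod level" "s mod level = s' mod level"
      unfolding 1 2[unfolded 1] by (simp_all add: \<rho>_def)
    moreover have "p * s - q * r = 1" using \<sigma> by (simp add: T_def 1)
    moreover have "p' * s' - q' * r' = 1" using rep[of "\<rho> \<sigma>"] \<sigma> by (simp add: T_def 2)
    ultimately show ?thesis unfolding 2 unfolding 1 act_def prod.case
      by (intro height_moebius_cong z) (simp_all add: mod_eq_dvd_iff)
  qed
  have "\<forall>\<tau>\<in>\<rho> ` T. \<exists>Y. \<forall>z. Im z \<ge> Y \<longrightarrow> Im z > 0 \<longrightarrow> height (act (rep \<tau>) z) < m"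
  proof
    fix \<tau> assume "\<tau> \<in> \<rho> ` T"
    from rep[OF this] obtain p q r s where "rep \<tau> = (p, q, r, s)" "p * s - q * r = 1" by (auto simp: T_def)
    then show "\<exists>Y. \<forall>z. Im z \<ge> Y \<longrightarrow> Im z > 0 \<longrightarrow> height (act (rep \<tau>) z) < m"
      using height_decay[OF k _ m] by (simp add: act_def)
  qed
  from bchoice[OF this] obtain Y where
    Y: "\<forall>\<tau>\<in>\<rho> ` T. \<forall>z. Im z \<ge> Y \<tau> \<longrightarrow> Im z > 0 \<longrightarrow> height (act (rep \<tau>) z) < m" ..
  define Y0 where "Y0 = Max (Y ` \<rho> ` T)"
  have Y0: "Y \<tau> \<le> Y0" if "\<tau> \<in> \<rho> ` T" for \<tau>
    unfolding Y0_def using fin that by (intro Max_ge) auto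
  let ?N = "real_of_int level"
  define K where "K = cbox (Complex 0 (1/2)) (Complex ?N Y0)"
  have K_pos: "K \<subseteq> {z. Im z > 0}" by (auto simp: K_def in_cbox_complex_iff)
  define V where "V = (\<Union>\<tau>\<in>\<rho> ` T. (\<lambda>z. height (act (rep \<tau>) z)) ` K)"
  have "compact ((\<lambda>z. height (act (rep \<tau>) z)) ` K)" if \<tau>: "\<tau> \<in> \<rho> ` T" for \<tau>
  proof (rule compact_continuous_image)
    obtain p q r s where pq: "rep \<tau> = (p, q, r, s)" "p * s - q * r = 1" using rep[OF \<tau>] by (auto simp: T_def)
    have "continuous_on K (moebius p q r s)"
      unfolding moebius_def using K_pos pq(2)
      by (intro continuous_intros ballI moebius_denom_nonzero) auto
    then have "continuous_on K (act (rep \<tau>))" by (simp add: pq act_def)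
    moreover have "act (rep \<tau>) ` K \<subseteq> {z. Im z > 0}" using act_pos[OF rep[OF \<tau>]] K_pos by auto
    ultimately show "continuous_on K (\<lambda>z. height (act (rep \<tau>) z))"
      by (rule continuous_on_compose2[OF continuous_on_height])
    show "compact K" unfolding K_def by (rule compact_cbox)
  qed
  then have "compact V" unfolding V_def using fin by (intro compact_UN) auto
  have key: "height z < m \<or> height z \<in> V" if z: "Im z > 0" for z
  proof -
    obtain p q r s w' where w': "p * s - q * r = 1" "Im w' \<ge> 1/2" "z = moebius p q r s w'"
      by (rule reduce_to_Im_ge_half[OF z])
    define n where "n = \<lfloor>Re w' / ?N\<rfloor>"
    define w where "w = w' - of_int (n * level)"
    define \<sigma> where "\<sigma> = (p, q + (n * level) * p, r, s + (n * level) * r)"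
    have \<sigma>: "\<sigma> \<in> T" using w'(1) by (simp add: \<sigma>_def T_def algebra_simps)
    have z\<sigma>: "z = act \<sigma> w" by (simp add: act_def \<sigma>_def w_def moebius_translate w'(3))
    have N: "?N > 0" using level_pos by simp
    have Re: "0 \<le> Re w" "Re w \<le> ?N"
    proof -
      have "of_int n \<le> Re w' / ?N" "Re w' / ?N \<le> of_int n + 1" unfolding n_def by linarith+
      then show "0 \<le> Re w" "Re w \<le> ?N" using N by (simp_all add: w_def field_simps)
    qed
    have Im: "Im w \<ge> 1/2" using w'(2) by (simp add: w_def)
    then have eq: "height z = height (act (rep (\<rho> \<sigma>)) w)" unfolding z\<sigma> by (intro cong \<sigma>) simp
    show ?thesis
    proof (cases "Im w \<le> Y0")
      case True
      then have "w \<in> K" using Re Im by (simp add: K_def in_cbox_complex_iff)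
      then show ?thesis unfolding eq V_def using \<sigma> by blast
    next
      case False
      then show ?thesis unfolding eq using Y Y0[of "\<rho> \<sigma>"] \<sigma> Im by auto
    qed
  qed
  then have mV: "m \<in> V" using z1(1) unfolding m_def by blast
  then obtain v where v: "v \<in> V" "\<And>u. u \<in> V \<Longrightarrow> u \<le> v"
    using compact_attains_sup[OF \<open>compact V\<close>] by blast
  obtain \<tau> w where \<tau>: "\<tau> \<in> \<rho> ` T" "w \<in> K" "v = height (act (rep \<tau>) w)" using v(1) unfolding V_def by blast
  show ?thesis
  proof (rule that)
    show "Im (act (rep \<tau>) w) > 0" using \<tau> K_pos by (intro act_pos rep) auto
    show "height (act (rep \<tau>) w) > 0" using v(2)[OF mV] m \<tau>(3) by simp
    show "height z \<le> height (act (rep \<tau>) w)" if "Im z > 0" for z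
      using key[OF that] v(2)[OF mV] v(2) \<tau>(3) by auto
  qed
qed

lemma k_less_2: "k < 2"
proof (rule ccontr)
  assume "\<not> k < 2"
  then have k: "k \<ge> 2" by simp
  have "\<exists>z. Im z > 0 \<and> F z \<noteq> 0"
  proof (rule ccontr)
    assume *: "\<not> ?thesis"
    have "lambert_coeff square_coeff = (\<lambda>_. 0)"
    proof (rule qseries_unique[OF F_qseries(1) unit_series_0])
      show "qseries (lambert_coeff square_coeff) z = qseries (\<lambda>_. 0) z" if "Im z > 0" for z
        using * that F_qseries(2)[OF that] by (simp add: qseries_def pseries_def)
    qed
    then show False using lambert_coeff_square_1 by simp
  qed
  then obtain z1 where z1: "Im z1 > 0" "F z1 \<noteq> 0" by blast
  obtain z0 where z0: "Im z0 > 0" "height z0 > 0" "\<And>z. Im z > 0 \<Longrightarrow> height z \<le> height z0"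
    by (rule height_attains_max[OF k z1]) (assumption | rule that)+
  define m where "m = height z0"
  have per: "height (z + of_int n) = height z" for z n by (simp add: height_def F_def qexp_add)
  \<comment> \<open>Since \<open>norm l = 2 ^ k\<close>, the relation \<open>F_double\<close> bounds
    the height at \<open>z\<close> by the mean of the heights at \<open>z / 2\<close> and
    \<open>(z + 1) / 2\<close>. At a maximum both must be maximal.\<close>
  have half: "height (z / 2) = m" if z: "Im z > 0" "height z = m" for z
  proof -
    have h: "norm (F u) * Im z ^ k = 2 ^ k * height u" if "Im u = Im z / 2" for u
    proof -
      have "Im z = 2 * Im u" using that by simp
      then show ?thesis by (simp add: height_def power_mult_distrib)
    qed
    have "norm (2 * l * F z) \<le> norm (F (z / 2)) + norm (F ((z + 1) / 2))"
      unfolding F_double[OF z(1), symmetric] by (rule norm_triangle_ineq)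
    then have "2 * 2 ^ k * norm (F z) \<le> norm (F (z / 2)) + norm (F ((z + 1) / 2))"
      by (simp add: norm_mult norm_l)
    then have "(2 * 2 ^ k * norm (F z)) * Im z ^ k \<le> (norm (F (z / 2)) + norm (F ((z + 1) / 2))) * Im z ^ k"
      using z by (intro mult_right_mono) auto
    then have "2 * 2 ^ k * height z \<le> 2 ^ k * height (z / 2) + 2 ^ k * height ((z + 1) / 2)"
      using h[of "z / 2"] h[of "(z + 1) / 2"] by (simp add: height_def[of z] distrib_right mult.assoc)
    then have "2 ^ k * (2 * height z) \<le> 2 ^ k * (height (z / 2) + height ((z + 1) / 2))"
      by (simp add: distrib_left mult_ac)
    then have "2 * height z \<le> height (z / 2) + height ((z + 1) / 2)" by simp
    moreover have "height (z / 2) \<le> m" "height ((z + 1) / 2) \<le> m" unfolding m_def using z by (auto intro!: z0(3))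
    ultimately show ?thesis using z(2) by linarith
  qed
  have max: "height ((z0 + of_int b) / 2 ^ n) = m" for n b
  proof (induction n)
    case 0 show ?case using per[of z0 b] by (simp add: m_def)
  next
    case (Suc n)
    have "(z0 + of_int b) / 2 ^ n = (z0 + of_int b) / of_real (2 ^ n)" by simp
    then have "Im ((z0 + of_int b) / 2 ^ n) > 0" using z0(1) by (simp only: Im_divide_of_real) simp
    from half[OF this Suc] show ?case by (simp add: mult.commute)
  qed
  obtain Y where Y: "\<And>z. Im z \<ge> Y \<Longrightarrow> Im z > 0 \<Longrightarrow> height z < m"
    using height_decay[OF k, of 1 1 0 0 m] z0(2) by (auto simp: m_def)
  let ?N = "real_of_int level" and ?y = "Im z0"
  define E where "E = ?N\<^sup>2 * (1 + ?y\<^sup>2)"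
  have E: "E > 0" using level_pos by (simp add: E_def add_pos_nonneg)
  obtain n :: nat where n: "Y * E / ?y < 2 ^ n" using real_arch_pow[of 2 "Y * E / ?y"] by auto
  \<comment> \<open>The real part of \<open>w\<close> is placed within \<open>1 / 2 ^ n\<close> of
    the cusp \<open>- 1 / level\<close>, which the matrix with lower row \<open>(level, 1)\<close>
    sends to infinity; the image of \<open>w\<close> then has height at least
    \<open>?y * 2 ^ n / E\<close>.\<close>
  define b where "b = - \<lfloor>Re z0 + 2 ^ n / ?N\<rfloor>"
  define w where "w = (z0 + of_int b) / 2 ^ n"
  have w: "Re w = (Re z0 + of_int b) / 2 ^ n" "Im w = ?y / 2 ^ n"
  proof -
    have "w = (z0 + of_int b) / of_real (2 ^ n)" by (simp add: w_def)
    then show "Re w = (Re z0 + of_int b) / 2 ^ n" "Im w = ?y / 2 ^ n"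
      by (simp_all only: Re_divide_of_real Im_divide_of_real) simp_all
  qed
  have w_pos: "Im w > 0" using w z0 by simp
  let ?j = "norm (of_int level * w + of_int 1 :: complex)"
  have "?j\<^sup>2 = ?N\<^sup>2 * ((Re w + 1 / ?N)\<^sup>2 + (Im w)\<^sup>2)"
  proof -
    have "?j\<^sup>2 = (?N * Re w + 1)\<^sup>2 + (?N * Im w)\<^sup>2" by (simp add: cmod_power2)
    also have "?N * Re w + 1 = ?N * (Re w + 1 / ?N)" using level_pos by (simp add: distrib_left)
    finally show ?thesis by (simp only: power_mult_distrib distrib_left[of "?N\<^sup>2"])
  qed
  also have "Re w + 1 / ?N = (Re z0 + of_int b + 2 ^ n / ?N) / 2 ^ n" by (simp add: w add_divide_distrib)
  also have "?N\<^sup>2 * (((Re z0 + of_int b + 2 ^ n / ?N) / 2 ^ n)\<^sup>2 + (Im w)\<^sup>2) =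
      ?N\<^sup>2 * ((Re z0 + of_int b + 2 ^ n / ?N)\<^sup>2 + ?y\<^sup>2) / (2 ^ n)\<^sup>2"
    unfolding w power_divide by (simp only: add_divide_distrib[symmetric] times_divide_eq_right)
  also have "\<dots> \<le> E / (2 ^ n)\<^sup>2"
  proof -
    have "0 \<le> Re z0 + of_int b + 2 ^ n / ?N" "Re z0 + of_int b + 2 ^ n / ?N \<le> 1" unfolding b_def by linarith+
    then have "(Re z0 + of_int b + 2 ^ n / ?N)\<^sup>2 \<le> 1" by (simp add: power_le_one)
    then show ?thesis unfolding E_def by (intro divide_right_mono mult_left_mono) auto
  qed
  finally have j: "?j\<^sup>2 \<le> E / (2 ^ n)\<^sup>2" .
  have "of_int level * w + of_int 1 \<noteq> (0::complex)" by (rule moebius_denom_nonzero[OF w_pos]) simp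
  then have j0: "?j\<^sup>2 > 0" by simp
  have ht: "height (moebius 1 0 level 1 w) = m"
    using height_invariant[of 1 1 0 level w] w_pos max[of b n] by (simp add: w_def)
  have Im: "Im (moebius 1 0 level 1 w) = Im w / ?j\<^sup>2" using Im_moebius[OF w_pos, of 1 1 0 level] by simp
  have "Y \<le> ?y * 2 ^ n / E" using n E z0(1) by (simp add: field_simps)
  also have "\<dots> = Im w / (E / (2 ^ n)\<^sup>2)" using E by (simp add: w power2_eq_square)
  also have "\<dots> \<le> Im w / ?j\<^sup>2" using j j0 w_pos by (intro divide_left_mono) (auto simp: E)
  finally have "Im (moebius 1 0 level 1 w) \<ge> Y" unfolding Im .
  moreover have "Im (moebius 1 0 level 1 w) > 0" unfolding Im using w_pos j0 by (intro divide_pos_pos)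
  ultimately show False using Y ht by fastforce
qed

end

section \<open>Plus forms\<close>

lemma csqrt_upper_half_plane:
  assumes "Im z > 0" shows "Re (csqrt z) > 0" "Im (csqrt z) > 0"
proof -
  define w where "w = csqrt z"
  have "w\<^sup>2 = z" by (simp add: w_def)
  then have "Im (w\<^sup>2) > 0" using assms by simp
  then have p: "Re w * Im w > 0" by (simp add: power2_eq_square mult.commute)
  moreover have "0 < Re w \<or> Re w = 0 \<and> 0 \<le> Im w" unfolding w_def by (rule csqrt_principal)
  ultimately have "Re w > 0" by auto
  then have "Re w > 0" "Im w > 0" using p by (auto simp: zero_less_mult_iff)
  then show "Re (csqrt z) > 0" "Im (csqrt z) > 0" by (simp_all only: w_def)
qed

text \<open>\<open>csqrt z\<close> lies in the open first quadrant and \<open>u\<close> in the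
  closed fourth one, so the product has positive real part and is the principal root.\<close>

lemma csqrt_eq_mult_csqrt:
  assumes z: "Im z > 0" and u: "u\<^sup>2 * z = y" "Re u \<ge> 0" "Im u \<le> 0" "u \<noteq> 0"
  shows "csqrt y = u * csqrt z"
proof -
  define w where "w = csqrt z"
  have w: "w\<^sup>2 = z" "Re w > 0" "Im w > 0" using csqrt_upper_half_plane[OF z] by (simp_all only: w_def power2_csqrt)
  have "Re (u * w) > 0"
  proof (cases "Re u = 0")
    case True
    then have "Im u \<noteq> 0" using u(4) by (simp add: complex_eq_iff)
    with True show ?thesis using u w by (simp add: mult_neg_pos)
  next
    case False
    then have "Re u * Re w > 0" using u w by simp
    moreover have "Im u * Im w \<le> 0" using u w by (simp add: mult_nonpos_nonneg)
    ultimately show ?thesis by simp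
  qed
  then have "csqrt y = u * w" using u(1) w(1) by (intro csqrt_unique) (auto simp: power_mult_distrib)
  then show ?thesis by (simp only: w_def)
qed

lemma csqrt_minus_upper_half_plane: "Im z > 0 \<Longrightarrow> csqrt (- z) = - \<i> * csqrt z"
  by (rule csqrt_eq_mult_csqrt) simp_all

lemma csqrt_minus_2i_mult: "Im z > 0 \<Longrightarrow> csqrt (- 2 * \<i> * z) = (1 - \<i>) * csqrt z"
  by (rule csqrt_eq_mult_csqrt) (simp_all add: power2_eq_square algebra_simps complex_eq_iff)

lemma csqrt_minus_divide:
  assumes z: "Im z > 0" and r: "r > 0"
  shows "csqrt (- of_real (r\<^sup>2) / z) = of_real r * \<i> / csqrt z"
proof -
  define w where "w = csqrt z"
  have w: "w\<^sup>2 = z" "Re w > 0" "Im w > 0" using csqrt_upper_half_plane[OF z] by (simp_all only: w_def power2_csqrt)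
  have "(of_real r * \<i> / w)\<^sup>2 = - of_real (r\<^sup>2) / z"
    by (simp add: power_divide power_mult_distrib w(1))
  moreover have "Re (of_real r * \<i> / w) > 0"
  proof -
    have "w \<noteq> 0" using w by auto
    then have "r * (Im w / (norm w)\<^sup>2) > 0" using r w by (intro mult_pos_pos divide_pos_pos) auto
    also have "r * (Im w / (norm w)\<^sup>2) = Re (of_real r * \<i> / w)" by (simp add: Re_divide')
    finally show ?thesis .
  qed
  ultimately have "csqrt (- of_real (r\<^sup>2) / z) = of_real r * \<i> / w" by (intro csqrt_unique) auto
  then show ?thesis by (simp only: w_def)
qed

lemma unit_series_subseq:
  assumes a: "unit_series a" and d: "d > 0"
  shows "unit_series (\<lambda>n. a (d * n))"
proof (rule unit_seriesI_of_upper_half_plane)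
  fix z :: complex assume z: "Im z > 0"
  define x where "x = qexp (z / of_nat d)"
  have xd: "x ^ d = qexp z" using qexp_of_nat_mult[of d "z / of_nat d"] d by (simp add: x_def)
  have "norm x < 1" unfolding x_def norm_qexp_less_1_iff using z d by simp
  moreover have "unit_series (\<lambda>n. if d dvd n then a n else 0)" using a by (rule unit_series_subset)
  ultimately have "summable (\<lambda>n. (if d dvd n then a n else 0) * x ^ n)" by (simp add: unit_series_def)
  then have "summable (\<lambda>n. (if d dvd d * n then a (d * n) else 0) * x ^ (d * n))"
    using d by (subst summable_mono_reindex[of "\<lambda>n. d * n" "\<lambda>n. (if d dvd n then a n else 0) * x ^ n"])
      (auto simp: strict_mono_def elim!: dvdE)
  then show "summable (\<lambda>n. a (d * n) * qexp z ^ n)" by (simp add: power_mult xd)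
qed

definition plus_support :: "nat \<Rightarrow> (nat \<Rightarrow> complex) \<Rightarrow> bool" where
  "plus_support k a \<longleftrightarrow> (\<forall>n. ((-1) ^ k * int n) mod 4 \<notin> {0, 1} \<longrightarrow> a n = 0)"

text \<open>Apart from the multiples of 4 the support lies in one class modulo 4, that of 1 for even
  \<open>k\<close> and that of 3 for odd \<open>k\<close>.\<close>

lemma plus_supportD:
  assumes "plus_support k a" "a n \<noteq> 0" "\<not> 4 dvd n"
  shows "\<i> ^ n = \<i> * (-1) ^ k"
proof -
  have "((-1) ^ k * int n) mod 4 \<in> {0, 1}" using assms(1,2) by (auto simp: plus_support_def)
  then have "n mod 4 = (if even k then 1 else 3)"
    using assms(3) by (cases "even k") (auto, presburger+)
  then have "n = 4 * (n div 4) + (if even k then 1 else 3)" by presburger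
  then have "\<i> ^ n = (\<i> ^ 4) ^ (n div 4) * \<i> ^ (if even k then 1 else 3)"
    by (metis power_add power_mult)
  moreover have "\<i> ^ 4 = 1" "\<i> ^ 3 = - \<i>" by (simp_all add: power4_eq_xxxx power3_eq_cube)
  ultimately show ?thesis by simp
qed

text \<open>Off the multiples of 4, a shift of \<open>w\<close> by 1 or -1 multiplies all terms by
  one common constant, and the two constants are opposite. Adding the two shifts therefore isolates
  \<open>e0\<close>.\<close>

lemma plus_sections:
  assumes a: "unit_series a" "plus_support k a" and w: "Im w > 0"
  defines "e0 \<equiv> qseries (\<lambda>n. a (4 * n)) w"
  defines "e1 \<equiv> qseries a (w / 4) - e0"
  shows "qseries a ((w + 1) / 4) = e0 + \<i> * (-1) ^ k * e1" "qseries a ((w - 1) / 4) = e0 - \<i> * (-1) ^ k * e1"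
    and "unit_series (\<lambda>n. a (4 * n))"
proof -
  have u: "unit_series (\<lambda>n. a (4 * n))" by (rule unit_series_subseq[OF a(1)]) simp
  then show "unit_series (\<lambda>n. a (4 * n))" .
  define x where "x = qexp (w / 4)"
  have x4: "x ^ 4 = qexp w" using qexp_of_nat_mult[of 4 "w / 4"] by (simp add: x_def)
  have "(\<lambda>n. a (4 * n) * qexp w ^ n) sums e0" unfolding e0_def by (rule qseries_sums[OF u w])
  then have "(\<lambda>n. if 4 dvd 4 * n then a (4 * n) * x ^ (4 * n) else 0) sums e0" by (simp add: power_mult x4)
  then have 0: "(\<lambda>n. if 4 dvd n then a n * x ^ n else 0) sums e0"
    by (subst (asm) sums_mono_reindex[of "\<lambda>n. 4 * n" "\<lambda>n. if 4 dvd n then a n * x ^ n else 0"])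
      (auto simp: strict_mono_def elim!: dvdE)
  have q: "(\<lambda>n. a n * qexp ((w + c) / 4) ^ n) sums qseries a ((w + c) / 4)" if "Im c = 0" for c
    using w that by (intro qseries_sums a) simp
  from sums_diff[OF q[of 0] 0] have 1: "(\<lambda>n. if 4 dvd n then 0 else a n * x ^ n) sums e1"
    by (simp add: e1_def x_def if_distrib[of "\<lambda>y. _ - y"] cong: if_cong)
  have "qexp (1 / 4) = cis (pi / 2)" "qexp (- 1 / 4) = cis (- (pi / 2))"
    by (simp_all add: qexp_def cis_conv_exp mult_ac)
  then have "qexp (1 / 4) = \<i>" "qexp (- 1 / 4) = - \<i>" by (simp_all add: complex_eq_iff)
  then have qx: "qexp ((w + 1) / 4) ^ n = x ^ n * \<i> ^ n" "qexp ((w + -1) / 4) ^ n = x ^ n * (- \<i>) ^ n" for n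
    unfolding add_divide_distrib qexp_add x_def by (simp_all only: power_mult_distrib)
  have i4: "\<i> ^ n = 1" "(- \<i>) ^ n = 1" if "4 dvd n" for n
    using that by (auto simp: power_mult power4_eq_xxxx elim!: dvdE)
  have im: "(- \<i>) ^ n = - (\<i> * (-1) ^ k)" if "a n \<noteq> 0" "\<not> 4 dvd n" for n
  proof -
    have "(- \<i>) ^ n * \<i> ^ n = 1" by (simp flip: power_mult_distrib)
    moreover have "(- (\<i> * (-1) ^ k)) * \<i> ^ n = 1"
      unfolding plus_supportD[OF a(2) that] by (simp add: algebra_simps flip: power_add)
    ultimately have "(- \<i>) ^ n * \<i> ^ n = (- (\<i> * (-1) ^ k)) * \<i> ^ n" by (simp only:)
    then show ?thesis by (simp only: mult_cancel_right) simp
  qed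
  have "a n * qexp ((w + 1) / 4) ^ n = (if 4 dvd n then a n * x ^ n else 0) + \<i> * (-1) ^ k * (if 4 dvd n then 0 else a n * x ^ n)" for n
    unfolding qx using plus_supportD[OF a(2), of n] i4[of n] by auto
  with sums_add[OF 0 sums_mult[OF 1, of "\<i> * (-1) ^ k"]] q[of 1]
  show "qseries a ((w + 1) / 4) = e0 + \<i> * (-1) ^ k * e1" by (simp add: sums_iff)
  have "a n * qexp ((w + -1) / 4) ^ n = (if 4 dvd n then a n * x ^ n else 0) - \<i> * (-1) ^ k * (if 4 dvd n then 0 else a n * x ^ n)" for n
    unfolding qx using im[of n] i4[of n] by (cases "4 dvd n"; cases "a n = 0") simp_all
  with sums_diff[OF 0 sums_mult[OF 1, of "\<i> * (-1) ^ k"]] q[of "-1"]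
  show "qseries a ((w - 1) / 4) = e0 - \<i> * (-1) ^ k * e1" by (simp add: sums_iff)
qed

locale plus_form =
  fixes k :: nat and a :: "nat \<Rightarrow> complex"
  assumes unit: "unit_series a" and support: "plus_support k a"
    and law: "\<And>p q r s z. p * s - q * r = 1 \<Longrightarrow> 4 dvd r \<Longrightarrow> Im z > 0 \<Longrightarrow>
        qseries a (moebius p q r s z) = theta_j r s z ^ (2 * k + 1) * qseries a z"
begin

text \<open>The section is half the sum of the values at \<open>(w + 1) / 4\<close> and
  \<open>(w - 1) / 4\<close>. For \<open>w = - 1 / t\<close> these points are the images of
  \<open>(t - 1) / 4\<close> and \<open>(t + 1) / 4\<close> under the matrices with lower rows
  \<open>(4, 1)\<close> and \<open>(-4, 1)\<close>, and the plus condition at \<open>t\<close>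
  recombines the two values into the one at \<open>t / 4\<close>.\<close>

lemma section_inversion:
  assumes t: "Im t > 0"
  shows "qseries (\<lambda>n. a (4 * n)) (-1/t) = (1 - \<i> * (-1) ^ k) / 2 * csqrt t ^ (2 * k + 1) * qseries a (t/4)"
proof -
  let ?h = "qseries (\<lambda>n. a (4 * n))" and ?s = "(-1) ^ k :: complex" and ?m = "2 * k + 1"
  have t0: "t \<noteq> 0" using t by auto
  have w: "Im (-1/t) > 0" by (rule Im_neg_inverse_pos[OF t])
  have j: "theta_j 4 1 ((t - 1) / 4) = csqrt t" "theta_j (-4) 1 ((t + 1) / 4) = csqrt (- t)"
  proof -
    have "of_int 4 * ((t - 1) / 4) + of_int 1 = t" "of_int (-4) * ((t + 1) / 4) + of_int 1 = - t"
      by (simp_all only: of_int_minus of_int_numeral of_int_1 times_divide_eq_right mult_minus_left) (simp_all add: field_simps)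
    then show "theta_j 4 1 ((t - 1) / 4) = csqrt t" "theta_j (-4) 1 ((t + 1) / 4) = csqrt (- t)"
      by (simp_all only: theta_j_def) (simp_all add: theta_eps_def shimura_symbol_def)
  qed
  have 1: "qseries a ((-1/t + 1) / 4) = csqrt t ^ ?m * qseries a ((t - 1) / 4)"
  proof -
    have "moebius 1 0 4 1 ((t - 1) / 4) = (-1/t + 1) / 4" using t0 by (simp add: moebius_def field_simps)
    moreover have "qseries a (moebius 1 0 4 1 ((t - 1) / 4)) = theta_j 4 1 ((t - 1) / 4) ^ ?m * qseries a ((t - 1) / 4)"
      using t by (intro law) simp_all
    ultimately show ?thesis by (simp only: j)
  qed
  have 2: "qseries a ((-1/t - 1) / 4) = (- \<i> * ?s) * csqrt t ^ ?m * qseries a ((t + 1) / 4)"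
  proof -
    have "moebius 1 0 (-4) 1 ((t + 1) / 4) = (-1/t - 1) / 4" using t0 by (simp add: moebius_def field_simps)
    moreover have "qseries a (moebius 1 0 (-4) 1 ((t + 1) / 4)) = theta_j (-4) 1 ((t + 1) / 4) ^ ?m * qseries a ((t + 1) / 4)"
      using t by (intro law) simp_all
    ultimately have "qseries a ((-1/t - 1) / 4) = csqrt (- t) ^ ?m * qseries a ((t + 1) / 4)"
      by (simp only: j)
    also have "csqrt (- t) ^ ?m = (- \<i> * ?s) * csqrt t ^ ?m"
      unfolding csqrt_minus_upper_half_plane[OF t] power_mult_distrib by (simp add: power_mult)
    finally show ?thesis .
  qed
  note sec = plus_sections(1,2)[OF unit support]
  have "2 * ?h (-1/t) = qseries a ((-1/t + 1) / 4) + qseries a ((-1/t - 1) / 4)"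
    unfolding sec[OF w] by simp
  also have "\<dots> = csqrt t ^ ?m * (qseries a ((t - 1) / 4) - \<i> * ?s * qseries a ((t + 1) / 4))"
    unfolding 1 2 by (simp add: algebra_simps)
  also have "qseries a ((t - 1) / 4) - \<i> * ?s * qseries a ((t + 1) / 4) = (1 - \<i> * ?s) * qseries a (t/4)"
  proof -
    have "\<i> * ?s * (\<i> * ?s) = -1" by (simp add: algebra_simps flip: power_add)
    moreover have "e - x * y - x * (e + x * y) = (1 - x) * (e + y)" if "x * x = -1" for x e y :: complex
    proof -
      have "e - x * y - x * (e + x * y) = e - x * y - x * e - (x * x) * y" by (simp add: algebra_simps)
      then show ?thesis unfolding that by (simp add: algebra_simps)
    qed
    ultimately show ?thesis unfolding sec[OF t] by simp
  qed
  finally show ?thesis by (simp add: mult_ac)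
qed

lemma eigen_imp_zero:
  assumes k: "k > 0" and l: "l \<noteq> 0" "\<And>n. a (4 * n) = l * a n"
  shows "a = (\<lambda>_. 0)"
proof (rule ccontr)
  assume nz: "a \<noteq> (\<lambda>_. 0)"
  let ?s = "(-1) ^ k :: complex" and ?m = "2 * k + 1"
  define C where "C = (1 - \<i> * ?s) / (2 * l)"
  have ss: "?s * ?s = 1" by (simp flip: power_add)
  have inv: "qseries a (-1/t) = C * csqrt t ^ ?m * qseries a (t/4)" if "Im t > 0" for t
  proof -
    have "qseries (\<lambda>n. a (4 * n)) (-1/t) = l * qseries a (-1/t)"
      unfolding qseries_def pseries_def l(2) mult.assoc
      using unit Im_neg_inverse_pos[OF that] by (intro suminf_mult) (auto simp: unit_series_def norm_qexp_less_1_iff)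
    then have "l * qseries a (-1/t) = (1 - \<i> * ?s) / 2 * csqrt t ^ ?m * qseries a (t/4)"
      using section_inversion[OF that] by simp
    then show ?thesis using l(1) by (simp add: C_def field_simps)
  qed
  obtain z0 where z0: "Im z0 > 0" "qseries a z0 \<noteq> 0"
  proof (rule ccontr)
    assume *: "\<not> thesis"
    have "a = (\<lambda>_. 0)"
    proof (rule qseries_unique[OF unit unit_series_0])
      show "qseries a z = qseries (\<lambda>_. 0) z" if "Im z > 0" for z
        using * \<open>\<And>z0. Im z0 > 0 \<Longrightarrow> qseries a z0 \<noteq> 0 \<Longrightarrow> thesis\<close> that
        by (auto simp: qseries_def pseries_def)
    qed
    then show False using nz by simp
  qed
  \<comment> \<open>The inversion applied at \<open>- 4 / t\<close> and then at \<open>t\<close>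
    leads back to \<open>z0\<close>. The product of the two square roots is \<open>2 * \<i>\<close>,
    which gives \<open>C\<^sup>2 * (2 * \<i>) ^ (2 * k + 1) = 1\<close>.\<close>
  have l2: "l\<^sup>2 = 4 ^ k"
  proof -
    define t where "t = 4 * z0"
    have t: "Im t > 0" "t \<noteq> 0" using z0 by (auto simp: t_def)
    have "Im (-4/t) > 0" using Im_neg_inverse_pos[OF z0(1)] by (simp add: t_def)
    moreover have "-1 / (-4/t) = z0" "-4/t / 4 = -1/t" by (simp_all add: t_def)
    ultimately have "qseries a z0 = C * csqrt (-4/t) ^ ?m * qseries a (-1/t)" using inv[of "-4/t"] by (simp only:)
    also have "csqrt (-4/t) = 2 * \<i> / csqrt t" using csqrt_minus_divide[OF t(1), of 2] by simp
    also have "qseries a (-1/t) = C * csqrt t ^ ?m * qseries a z0" using inv[OF t(1)] by (simp add: t_def)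
    also have "C * (2 * \<i> / csqrt t) ^ ?m * (C * csqrt t ^ ?m * qseries a z0) = C\<^sup>2 * (2 * \<i>) ^ ?m * qseries a z0"
      using t(2) by (simp add: power_divide power2_eq_square)
    finally have "C\<^sup>2 * (2 * \<i>) ^ ?m = 1" using z0(2) by simp
    moreover have "(2 * \<i>) ^ ?m = 2 * \<i> * ?s * 4 ^ k"
    proof -
      have "(2 * \<i>)\<^sup>2 = - 1 * (4 :: complex)" by (simp add: power_mult_distrib)
      then have "(2 * \<i>) ^ (2 * k) = (- 1 * 4 :: complex) ^ k" by (simp only: power_mult)
      then have "(2 * \<i>) ^ (2 * k) = ?s * 4 ^ k" by (simp only: power_mult_distrib)
      then show ?thesis by simp
    qed
    moreover have "C\<^sup>2 = (- 2 * \<i> * ?s) / (4 * l\<^sup>2)"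
    proof -
      have "(1 - \<i> * ?s)\<^sup>2 = - 2 * \<i> * ?s" using ss by (simp add: power2_eq_square algebra_simps)
      then show ?thesis by (simp add: C_def power_divide power_mult_distrib)
    qed
    ultimately have "(- 2 * \<i> * ?s) / (4 * l\<^sup>2) * (2 * \<i> * ?s * 4 ^ k) = 1" by (simp only:)
    moreover have "(- 2 * \<i> * ?s) / (4 * l\<^sup>2) * (2 * \<i> * ?s * 4 ^ k) = (?s * ?s) * 4 ^ k / l\<^sup>2"
      by (simp add: field_simps)
    ultimately show ?thesis using l(1) ss by (simp add: field_simps)
  qed
  have nC: "norm C = 2 powr - (real k + 1/2)"
  proof -
    have "(norm l)\<^sup>2 = (2 ^ k)\<^sup>2"
      using arg_cong[OF l2, of norm] power_even_eq[of "2::real" k] power_mult[of "2::real" 2 k] by (simp add: norm_power)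
    then have nl: "norm l = 2 ^ k" by (simp add: power2_eq_iff_nonneg)
    have "norm (1 - \<i> * ?s) = sqrt 2"
      by (cases "even k") (simp_all add: cmod_def)
    then have "norm C = sqrt 2 / (2 * 2 ^ k)" by (simp add: C_def norm_divide norm_mult nl)
    also have "\<dots> = 2 powr (1/2) / (2 powr 1 * 2 powr real k)" by (simp add: powr_half_sqrt powr_realpow)
    also have "\<dots> = 2 powr (1/2 - (1 + real k))" by (simp only: powr_diff powr_add)
    also have "1/2 - (1 + real k) = - (real k + 1/2)" by simp
    finally show ?thesis .
  qed
  have two: "a n = 0" if "n mod 4 = 2" for n
  proof -
    have "((-1) ^ k * int n) mod 4 \<notin> {0, 1}" using that by (cases "even k") (auto, presburger+)
    then show ?thesis using support by (auto simp: plus_support_def)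
  qed
  interpret weil_series k a l C
    by unfold_locales (use unit l two inv nC l2 in auto)
  obtain n0 where "a n0 \<noteq> 0" using nz by auto
  define t where "t = (LEAST n. a n \<noteq> 0)"
  have t: "a t \<noteq> 0" unfolding t_def by (rule LeastI[of _ n0]) fact
  have t': "a n = 0" if "n < t" for n using not_less_Least[of n "\<lambda>n. a n \<noteq> 0"] that by (auto simp: t_def)
  interpret plus_eigenform k a l C t
    by unfold_locales (use k law t t' in auto)
  have k1: "k = 1" using k_less_2 k by simp
  \<comment> \<open>For \<open>k = 1\<close> the index 1 is excluded because -1 is 3 modulo 4; the
    index 2 is excluded for every \<open>k\<close>.\<close>
  have "a n = 0" if "n < 3" for n
  proof -
    have "n = 0 \<or> n = 1 \<or> n = 2" using that by auto
    then show ?thesis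
      using coeff_0 two[of 2] support[unfolded plus_support_def, rule_format, of 1] k1 by auto
  qed
  then show False using weight_3_half_vanishes[OF k1] nz by blast
qed

end

lemma plus_spaceE:
  assumes "f \<in> plus_space k"
  obtains a where "plus_form k a" "\<And>z. Im z > 0 \<Longrightarrow> f z = qseries a z"
proof -
  obtain a where a: "\<And>z. Im z > 0 \<Longrightarrow> (\<lambda>n. a n * qexp z ^ n) sums f z" "plus_support k a"
    using assms by (auto simp: plus_space_def plus_support_def qexp_def)
  have u: "unit_series a"
    by (rule unit_seriesI_of_upper_half_plane) (rule sums_summable[OF a(1)])
  have f: "f z = qseries a z" if "Im z > 0" for z
    using sums_unique2[OF a(1)[OF that] qseries_sums[OF u that]] .
  have "plus_form k a"
  proof (unfold_locales)
    fix p q r s :: int and z :: complex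
    assume g: "p * s - q * r = 1" "4 dvd r" and z: "Im z > 0"
    have "Im (moebius p q r s z) > 0" using g z by (intro Im_moebius_pos) auto
    moreover have "f (moebius p q r s z) = theta_j r s z ^ (2 * k + 1) * f z"
      using assms g z by (auto simp: plus_space_def cusp_forms_def)
    ultimately show "qseries a (moebius p q r s z) = theta_j r s z ^ (2 * k + 1) * qseries a z"
      using f z by simp
  qed (use u a in auto)
  then show ?thesis using f by (rule that)
qed

lemma plus_form_combination:
  assumes "plus_form k a" "plus_form k b"
  shows "plus_form k (\<lambda>n. a n + x * b n)"
proof -
  interpret a: plus_form k a by fact
  interpret b: plus_form k b by fact
  have sums: "(\<lambda>n. (a n + x * b n) * y ^ n) sums (pseries a y + x * pseries b y)" if "norm y < 1" for y
    using sums_add[OF pseries_sums[OF a.unit that] sums_mult[OF pseries_sums[OF b.unit that], of x]]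
    by (simp add: algebra_simps)
  then have u: "unit_series (\<lambda>n. a n + x * b n)" by (auto simp: unit_series_def sums_iff)
  have q: "qseries (\<lambda>n. a n + x * b n) z = qseries a z + x * qseries b z" if "Im z > 0" for z
    using sums[of "qexp z"] that by (simp add: qseries_def pseries_def sums_iff norm_qexp_less_1_iff)
  show ?thesis
  proof (unfold_locales)
    fix p q r s :: int and z :: complex
    assume g: "p * s - q * r = 1" "4 dvd r" and z: "Im z > 0"
    have "Im (moebius p q r s z) > 0" using g z by (intro Im_moebius_pos) auto
    then show "qseries (\<lambda>n. a n + x * b n) (moebius p q r s z) =
        theta_j r s z ^ (2 * k + 1) * qseries (\<lambda>n. a n + x * b n) z"
      using q z a.law[OF g z] b.law[OF g z] by (simp add: algebra_simps)
  qed (use u a.support b.support in \<open>auto simp: plus_support_def\<close>)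
qed

text \<open>
  On plus forms \<open>W4\<close> and the operator \<open>U4\<close> agree up to a nonzero scalar, so a form in the
  intersection and its preimage are exchanged by \<open>U4\<close>.
\<close>

lemma W4_section:
  assumes a: "plus_form k a" and b: "plus_form k b"
    and W: "\<And>z. Im z > 0 \<Longrightarrow> qseries a z = W4 k (qseries b) z"
  obtains \<alpha> \<beta> where "\<alpha> \<noteq> 0" "\<beta> \<noteq> 0" "\<And>n. a (4 * n) = \<alpha> * b n" "\<And>n. b (4 * n) = \<beta> * a n"
proof -
  interpret a: plus_form k a by fact
  interpret b: plus_form k b by fact
  let ?s = "(-1) ^ k :: complex" and ?m = "2 * k + 1"
  have si: "1 - \<i> * ?s \<noteq> 0" by (cases "even k") (auto simp: complex_eq_iff)
  define v :: complex where "v = of_int (shimura_symbol 2 (2 * int k + 1))"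
  have "coprime 2 (2 * int k + 1)" by simp
  then have v: "v \<noteq> 0" using shimura_symbol_cases[of 2 "2 * int k + 1"] by (auto simp: v_def)
  define e :: complex where "e = (1 - \<i>) ^ ?m"
  have "1 - \<i> \<noteq> 0" by (simp add: complex_eq_iff)
  then have e: "e \<noteq> 0" unfolding e_def by (rule power_not_zero)
  have W': "qseries b (-1 / (4 * z)) = e / v * csqrt z ^ ?m * qseries a z" if z: "Im z > 0" for z
  proof -
    define R where "R = csqrt z ^ ?m"
    have "R \<noteq> 0" using z by (auto simp: R_def)
    moreover have "csqrt (- 2 * \<i> * z) ^ ?m = e * R"
      unfolding csqrt_minus_2i_mult[OF z] R_def e_def by (rule power_mult_distrib)
    ultimately show ?thesis
      using W[OF z] z v e by (simp only: W4_def v_def[symmetric] R_def[symmetric]) (simp add: field_simps)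
  qed
  \<comment> \<open>The constant that results from eliminating \<open>qseries a z\<close> between
    \<open>W'\<close> and the section inversion of \<open>a\<close> at \<open>4 * z\<close>.\<close>
  define c where "c = 2 * e / (v * (1 - \<i> * ?s) * 2 ^ ?m)"
  have c: "c \<noteq> 0" using si v e by (simp add: c_def)
  have bc: "qseries b w = c * qseries (\<lambda>n. a (4 * n)) w" if w: "Im w > 0" for w
  proof -
    define z where "z = -1 / (4 * w)"
    have w0: "w \<noteq> 0" using w by auto
    have z: "Im z > 0" using Im_neg_inverse_pos[of "4 * w"] w by (simp add: z_def)
    have zw: "-1 / (4 * z) = w" using w0 by (simp add: z_def)
    have z0: "csqrt z \<noteq> 0" using z by auto
    have "csqrt (4 * z) = 2 * csqrt z" using csqrt_mult_of_real[of 4 z] by simp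
    then have "qseries (\<lambda>n. a (4 * n)) w = (1 - \<i> * ?s) / 2 * (2 ^ ?m * csqrt z ^ ?m) * qseries a z"
      using a.section_inversion[of "4 * z"] z zw by (simp only: power_mult_distrib) simp
    moreover have "y = 2 * e / (v * S * N) * x" if "x = S / 2 * (N * R) * u" "y = e / v * R * u" "S \<noteq> 0" "N \<noteq> 0" for x y S N R u :: complex
      using that v by (simp add: field_simps)
    ultimately show ?thesis
      using W'[OF z] si unfolding zw c_def by (metis power_not_zero zero_neq_numeral)
  qed
  have ub: "unit_series (\<lambda>n. c * a (4 * n))"
    using unit_series_subseq[OF a.unit, of 4] by (auto simp: unit_series_def mult.assoc intro: summable_mult)
  have "b = (\<lambda>n. c * a (4 * n))"
  proof (rule qseries_unique[OF b.unit ub])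
    fix z :: complex assume z: "Im z > 0"
    have "summable (\<lambda>n. a (4 * n) * qexp z ^ n)"
      using unit_series_subseq[OF a.unit, of 4] z by (auto simp: unit_series_def norm_qexp_less_1_iff)
    then show "qseries b z = qseries (\<lambda>n. c * a (4 * n)) z"
      unfolding bc[OF z] by (simp add: qseries_def pseries_def mult.assoc suminf_mult)
  qed
  then have 1: "a (4 * n) = inverse c * b n" for n using c by simp
  \<comment> \<open>The section inversion of \<open>b\<close> at \<open>- 1 / z\<close> involves
    \<open>b\<close> at \<open>- 1 / (4 * z)\<close>, which \<open>W'\<close> expresses by
    \<open>a\<close>; the powers of \<open>csqrt z\<close> cancel.\<close>
  define d where "d = (1 - \<i> * ?s) / 2 * (\<i> ^ ?m * e) / v"
  have d: "d \<noteq> 0" using si v e by (simp add: d_def)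
  have bd: "qseries (\<lambda>n. b (4 * n)) z = d * qseries a z" if z: "Im z > 0" for z
  proof -
    have z': "Im (-1/z) > 0" by (rule Im_neg_inverse_pos[OF z])
    have z0: "z \<noteq> 0" "csqrt z \<noteq> 0" using z by auto
    have "qseries (\<lambda>n. b (4 * n)) z = (1 - \<i> * ?s) / 2 * csqrt (-1/z) ^ ?m * qseries b (-1 / (4 * z))"
      using b.section_inversion[OF z'] z0 by (simp add: mult.commute)
    also have "csqrt (-1/z) = \<i> / csqrt z" using csqrt_minus_divide[OF z, of 1] by simp
    finally show ?thesis
      unfolding W'[OF z] d_def power_divide using z0 by simp
  qed
  have ua: "unit_series (\<lambda>n. d * a n)"
    using a.unit by (auto simp: unit_series_def mult.assoc intro: summable_mult)
  have "(\<lambda>n. b (4 * n)) = (\<lambda>n. d * a n)"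
  proof (rule qseries_unique[OF unit_series_subseq[OF b.unit] ua])
    fix z :: complex assume z: "Im z > 0"
    have "summable (\<lambda>n. a n * qexp z ^ n)"
      using a.unit z by (auto simp: unit_series_def norm_qexp_less_1_iff)
    then show "qseries (\<lambda>n. b (4 * n)) z = qseries (\<lambda>n. d * a n) z"
      unfolding bd[OF z] by (simp add: qseries_def pseries_def mult.assoc suminf_mult)
  qed simp
  then have "b (4 * n) = d * a n" for n by (rule fun_cong)
  then show ?thesis using that[of "inverse c" d] c d 1 by simp
qed

lemma zero_in_plus_space: "(\<lambda>z. 0) \<in> plus_space k"
proof -
  have "vanishes_at_cusps k (\<lambda>z. 0)"
    unfolding vanishes_at_cusps_def
    by (intro allI impI exI[of _ "1::nat"] exI[of _ "\<lambda>_::nat. 0::complex"]) simp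
  then have "(\<lambda>z. 0) \<in> cusp_forms k" by (simp add: cusp_forms_def)
  moreover have "\<exists>a :: nat \<Rightarrow> complex. (\<forall>z\<in>\<H>. (\<lambda>n. a n * exp (2 * of_real pi * \<i> * z) ^ n) sums 0) \<and>
      (\<forall>n. ((-1) ^ k * int n) mod 4 \<notin> {0, 1} \<longrightarrow> a n = 0)"
    by (rule exI[of _ "\<lambda>_. 0"]) simp
  ultimately show ?thesis by (simp only: plus_space_def mem_Collect_eq simp_thms)
qed

theorem proposition6p2:
  fixes k :: nat
  assumes "k > 0"
  shows "plus_space k \<inter> A_plus_space k = {\<lambda>z. 0}"
proof (intro equalityI subsetI)
  fix f assume "f \<in> plus_space k \<inter> A_plus_space k"
  then obtain g where f: "f \<in> plus_space k" and g: "g \<in> plus_space k" and W: "f = W4 k g"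
    by (auto simp: A_plus_space_def)
  obtain a where a: "plus_form k a" "\<And>z. Im z > 0 \<Longrightarrow> f z = qseries a z" by (rule plus_spaceE[OF f]) (rule that)
  obtain b where b: "plus_form k b" "\<And>z. Im z > 0 \<Longrightarrow> g z = qseries b z" by (rule plus_spaceE[OF g]) (rule that)
  have "qseries a z = W4 k (qseries b) z" if z: "Im z > 0" for z
  proof -
    have "Im (- 1 / (4 * z)) > 0" using Im_neg_inverse_pos[of "4 * z"] z by simp
    then have "W4 k g z = W4 k (qseries b) z" using b(2)[of "- 1 / (4 * z)"] by (simp add: W4_def)
    then show ?thesis using a(2)[OF z] W by simp
  qed
  then obtain \<alpha> \<beta> where ab: "\<alpha> \<noteq> 0" "\<beta> \<noteq> 0" "\<And>n. a (4 * n) = \<alpha> * b n" "\<And>n. b (4 * n) = \<beta> * a n"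
    by (rule W4_section[OF a(1) b(1)]) (assumption | rule that)+
  \<comment> \<open>On the span of \<open>a\<close> and \<open>b\<close>, taking every fourth
    coefficient has the eigenvectors \<open>a + x * b\<close> with eigenvalue
    \<open>x * \<beta>\<close> for both square roots \<open>x\<close> of
    \<open>\<alpha> / \<beta>\<close>. Both vanish, and so does their sum
    \<open>2 * a\<close>.\<close>
  have zero: "(\<lambda>n. a n + x * b n) = (\<lambda>_. 0)" if x: "x\<^sup>2 = \<alpha> / \<beta>" for x
  proof (rule plus_form.eigen_imp_zero[OF plus_form_combination[OF a(1) b(1)] assms])
    have x0: "x \<noteq> 0" using x ab by auto
    then show "x * \<beta> \<noteq> 0" using ab by simp
    have "\<alpha> = x * \<beta> * x" using x ab by (simp add: power2_eq_square field_simps)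
    then show "a (4 * n) + x * b (4 * n) = x * \<beta> * (a n + x * b n)" for n
      unfolding ab(3,4) by (simp add: algebra_simps)
  qed
  let ?x = "csqrt (\<alpha> / \<beta>)"
  have "a n = 0" for n
  proof -
    have "a n + ?x * b n = 0" using fun_cong[OF zero[of ?x], of n] by simp
    moreover have "a n + - ?x * b n = 0" using fun_cong[OF zero[of "- ?x"], of n] by simp
    ultimately have "a n + a n = 0" by simp
    then show ?thesis by simp
  qed
  then have "f z = 0" if "Im z > 0" for z using a(2)[OF that] by (simp add: qseries_def pseries_def)
  moreover have "f z = 0" if "\<not> Im z > 0" for z
    using f that by (auto simp: plus_space_def cusp_forms_def)
  ultimately show "f \<in> {\<lambda>z. 0}" by auto
next
  fix f :: "complex \<Rightarrow> complex" assume "f \<in> {\<lambda>z. 0}"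
  moreover have "W4 k (\<lambda>z. 0) = (\<lambda>z. 0)" by (simp add: W4_def fun_eq_iff)
  then have "(\<lambda>z. 0) \<in> A_plus_space k"
    unfolding A_plus_space_def by (rule image_eqI[OF sym zero_in_plus_space])
  ultimately show "f \<in> plus_space k \<inter> A_plus_space k" using zero_in_plus_space by simp
qed

end
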